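(* Let $E\to M$ and $E'\to M$ be smooth vector bundles over the same base manifold $M$, let $K$ be a linear connection on $E$ and $K'$ a linear connection on $E'$, and let $K\otimes K'$ be their tensor product connection on $E\otimes_M E'\to M$. Then, in local linear fiber coordinates $(x^\lambda,y^i)$ on $E$, $(x^\lambda,z^a)$ on $E'$ and the induced ones $(x^\lambda,w^{ia})$ on $E\otimes_M E'$, the curvature of $K\otimes K'$ has the coordinate expression $$R[K\otimes K'] = R[K\otimes K']_{jb}{}^{ia}{}_{\lambda\mu}\,w^{jb}\,\partial_{ia}\otimes d^\lambda\wedge d^\mu=\big(R[K]_j{}^i{}_{\lambda\mu}\,w^{ja}+R[K']_b{}^a{}_{\lambda\mu}\,w^{ib}\big)\,\partial_{ia}\otimes d^\lambda\wedge d^\mu ,$$ i.e. the coefficients of the curvature $R[K\otimes K']$ are $$R[K\otimes K']_{jb}{}^{ia}{}_{\lambda\mu}=R[K]_j{}^i{}_{\lambda\mu}\,\delta^a_b+R[K']_b{}^a{}_{\lambda\mu}\,\delta^i_j .$$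
   Context: All manifolds and maps are smooth; the summation convention over repeated indices is used (sums over all values of the indices). $d^\lambda=dx^\lambda$, $\partial_\lambda=\partial/\partial x^\lambda$, $\partial_i=\partial/\partial y^i$, $\partial_{ia}=\partial/\partial w^{ia}$; $VF$ denotes the vertical bundle of $F\to M$. A linear connection on a vector bundle $E\to M$ is a linear splitting $K:E\to J^1E$ (a vector bundle morphism over $M$ that is a section of $\pi^1_0:J^1E\to E$). Equivalently it is the tangent-valued 1-form $K:E\to T^*M\otimes TE$ projecting onto the identity of $TM$, with coordinate expression $K=d^\lambda\otimes(\partial_\lambda+K_j{}^i{}_\lambda\,y^j\,\partial_i)$, $K_j{}^i{}_\lambda\in C^\infty(M,\mathbb R)$ locally; likewise $K'=d^\lambda\otimes(\partial_\lambda+K'_b{}^a{}_\lambda z^b\partial_a)$ on $E'$. The curvature of a linear connection $K$ is the vertical-valued 2-form $R[K]=-[K,K]:E\to VE\otimes\Lambda^2T^*M$, with $[\,,]$ the Frölicher–Nijenhuis bracket. In coordinates $R[K]=R[K]_j{}^i{}_{\lambda\mu}\,y^j\,\partial_i\otimes d^\lambda\wedge d^\mu$ with coefficients $$R[K]_j{}^i{}_{\lambda\mu}=\partial_\mu K_j{}^i{}_\lambda-\partial_\lambda K_j{}^i{}_\mu+K_j{}^p{}_\mu K_p{}^i{}_\lambda-K_j{}^p{}_\lambda K_p{}^i{}_\mu .$$ The same definition is used for $K'$ and $K\otimes K'$ on their respective bundles. The tensor product connection $K\otimes K':E\otimes_ME'\to J^1(E\otimes_ME')$ is the unique linear connection with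 $(K\otimes K')\circ\otimes=J^1\otimes\circ(K\times K')$ on $E\times_ME'$, where $\otimes:E\times_M E'\to E\otimes_M E'$ is the tensor product map and $J^1\otimes:J^1E\times_MJ^1E'\to J^1(E\otimes_ME')$, $(j^1\Phi,j^1\Phi')\mapsto j^1(\Phi\otimes\Phi')$. Its coordinate expression is $K\otimes K'=d^\lambda\otimes\big(\partial_\lambda+(K_j{}^i{}_\lambda w^{ja}+K'_b{}^a{}_\lambda w^{ib})\partial_{ia}\big)$. *)

theory Defs
  imports "HOL-Analysis.Analysis" "HOL-Library.Function_Algebras"
begin

section \<open>Smooth manifolds\<close>

fun Ck_on :: "nat \<Rightarrow> 'a::real_normed_vector set \<Rightarrow> ('a \<Rightarrow> 'b::real_normed_vector) \<Rightarrow> bool" where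
  "Ck_on 0 S f \<longleftrightarrow> continuous_on S f"
| "Ck_on (Suc k) S f \<longleftrightarrow>
     (\<forall>x\<in>S. f differentiable (at x)) \<and> (\<forall>v. Ck_on k S (\<lambda>x. frechet_derivative f (at x) v))"

definition smooth_on :: "'a::real_normed_vector set \<Rightarrow> ('a \<Rightarrow> 'b::real_normed_vector) \<Rightarrow> bool" where
  "smooth_on S f \<longleftrightarrow> open S \<and> (\<forall>k. Ck_on k S f)"

text \<open>An atlas is a set of charts (domain, coordinate map). The manifold it describes is the union
  of the chart domains, with the topology induced by the charts.\<close>

type_synonym ('p, 'v) atlas = "('p set \<times> ('p \<Rightarrow> 'v)) set"

definition carrier :: "('p, 'v) atlas \<Rightarrow> 'p set" where
  "carrier A = (\<Union>(U, \<phi>)\<in>A. U)"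

definition mopen :: "('p, 'v::real_normed_vector) atlas \<Rightarrow> 'p set \<Rightarrow> bool" where
  "mopen A W \<longleftrightarrow> W \<subseteq> carrier A \<and> (\<forall>(U, \<phi>)\<in>A. open (\<phi> ` (U \<inter> W)))"

definition smooth_manifold :: "('p, 'v::euclidean_space) atlas \<Rightarrow> bool" where
  "smooth_manifold A \<longleftrightarrow>
     (\<forall>(U, \<phi>)\<in>A. inj_on \<phi> U \<and> open (\<phi> ` U)) \<and>
     (\<forall>(U, \<phi>)\<in>A. \<forall>(V, \<psi>)\<in>A. smooth_on (\<phi> ` (U \<inter> V)) (\<psi> \<circ> inv_into U \<phi>)) \<and>
     Hausdorff_space (topology (mopen A)) \<and> second_countable (topology (mopen A))"

text \<open>\<open>smooth_map A B W h\<close>: \<open>h\<close> is a smooth map from the open subset \<open>W\<close> of \<open>A\<close> to \<open>B\<close>. (The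
  openness required by \<^const>\<open>smooth_on\<close> makes the preimages of chart domains open.)\<close>

definition smooth_map :: "('p, 'v::real_normed_vector) atlas \<Rightarrow> ('q, 'w::real_normed_vector) atlas \<Rightarrow>
    'p set \<Rightarrow> ('p \<Rightarrow> 'q) \<Rightarrow> bool" where
  "smooth_map A B W h \<longleftrightarrow> mopen A W \<and> h ` W \<subseteq> carrier B \<and>
     (\<forall>(U, \<phi>)\<in>A. \<forall>(V, \<psi>)\<in>B.
        smooth_on (\<phi> ` (U \<inter> W \<inter> h -` V)) (\<psi> \<circ> h \<circ> inv_into U \<phi>))"

definition flat :: "('v::real_normed_vector, 'v) atlas" where
  "flat = {(UNIV, \<lambda>v. v)}"

definition smooth_at :: "('p, 'v::real_normed_vector) atlas \<Rightarrow> 'p \<Rightarrow> ('p \<Rightarrow> real) \<Rightarrow> bool" where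
  "smooth_at A p f \<longleftrightarrow> (\<exists>W. p \<in> W \<and> smooth_map A flat W f)"

text \<open>Local coordinates on a manifold need not belong to the given atlas, only be compatible with it.\<close>

definition local_chart :: "('p, 'v::euclidean_space) atlas \<Rightarrow> 'p set \<Rightarrow> ('p \<Rightarrow> 'v) \<Rightarrow> bool" where
  "local_chart A U x \<longleftrightarrow> inj_on x U \<and> smooth_map A flat U x \<and> smooth_map flat A (x ` U) (inv_into U x)"

section \<open>Tangent vectors, vector fields, Froelicher--Nijenhuis bracket\<close>

text \<open>A tangent vector is represented by its action on functions that are smooth near its base
  point; on all other functions it is \<open>0\<close>, so that equality of tangent vectors is equality of
  operators. The tangent space consists of the velocities of smooth curves.\<close>

type_synonym 'p tvec = "('p \<Rightarrow> real) \<Rightarrow> real"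

definition velocity :: "('p, 'v::real_normed_vector) atlas \<Rightarrow> (real \<Rightarrow> 'p) \<Rightarrow> 'p tvec" where
  "velocity A c = (\<lambda>f. if smooth_at A (c 0) f then deriv (\<lambda>t. f (c t)) 0 else 0)"

definition tangent_space :: "('p, 'v::real_normed_vector) atlas \<Rightarrow> 'p \<Rightarrow> 'p tvec set" where
  "tangent_space A p = {velocity A c | c. c 0 = p \<and> (\<exists>S. 0 \<in> S \<and> smooth_map flat A S c)}"

definition tangent_map :: "('q, 'w::real_normed_vector) atlas \<Rightarrow> ('p \<Rightarrow> 'q) \<Rightarrow> 'p \<Rightarrow> 'p tvec \<Rightarrow> 'q tvec" where
  "tangent_map B h p u = (\<lambda>f. if smooth_at B (h p) f then u (f \<circ> h) else 0)"

definition vector_field :: "('p, 'v::real_normed_vector) atlas \<Rightarrow> 'p set \<Rightarrow> ('p \<Rightarrow> 'p tvec) \<Rightarrow> bool" where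
  "vector_field A W X \<longleftrightarrow> mopen A W \<and> (\<forall>p\<in>W. X p \<in> tangent_space A p) \<and>
     (\<forall>V f. V \<subseteq> W \<longrightarrow> smooth_map A flat V f \<longrightarrow> smooth_map A flat V (\<lambda>p. X p f))"

text \<open>\<open>coord_vec A U \<phi> v p\<close> is the tangent vector at \<open>p\<close> whose components in the chart \<open>(U, \<phi>)\<close>
  are \<open>v\<close>; for a basis vector \<open>v\<close> this is a coordinate vector.\<close>

definition coord_vec :: "('p, 'v::real_normed_vector) atlas \<Rightarrow> 'p set \<Rightarrow> ('p \<Rightarrow> 'v) \<Rightarrow> 'v \<Rightarrow> 'p \<Rightarrow> 'p tvec" where
  "coord_vec A U \<phi> v p =
     (\<lambda>f. if smooth_at A p f then frechet_derivative (f \<circ> inv_into U \<phi>) (at (\<phi> p)) v else 0)"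

definition lie_bracket :: "('p, 'v::real_normed_vector) atlas \<Rightarrow> ('p \<Rightarrow> 'p tvec) \<Rightarrow> ('p \<Rightarrow> 'p tvec) \<Rightarrow> 'p \<Rightarrow> 'p tvec" where
  "lie_bracket A X Y p =
     (\<lambda>f. if smooth_at A p f then X p (\<lambda>q. Y q f) - Y p (\<lambda>q. X q f) else 0)"

text \<open>The Froelicher--Nijenhuis bracket of two tangent-valued 1-forms, a tangent-valued 2-form
  evaluated here on two vector fields. Wedge products are normalised by
  \<open>(\<alpha> \<and> \<beta>)(X, Y) = \<alpha> X * \<beta> Y - \<alpha> Y * \<beta> X\<close>. Sums and differences of vector fields are
  the pointwise ones of function types.\<close>

type_synonym 'p tv_form = "'p \<Rightarrow> 'p tvec \<Rightarrow> 'p tvec"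

definition app_form :: "'p tv_form \<Rightarrow> ('p \<Rightarrow> 'p tvec) \<Rightarrow> 'p \<Rightarrow> 'p tvec" (infixr "\<cdot>" 80) where
  "P \<cdot> X = (\<lambda>p. P p (X p))"

definition fn_bracket :: "('p, 'v::real_normed_vector) atlas \<Rightarrow> 'p tv_form \<Rightarrow> 'p tv_form \<Rightarrow>
    ('p \<Rightarrow> 'p tvec) \<Rightarrow> ('p \<Rightarrow> 'p tvec) \<Rightarrow> 'p \<Rightarrow> 'p tvec" where
  "fn_bracket A P Q X Y =
     lie_bracket A (P \<cdot> X) (Q \<cdot> Y) - lie_bracket A (P \<cdot> Y) (Q \<cdot> X)
     - Q \<cdot> (lie_bracket A (P \<cdot> X) Y - lie_bracket A (P \<cdot> Y) X)
     - P \<cdot> (lie_bracket A (Q \<cdot> X) Y - lie_bracket A (Q \<cdot> Y) X)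
     + (Q \<cdot> P \<cdot> lie_bracket A X Y + P \<cdot> Q \<cdot> lie_bracket A X Y)"

section \<open>Vector bundles\<close>

record ('m, 'e, 'n, 'k) vbundle =
  base :: "('m, real^'n) atlas"
  proj :: "'e \<Rightarrow> 'm"
  vadd :: "'e \<Rightarrow> 'e \<Rightarrow> 'e"
  vscale :: "real \<Rightarrow> 'e \<Rightarrow> 'e"
  triv :: "('m set \<times> ('e \<Rightarrow> real^'k)) set"

definition fibre :: "('m, 'e, 'n::finite, 'k::finite) vbundle \<Rightarrow> 'm \<Rightarrow> 'e set" where
  "fibre B m = {e. proj B e = m}"

definition total :: "('m, 'e, 'n::finite, 'k::finite) vbundle \<Rightarrow> 'e set" where
  "total B = {e. proj B e \<in> carrier (base B)}"

definition fibrewise_linear :: "('m, 'e, 'n::finite, 'k::finite) vbundle \<Rightarrow> 'm set \<Rightarrow>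
    ('e \<Rightarrow> 'c::real_vector) \<Rightarrow> bool" where
  "fibrewise_linear B U y \<longleftrightarrow> (\<forall>m\<in>U.
     (\<forall>e\<in>fibre B m. \<forall>e'\<in>fibre B m. y (vadd B e e') = y e + y e') \<and>
     (\<forall>r. \<forall>e\<in>fibre B m. y (vscale B r e) = r *\<^sub>R y e))"

text \<open>The fibres are closed under the operations and mapped isomorphically onto \<open>real^'k\<close> by the
  local trivialisations; this makes them vector spaces. Transition functions are smooth.\<close>

definition vector_bundle :: "('m, 'e, 'n::finite, 'k::finite) vbundle \<Rightarrow> bool" where
  "vector_bundle B \<longleftrightarrow>
     smooth_manifold (base B) \<and>
     (\<Union>(U, y)\<in>triv B. U) = carrier (base B) \<and>
     (\<forall>m\<in>carrier (base B). \<forall>e\<in>fibre B m.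
        (\<forall>e'\<in>fibre B m. vadd B e e' \<in> fibre B m) \<and> (\<forall>r. vscale B r e \<in> fibre B m)) \<and>
     (\<forall>(U, y)\<in>triv B. mopen (base B) U \<and> fibrewise_linear B U y \<and>
        (\<forall>m\<in>U. bij_betw y (fibre B m) UNIV)) \<and>
     (\<forall>(U, y)\<in>triv B. \<forall>(V, y')\<in>triv B. \<forall>v.
        smooth_map (base B) flat (U \<inter> V) (\<lambda>m. y' (inv_into (fibre B m) y v)))"

definition fibred_chart :: "('m, 'e, 'n::finite, 'k::finite) vbundle \<Rightarrow> ('m \<Rightarrow> real^'n) \<Rightarrow>
    ('e \<Rightarrow> real^'k) \<Rightarrow> 'e \<Rightarrow> (real^'n) \<times> (real^'k)" where
  "fibred_chart B x y = (\<lambda>e. (x (proj B e), y e))"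

definition total_atlas :: "('m, 'e, 'n::finite, 'k::finite) vbundle \<Rightarrow> ('e, (real^'n) \<times> (real^'k)) atlas" where
  "total_atlas B =
     {(proj B -` (U \<inter> V), fibred_chart B x y) | U x V y. (U, x) \<in> base B \<and> (V, y) \<in> triv B}"

definition linear_fibre_coords :: "('m, 'e, 'n::finite, 'k::finite) vbundle \<Rightarrow> 'm set \<Rightarrow> ('e \<Rightarrow> real^'k) \<Rightarrow> bool" where
  "linear_fibre_coords B U y \<longleftrightarrow>
     mopen (base B) U \<and> fibrewise_linear B U y \<and> (\<forall>m\<in>U. bij_betw y (fibre B m) UNIV) \<and>
     smooth_map (total_atlas B) flat (proj B -` U) y"

section \<open>Linear connections as linear splittings of the first jet bundle\<close>

definition local_section :: "('m, 'e, 'n::finite, 'k::finite) vbundle \<Rightarrow> 'm \<Rightarrow> ('m \<Rightarrow> 'e) \<Rightarrow> bool" where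
  "local_section B m \<Phi> \<longleftrightarrow>
     (\<exists>U. m \<in> U \<and> smooth_map (base B) (total_atlas B) U \<Phi> \<and> (\<forall>q\<in>U. proj B (\<Phi> q) = q))"

text \<open>A 1-jet at \<open>m\<close> is an equivalence class of local sections with the same value and the same
  tangent map at \<open>m\<close>; it is stored together with this value, from which \<open>m\<close> is recovered by the
  projection.\<close>

type_synonym ('m, 'e) jet = "'e \<times> ('m \<Rightarrow> 'e) set"

definition j1 :: "('m, 'e, 'n::finite, 'k::finite) vbundle \<Rightarrow> 'm \<Rightarrow> ('m \<Rightarrow> 'e) \<Rightarrow> ('m, 'e) jet" where
  "j1 B m \<Phi> = (\<Phi> m, {\<Psi>. local_section B m \<Psi> \<and> \<Psi> m = \<Phi> m \<and>
     (\<forall>v\<in>tangent_space (base B) m.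
        tangent_map (total_atlas B) \<Psi> m v = tangent_map (total_atlas B) \<Phi> m v)})"

definition J1 :: "('m, 'e, 'n::finite, 'k::finite) vbundle \<Rightarrow> ('m, 'e) jet set" where
  "J1 B = {j1 B m \<Phi> | m \<Phi>. m \<in> carrier (base B) \<and> local_section B m \<Phi>}"

definition rep :: "('m, 'e) jet \<Rightarrow> 'm \<Rightarrow> 'e" where
  "rep \<theta> = (SOME \<Phi>. \<Phi> \<in> snd \<theta>)"

definition jet_coords :: "('m, 'e, 'n::finite, 'k::finite) vbundle \<Rightarrow> 'm set \<Rightarrow> ('m \<Rightarrow> real^'n) \<Rightarrow>
    ('e \<Rightarrow> real^'k) \<Rightarrow> ('m, 'e) jet \<Rightarrow> (real^'n) \<times> (real^'k) \<times> ((real^'k)^'n)" where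
  "jet_coords B U x y \<theta> =
     (x (proj B (fst \<theta>)), y (fst \<theta>),
      \<chi> l. frechet_derivative (y \<circ> rep \<theta> \<circ> inv_into U x) (at (x (proj B (fst \<theta>)))) (axis l 1))"

definition jet_atlas :: "('m, 'e, 'n::finite, 'k::finite) vbundle \<Rightarrow>
    (('m, 'e) jet, (real^'n) \<times> (real^'k) \<times> ((real^'k)^'n)) atlas" where
  "jet_atlas B =
     {({\<theta> \<in> J1 B. proj B (fst \<theta>) \<in> U \<inter> V}, jet_coords B U x y) | U x V y. (U, x) \<in> base B \<and> (V, y) \<in> triv B}"

definition jet_add :: "('m, 'e, 'n::finite, 'k::finite) vbundle \<Rightarrow> ('m, 'e) jet \<Rightarrow> ('m, 'e) jet \<Rightarrow> ('m, 'e) jet" where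
  "jet_add B \<theta> \<eta> = j1 B (proj B (fst \<theta>)) (\<lambda>q. vadd B (rep \<theta> q) (rep \<eta> q))"

definition jet_scale :: "('m, 'e, 'n::finite, 'k::finite) vbundle \<Rightarrow> real \<Rightarrow> ('m, 'e) jet \<Rightarrow> ('m, 'e) jet" where
  "jet_scale B r \<theta> = j1 B (proj B (fst \<theta>)) (\<lambda>q. vscale B r (rep \<theta> q))"

definition linear_connection :: "('m, 'e, 'n::finite, 'k::finite) vbundle \<Rightarrow> ('e \<Rightarrow> ('m, 'e) jet) \<Rightarrow> bool" where
  "linear_connection B K \<longleftrightarrow>
     smooth_map (total_atlas B) (jet_atlas B) (total B) K \<and>
     (\<forall>e\<in>total B. K e \<in> J1 B \<and> fst (K e) = e) \<and>
     (\<forall>e\<in>total B. \<forall>e'\<in>total B. proj B e = proj B e' \<longrightarrow> K (vadd B e e') = jet_add B (K e) (K e')) \<and>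
     (\<forall>r. \<forall>e\<in>total B. K (vscale B r e) = jet_scale B r (K e))"

text \<open>The tangent-valued 1-form \<open>E \<rightarrow> T\<^sup>*M \<otimes> TE\<close> of a connection, as a 1-form on the total space:
  if \<open>K e\<close> is the 1-jet of \<open>\<Phi>\<close>, then \<open>u\<close> in \<open>T\<^sub>e E\<close> is sent to \<open>T\<Phi> (Tp u)\<close> with \<open>p\<close> the
  bundle projection.\<close>

definition connection_form :: "('m, 'e, 'n::finite, 'k::finite) vbundle \<Rightarrow> ('e \<Rightarrow> ('m, 'e) jet) \<Rightarrow> 'e tv_form" where
  "connection_form B K e u =
     tangent_map (total_atlas B) (rep (K e)) (proj B e) (tangent_map (base B) (proj B) e u)"

definition curvature :: "('m, 'e, 'n::finite, 'k::finite) vbundle \<Rightarrow> ('e \<Rightarrow> ('m, 'e) jet) \<Rightarrow>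
    ('e \<Rightarrow> 'e tvec) \<Rightarrow> ('e \<Rightarrow> 'e tvec) \<Rightarrow> 'e \<Rightarrow> 'e tvec" where
  "curvature B K X Y = - fn_bracket (total_atlas B) (connection_form B K) (connection_form B K) X Y"

section \<open>Coordinate expressions\<close>

definition d_base :: "('m, 'e, 'n::finite, 'k::finite) vbundle \<Rightarrow> ('m \<Rightarrow> real^'n) \<Rightarrow> 'n \<Rightarrow> 'e tvec \<Rightarrow> real" where
  "d_base B x l u = u (\<lambda>e. x (proj B e) $ l)"

definition base_vec :: "('m, 'e, 'n::finite, 'k::finite) vbundle \<Rightarrow> 'm set \<Rightarrow> ('m \<Rightarrow> real^'n) \<Rightarrow>
    ('e \<Rightarrow> real^'k) \<Rightarrow> 'n \<Rightarrow> 'e \<Rightarrow> 'e tvec" where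
  "base_vec B U x y l = coord_vec (total_atlas B) (proj B -` U) (fibred_chart B x y) (axis l 1, 0)"

definition fibre_vec :: "('m, 'e, 'n::finite, 'k::finite) vbundle \<Rightarrow> 'm set \<Rightarrow> ('m \<Rightarrow> real^'n) \<Rightarrow>
    ('e \<Rightarrow> real^'k) \<Rightarrow> 'k \<Rightarrow> 'e \<Rightarrow> 'e tvec" where
  "fibre_vec B U x y i = coord_vec (total_atlas B) (proj B -` U) (fibred_chart B x y) (0, axis i 1)"

text \<open>The vertical-valued 2-form \<open>C i l k \<partial>\<^sub>i \<otimes> dx\<^sup>l \<and> dx\<^sup>k\<close>, summed over all values of
  \<open>i, l, k\<close>, whose coefficients \<open>C i l k\<close> are functions on the total space.\<close>

definition vertical_2form :: "('m, 'e, 'n::finite, 'k::finite) vbundle \<Rightarrow> 'm set \<Rightarrow> ('m \<Rightarrow> real^'n) \<Rightarrow>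
    ('e \<Rightarrow> real^'k) \<Rightarrow> ('k \<Rightarrow> 'n \<Rightarrow> 'n \<Rightarrow> 'e \<Rightarrow> real) \<Rightarrow>
    ('e \<Rightarrow> 'e tvec) \<Rightarrow> ('e \<Rightarrow> 'e tvec) \<Rightarrow> 'e \<Rightarrow> 'e tvec" where
  "vertical_2form B U x y C X Y e = (\<lambda>f. \<Sum>i\<in>UNIV. \<Sum>l\<in>UNIV. \<Sum>k\<in>UNIV.
     C i l k e * (d_base B x l (X e) * d_base B x k (Y e) - d_base B x l (Y e) * d_base B x k (X e))
       * fibre_vec B U x y i e f)"

text \<open>The coefficients \<open>R\<^sub>j\<^sup>i\<^sub>l\<^sub>k\<close> in
  \<open>R[K] = R\<^sub>j\<^sup>i\<^sub>l\<^sub>k y\<^sup>j \<partial>\<^sub>i \<otimes> dx\<^sup>l \<and> dx\<^sup>k\<close> (antisymmetric in \<open>l, k\<close>). As the sum is over all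
  \<open>l\<close> and \<open>k\<close>, the value of \<open>dy\<^sup>i\<close> on \<open>R[K](\<partial>\<^sub>l, \<partial>\<^sub>k)\<close> is \<open>2 R\<^sub>j\<^sup>i\<^sub>l\<^sub>k y\<^sup>j\<close>;
  the coefficient is read off at the \<open>j\<close>-th basis vector of the fibre over \<open>m\<close>.\<close>

definition curv_coeff :: "('m, 'e, 'n::finite, 'k::finite) vbundle \<Rightarrow> ('e \<Rightarrow> ('m, 'e) jet) \<Rightarrow>
    'm set \<Rightarrow> ('m \<Rightarrow> real^'n) \<Rightarrow> ('e \<Rightarrow> real^'k) \<Rightarrow> 'k \<Rightarrow> 'k \<Rightarrow> 'n \<Rightarrow> 'n \<Rightarrow> 'm \<Rightarrow> real" where
  "curv_coeff B K U x y j i l k m =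
     curvature B K (base_vec B U x y l) (base_vec B U x y k)
       (inv_into (fibre B m) y (axis j 1)) (\<lambda>e. y e $ i) / 2"

section \<open>Tensor products\<close>

definition fibrewise_bilinear :: "('m, 'e, 'n::finite, 'i::finite) vbundle \<Rightarrow> ('m, 'f, 'n, 'a::finite) vbundle \<Rightarrow>
    'm \<Rightarrow> ('e \<Rightarrow> 'f \<Rightarrow> real) \<Rightarrow> bool" where
  "fibrewise_bilinear E E' m \<beta> \<longleftrightarrow>
     (\<forall>e\<in>fibre E m. fibrewise_linear E' {m} (\<beta> e)) \<and>
     (\<forall>e'\<in>fibre E' m. fibrewise_linear E {m} (\<lambda>e. \<beta> e e'))"

definition induced_fibre_coords :: "('m, 'e, 'n::finite, 'i::finite) vbundle \<Rightarrow> ('m, 'f, 'n, 'a::finite) vbundle \<Rightarrow>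
    ('m, 't, 'n, 'i \<times> 'a) vbundle \<Rightarrow> ('e \<Rightarrow> 'f \<Rightarrow> 't) \<Rightarrow> 'm set \<Rightarrow>
    ('e \<Rightarrow> real^'i) \<Rightarrow> ('f \<Rightarrow> real^'a) \<Rightarrow> ('t \<Rightarrow> real^('i \<times> 'a)) \<Rightarrow> bool" where
  "induced_fibre_coords E E' T tens U y z w \<longleftrightarrow> fibrewise_linear T U w \<and>
     (\<forall>m\<in>U. \<forall>e\<in>fibre E m. \<forall>e'\<in>fibre E' m. \<forall>i a. w (tens e e') $ (i, a) = y e $ i * z e' $ a)"

text \<open>\<open>T\<close> with the fibrewise bilinear map \<open>tens\<close> is a tensor product bundle of \<open>E\<close> and \<open>E'\<close>: each
  fibre has the universal property of the tensor product (the fibres being finite-dimensional,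
  it suffices to test it on real-valued bilinear maps), and the smooth structure is the one for
  which the fibre coordinates induced by those of \<open>E\<close> and \<open>E'\<close> are fibre coordinates.\<close>

definition tensor_bundle :: "('m, 'e, 'n::finite, 'i::finite) vbundle \<Rightarrow> ('m, 'f, 'n, 'a::finite) vbundle \<Rightarrow>
    ('m, 't, 'n, 'i \<times> 'a) vbundle \<Rightarrow> ('e \<Rightarrow> 'f \<Rightarrow> 't) \<Rightarrow> bool" where
  "tensor_bundle E E' T tens \<longleftrightarrow>
     vector_bundle T \<and> base T = base E \<and>
     (\<forall>m\<in>carrier (base E).
        (\<forall>e\<in>fibre E m. \<forall>e'\<in>fibre E' m. tens e e' \<in> fibre T m) \<and>
        (\<forall>e\<in>fibre E m. \<forall>d\<in>fibre E m. \<forall>e'\<in>fibre E' m.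
           tens (vadd E e d) e' = vadd T (tens e e') (tens d e')) \<and>
        (\<forall>e\<in>fibre E m. \<forall>e'\<in>fibre E' m. \<forall>d'\<in>fibre E' m.
           tens e (vadd E' e' d') = vadd T (tens e e') (tens e d')) \<and>
        (\<forall>r. \<forall>e\<in>fibre E m. \<forall>e'\<in>fibre E' m.
           tens (vscale E r e) e' = vscale T r (tens e e') \<and>
           tens e (vscale E' r e') = vscale T r (tens e e')) \<and>
        (\<forall>\<beta>. fibrewise_bilinear E E' m \<beta> \<longrightarrow>
           (\<exists>h. fibrewise_linear T {m} h \<and> (\<forall>e\<in>fibre E m. \<forall>e'\<in>fibre E' m. h (tens e e') = \<beta> e e') \<and>
              (\<forall>h'. fibrewise_linear T {m} h' \<longrightarrow>
                 (\<forall>e\<in>fibre E m. \<forall>e'\<in>fibre E' m. h' (tens e e') = \<beta> e e') \<longrightarrow>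
                 (\<forall>t\<in>fibre T m. h' t = h t))))) \<and>
     (\<forall>U y z w. linear_fibre_coords E U y \<longrightarrow> linear_fibre_coords E' U z \<longrightarrow>
        induced_fibre_coords E E' T tens U y z w \<longrightarrow> linear_fibre_coords T U w)"

definition jet_tensor :: "('m, 'e, 'n::finite, 'i::finite) vbundle \<Rightarrow> ('m, 't, 'n, 'i \<times> 'a::finite) vbundle \<Rightarrow>
    ('e \<Rightarrow> 'f \<Rightarrow> 't) \<Rightarrow> ('m, 'e) jet \<Rightarrow> ('m, 'f) jet \<Rightarrow> ('m, 't) jet" where
  "jet_tensor E T tens \<theta> \<eta> = j1 T (proj E (fst \<theta>)) (\<lambda>q. tens (rep \<theta> q) (rep \<eta> q))"

definition tensor_connection :: "('m, 'e, 'n::finite, 'i::finite) vbundle \<Rightarrow> ('m, 'f, 'n, 'a::finite) vbundle \<Rightarrow>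
    ('m, 't, 'n, 'i \<times> 'a) vbundle \<Rightarrow> ('e \<Rightarrow> 'f \<Rightarrow> 't) \<Rightarrow>
    ('e \<Rightarrow> ('m, 'e) jet) \<Rightarrow> ('f \<Rightarrow> ('m, 'f) jet) \<Rightarrow> ('t \<Rightarrow> ('m, 't) jet) \<Rightarrow> bool" where
  "tensor_connection E E' T tens K K' L \<longleftrightarrow>
     linear_connection T L \<and>
     (\<forall>e\<in>total E. \<forall>e'\<in>total E'. proj E e = proj E' e' \<longrightarrow>
        L (tens e e') = jet_tensor E T tens (K e) (K' e'))"

end

theory Submission
  imports Defs
begin

text \<open>In coordinates \<open>(s, v)\<close> on the total space, with \<open>s\<close> the base point and \<open>v\<close> the fibre
  coordinate, a linear connection is a smooth family \<open>G s a v\<close>, linear in the base direction \<open>a\<close> and,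
  because the connection is linear, also in \<open>v\<close>: the horizontal lift of \<open>a\<close> to the point \<open>(s, v)\<close> is
  \<open>(a, G s a v)\<close>, so the connection form is \<open>P (a, b) = (a, G s a v)\<close>. It is a projection whose
  kernel consists of the vertical vectors.

  Expanding the Froelicher--Nijenhuis bracket of \<open>P\<close> with itself, everything cancels except
  \<open>[P, P](X, Y) = 2 ([PX, PY] - P [PX, PY])\<close>, twice the vertical part of the bracket of the horizontal
  parts. In this vertical part the derivatives of \<open>X\<close> and \<open>Y\<close> drop out, and the curvature at
  \<open>(s, v)\<close> on vectors with base components \<open>a\<close> and \<open>b\<close> is the vertical vector \<open>2 \<Omega> s a b v\<close>, where
  \<open>\<Omega> s a b\<close> is the derivative of \<open>G a\<close> along \<open>b\<close> minus that of \<open>G b\<close> along \<open>a\<close>, plus the commutator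
  of the endomorphisms \<open>G s a\<close> and \<open>G s b\<close> (lemma \<open>curvature_in_coords\<close>). The coefficients of the
  curvature are the matrix entries of \<open>\<Omega>\<close> on the basis vectors.

  For the tensor product connection, differentiating a tensor product of sections gives the Leibniz
  rule: \<open>G s a\<close> on \<open>E \<otimes> E'\<close> is \<open>G s a \<otimes> 1 + 1 \<otimes> G' s a\<close> (lemma \<open>G_tensor\<close>). In the commutator of
  two such operators the mixed terms \<open>G a \<otimes> G' b\<close> cancel, hence \<open>\<Omega>\<close> obeys the same rule (lemma
  \<open>\<Omega>_tensor\<close>). On the basis vector with indices \<open>(j, b)\<close>, which is a decomposable tensor, this is the
  claim.

  Three facts lead from tangent vectors as operators, atlases and jets to these coordinates. First,
  the Lie bracket of vector fields has its usual coordinate formula (lemma \<open>lie_bracket_in_chart\<close>);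
  this rests on the symmetry of second derivatives. Secondly, a chart of the base together with linear
  fibre coordinates is a chart of the total space (lemma \<open>local_chart_fibred_chart\<close>); the inverse is
  smooth by Cramer's rule. Thirdly, \<open>G\<close> is smooth in any such coordinates (lemma \<open>G_smooth\<close>): the jet
  coordinates of the connection are smooth in the charts of the atlas, hence the connection form maps
  smooth vector fields to smooth vector fields, a statement free of coordinates, and \<open>G\<close> is read off
  from the images of the coordinate vector fields.\<close>

section \<open>Smooth maps between Euclidean spaces\<close>

lemma Ck_on_cong:
  assumes "open S" "\<And>x. x \<in> S \<Longrightarrow> f x = g x" "Ck_on k S f"
  shows "Ck_on k S g"
  using assms(2,3)
proof (induction k arbitrary: f g)
  case 0
  then show ?case using continuous_on_cong[of S S f g] by simp
next
  case (Suc k)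
  have d: "(g has_derivative frechet_derivative f (at x)) (at x)" if "x \<in> S" for x
    using has_derivative_transform_within_open[OF iffD1[OF frechet_derivative_works] assms(1) that] Suc.prems that
    by (metis Ck_on.simps(2))
  have eq: "frechet_derivative g (at x) = frechet_derivative f (at x)" if "x \<in> S" for x
    using frechet_derivative_at[OF d[OF that]] by simp
  show ?case
    unfolding Ck_on.simps
  proof (intro conjI ballI allI)
    fix x assume "x \<in> S" then show "g differentiable (at x)" using d by (auto simp: differentiable_def)
  next
    fix v show "Ck_on k S (\<lambda>x. frechet_derivative g (at x) v)"
      by (rule Suc.IH[of "\<lambda>x. frechet_derivative f (at x) v"]) (use Suc.prems eq in auto)
  qed
qed

lemma Ck_on_lower: "Ck_on (Suc k) S f \<Longrightarrow> Ck_on k S f"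
proof (induction k arbitrary: f)
  case 0
  then show ?case
    by (auto intro!: differentiable_imp_continuous_on differentiable_at_imp_differentiable_on)
next
  case (Suc k)
  have *: "Ck_on (Suc k) S f \<longleftrightarrow>
     (\<forall>x\<in>S. f differentiable (at x)) \<and> (\<forall>v. Ck_on k S (\<lambda>x. frechet_derivative f (at x) v))" for k
    by simp
  show ?case using Suc.prems Suc.IH unfolding *[of k] *[of "Suc k"] by blast
qed

lemma Ck_on_subset: "Ck_on k S f \<Longrightarrow> T \<subseteq> S \<Longrightarrow> Ck_on k T f"
  by (induction k arbitrary: f) (auto intro: continuous_on_subset)

text \<open>Membership in \<open>Ck\<close> is a condition at each point of the set on the germ of the function there,
  so it can be checked on neighbourhoods.\<close>

lemma Ck_on_UN:
  assumes "\<And>x. x \<in> S \<Longrightarrow> \<exists>T. open T \<and> x \<in> T \<and> Ck_on k T f"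
  shows "Ck_on k S f"
  using assms
proof (induction k arbitrary: f)
  case 0
  show ?case unfolding Ck_on.simps
  proof (rule continuous_at_imp_continuous_on, rule ballI)
    fix x assume "x \<in> S"
    then obtain T where "open T" "x \<in> T" "continuous_on T f" using 0 by auto
    then show "isCont f x" by (simp add: continuous_on_eq_continuous_at)
  qed
next
  case (Suc k)
  show ?case unfolding Ck_on.simps
  proof (intro conjI ballI allI)
    fix x assume "x \<in> S" then show "f differentiable at x" using Suc.prems by (metis Ck_on.simps(2))
  next
    fix v show "Ck_on k S (\<lambda>x. frechet_derivative f (at x) v)"
      by (rule Suc.IH) (use Suc.prems in fastforce)
  qed
qed

lemma Ck_on_const: "Ck_on k S (\<lambda>x. c)"
  by (induction k arbitrary: c) auto

lemma Ck_on_linear: "bounded_linear f \<Longrightarrow> Ck_on k S f"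
proof (induction k)
  case 0 then show ?case by (simp add: linear_continuous_on)
next
  case (Suc k)
  then have "f differentiable at x" "frechet_derivative f (at x) = f" for x
    using bounded_linear_imp_has_derivative frechet_derivative_at differentiable_def by metis+
  then show ?case by (simp add: Ck_on_const)
qed

lemma Ck_on_add:
  "open S \<Longrightarrow> Ck_on k S f \<Longrightarrow> Ck_on k S g \<Longrightarrow> Ck_on k S (\<lambda>x. f x + g x)"
proof (induction k arbitrary: f g)
  case 0 then show ?case by (simp add: continuous_on_add)
next
  case (Suc k)
  have d: "((\<lambda>x. f x + g x) has_derivative
     (\<lambda>h. frechet_derivative f (at x) h + frechet_derivative g (at x) h)) (at x)" if "x \<in> S" for x
    by (rule has_derivative_add; rule iffD1[OF frechet_derivative_works]) (use Suc.prems that in auto)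
  have D: "Ck_on k S (\<lambda>x. frechet_derivative f (at x) v + frechet_derivative g (at x) v)" for v
    by (intro Suc.IH) (use Suc.prems in auto)
  have "Ck_on k S (\<lambda>x. frechet_derivative (\<lambda>x. f x + g x) (at x) v)" for v
    by (rule Ck_on_cong[OF Suc.prems(1) _ D[of v]]) (simp add: frechet_derivative_at[OF d, symmetric])
  then show ?case using d by (auto simp: differentiable_def)
qed

lemma Ck_on_bilinear:
  assumes "bounded_bilinear bil" "open S"
  shows "Ck_on k S f \<Longrightarrow> Ck_on k S g \<Longrightarrow> Ck_on k S (\<lambda>x. bil (f x) (g x))"
proof (induction k arbitrary: f g)
  case 0 then show ?case by (simp add: bounded_bilinear.continuous_on[OF assms(1)])
next
  case (Suc k)
  have d: "((\<lambda>x. bil (f x) (g x)) has_derivative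
     (\<lambda>h. bil (f x) (frechet_derivative g (at x) h) + bil (frechet_derivative f (at x) h) (g x))) (at x)"
    if "x \<in> S" for x
    by (rule bounded_bilinear.FDERIV[OF assms(1)]; rule iffD1[OF frechet_derivative_works]) (use Suc.prems that in auto)
  have D: "Ck_on k S (\<lambda>x. bil (f x) (frechet_derivative g (at x) v) + bil (frechet_derivative f (at x) v) (g x))" for v
    by (intro Ck_on_add assms Suc.IH) (use Suc.prems Ck_on_lower in auto)
  have "Ck_on k S (\<lambda>x. frechet_derivative (\<lambda>x. bil (f x) (g x)) (at x) v)" for v
    by (rule Ck_on_cong[OF assms(2) _ D[of v]]) (simp add: frechet_derivative_at[OF d, symmetric])
  then show ?case using d by (auto simp: differentiable_def)
qed

lemma Ck_on_sum: fixes f :: "'i \<Rightarrow> 'a::real_normed_vector \<Rightarrow> 'b::real_normed_vector" shows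
  "open S \<Longrightarrow> (\<And>i. i \<in> I \<Longrightarrow> Ck_on k S (f i)) \<Longrightarrow> Ck_on k S (\<lambda>x. \<Sum>i\<in>I. f i x)"
  by (induction I rule: infinite_finite_induct) (auto intro: Ck_on_const Ck_on_add)

text \<open>\<^const>\<open>Ck_on\<close> controls derivatives in fixed directions; with this identity a derivative in a
  varying direction becomes a combination of those.\<close>

lemma linear_eq_sum_Basis:
  fixes D :: "'b::euclidean_space \<Rightarrow> 'c::real_vector"
  assumes "linear D"
  shows "(\<Sum>b\<in>Basis. (w \<bullet> b) *\<^sub>R D b) = D w"
proof -
  have "D (\<Sum>b\<in>Basis. (w \<bullet> b) *\<^sub>R b) = (\<Sum>b\<in>Basis. (w \<bullet> b) *\<^sub>R D b)"
    by (simp only: linear_sum[OF assms] linear_scale[OF assms])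
  then show ?thesis by (simp only: euclidean_representation)
qed

lemma linear_eq_sum_axis:
  fixes f :: "real^'n::finite \<Rightarrow> 'b::real_vector"
  assumes "linear f" shows "f a = (\<Sum>l\<in>UNIV. (a $ l) *\<^sub>R f (axis l 1))"
proof -
  have "f (\<Sum>l\<in>UNIV. (a $ l) *\<^sub>R axis l 1) = (\<Sum>l\<in>UNIV. (a $ l) *\<^sub>R f (axis l 1))"
    by (simp only: linear_sum[OF assms] linear_scale[OF assms])
  moreover have "(\<Sum>l\<in>UNIV. (a $ l) *\<^sub>R axis l 1) = a"
    using basis_expansion[of a] by (simp add: scalar_mult_eq_scaleR)
  ultimately show ?thesis by simp
qed

text \<open>By the chain rule a directional derivative of the composite is a combination, with
  coefficients the components of a derivative of \<open>f\<close>, of composites of \<open>f\<close> with directional derivatives of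
  \<open>g\<close>. The induction therefore runs over all \<open>g\<close>, with \<open>f\<close> fixed.\<close>

lemma Ck_on_compose:
  fixes f :: "'a::real_normed_vector \<Rightarrow> 'b::euclidean_space" and g :: "'b \<Rightarrow> 'c::real_normed_vector"
  assumes "open S" "open T" "f ` S \<subseteq> T"
  shows "Ck_on k S f \<Longrightarrow> Ck_on k T g \<Longrightarrow> Ck_on k S (g \<circ> f)"
proof (induction k arbitrary: g)
  case 0 then show ?case using assms
    by (simp only: Ck_on.simps) (meson continuous_on_compose continuous_on_subset)
next
  case (Suc k)
  have d: "(g \<circ> f has_derivative frechet_derivative g (at (f x)) \<circ> frechet_derivative f (at x)) (at x)"
    if "x \<in> S" for x
    by (rule diff_chain_at; rule iffD1[OF frechet_derivative_works]) (use Suc.prems that assms in auto)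
  have fk: "Ck_on k S f" using Suc.prems Ck_on_lower by blast
  have D: "Ck_on k S (\<lambda>x. \<Sum>b\<in>Basis. (frechet_derivative f (at x) v \<bullet> b) *\<^sub>R
       ((\<lambda>y. frechet_derivative g (at y) b) \<circ> f) x)" for v
    by (intro Ck_on_sum Ck_on_bilinear[OF bounded_bilinear_scaleR] assms(1) Suc.IH fk
         Ck_on_bilinear[OF bounded_bilinear_inner] Ck_on_const) (use Suc.prems in auto)
  have "Ck_on k S (\<lambda>x. frechet_derivative (g \<circ> f) (at x) v)" for v
  proof (rule Ck_on_cong[OF assms(1) _ D[of v]])
    fix x assume x: "x \<in> S"
    have lin: "linear (frechet_derivative g (at (f x)))"
      using Suc.prems assms x by (intro linear_frechet_derivative) auto
    show "(\<Sum>b\<in>Basis. (frechet_derivative f (at x) v \<bullet> b) *\<^sub>R ((\<lambda>y. frechet_derivative g (at y) b) \<circ> f) x)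
      = frechet_derivative (g \<circ> f) (at x) v"
      unfolding frechet_derivative_at[OF d[OF x], symmetric]
      by (simp only: linear_eq_sum_Basis[OF lin] o_def)
  qed
  then show ?case using d unfolding Ck_on.simps differentiable_def by blast
qed

lemma Ck_on_inverse:
  fixes f :: "'a::real_normed_vector \<Rightarrow> real"
  assumes "open S" "\<And>x. x \<in> S \<Longrightarrow> f x \<noteq> 0"
  shows "Ck_on k S f \<Longrightarrow> Ck_on k S (\<lambda>x. inverse (f x))"
proof (induction k)
  case 0 then show ?case using assms by (auto intro: continuous_on_inverse)
next
  case (Suc k)
  have d: "((\<lambda>x. inverse (f x)) has_derivative
     (\<lambda>h. - (inverse (f x) * frechet_derivative f (at x) h * inverse (f x)))) (at x)" if "x \<in> S" for x
    by (rule Deriv.has_derivative_inverse) (use Suc.prems that assms in \<open>auto simp: frechet_derivative_works[symmetric]\<close>)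
  have m: "Ck_on k S (\<lambda>x. a x * b x)" if "Ck_on k S a" "Ck_on k S b" for a b :: "'a \<Rightarrow> real"
    by (rule Ck_on_bilinear[OF bounded_bilinear_mult assms(1) that])
  have D: "Ck_on k S (\<lambda>x. inverse (f x) * frechet_derivative f (at x) v * inverse (f x) * (- 1))" for v
    by (intro m Suc.IH Ck_on_const) (use Suc.prems Ck_on_lower in auto)
  have "Ck_on k S (\<lambda>x. frechet_derivative (\<lambda>x. inverse (f x)) (at x) v)" for v
    by (rule Ck_on_cong[OF assms(1) _ D[of v]]) (simp add: frechet_derivative_at[OF d, symmetric])
  then show ?case using d by (auto simp: differentiable_def)
qed

lemma Ck_on_Pair:
  "open S \<Longrightarrow> Ck_on k S f \<Longrightarrow> Ck_on k S g \<Longrightarrow> Ck_on k S (\<lambda>x. (f x, g x))"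
proof (induction k arbitrary: f g)
  case 0 then show ?case by (simp add: continuous_on_Pair)
next
  case (Suc k)
  have d: "((\<lambda>x. (f x, g x)) has_derivative
     (\<lambda>h. (frechet_derivative f (at x) h, frechet_derivative g (at x) h))) (at x)" if "x \<in> S" for x
    by (rule has_derivative_Pair; rule iffD1[OF frechet_derivative_works]) (use Suc.prems that in auto)
  have D: "Ck_on k S (\<lambda>x. (frechet_derivative f (at x) v, frechet_derivative g (at x) v))" for v
    by (intro Suc.IH) (use Suc.prems in auto)
  have "Ck_on k S (\<lambda>x. frechet_derivative (\<lambda>x. (f x, g x)) (at x) v)" for v
    by (rule Ck_on_cong[OF Suc.prems(1) _ D[of v]]) (simp add: frechet_derivative_at[OF d, symmetric])
  then show ?case using d by (auto simp: differentiable_def)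
qed

lemma smooth_on_open: "smooth_on S f \<Longrightarrow> open S" by (simp add: smooth_on_def)

lemma smooth_on_cong:
  "smooth_on S f \<Longrightarrow> (\<And>x. x \<in> S \<Longrightarrow> f x = g x) \<Longrightarrow> smooth_on S g"
  unfolding smooth_on_def using Ck_on_cong by blast

lemma smooth_on_subset: "smooth_on S f \<Longrightarrow> open T \<Longrightarrow> T \<subseteq> S \<Longrightarrow> smooth_on T f"
  unfolding smooth_on_def using Ck_on_subset by blast

lemma smooth_on_local:
  assumes "\<And>x. x \<in> S \<Longrightarrow> \<exists>T. x \<in> T \<and> T \<subseteq> S \<and> smooth_on T f"
  shows "smooth_on S f"
  unfolding smooth_on_def
proof (intro conjI allI)
  show "open S" using assms smooth_on_open by (subst open_subopen) blast
  show "Ck_on k S f" for k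
  proof (rule Ck_on_UN)
    fix x assume "x \<in> S"
    then obtain T where "x \<in> T" "smooth_on T f" using assms by blast
    then show "\<exists>T. open T \<and> x \<in> T \<and> Ck_on k T f" by (auto simp: smooth_on_def)
  qed
qed

lemma smooth_on_const: "open S \<Longrightarrow> smooth_on S (\<lambda>x. c)"
  by (simp add: smooth_on_def Ck_on_const)

lemma smooth_on_linear: "bounded_linear f \<Longrightarrow> open S \<Longrightarrow> smooth_on S f"
  by (simp add: smooth_on_def Ck_on_linear)

lemma smooth_on_add: "smooth_on S f \<Longrightarrow> smooth_on S g \<Longrightarrow> smooth_on S (\<lambda>x. f x + g x)"
  by (simp add: smooth_on_def Ck_on_add)

lemma smooth_on_bilinear:
  "bounded_bilinear bil \<Longrightarrow> smooth_on S f \<Longrightarrow> smooth_on S g \<Longrightarrow> smooth_on S (\<lambda>x. bil (f x) (g x))"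
  by (simp add: smooth_on_def Ck_on_bilinear)

lemmas smooth_on_mult = smooth_on_bilinear[OF bounded_bilinear_mult]
lemmas smooth_on_scaleR = smooth_on_bilinear[OF bounded_bilinear_scaleR]

lemma smooth_on_sum: fixes f :: "'i \<Rightarrow> 'a::real_normed_vector \<Rightarrow> 'b::real_normed_vector" shows
  "open S \<Longrightarrow> (\<And>i. i \<in> I \<Longrightarrow> smooth_on S (f i)) \<Longrightarrow> smooth_on S (\<lambda>x. \<Sum>i\<in>I. f i x)"
  by (simp add: smooth_on_def Ck_on_sum)

lemma smooth_on_prod:
  fixes f :: "'i \<Rightarrow> 'a::real_normed_vector \<Rightarrow> real"
  shows "open S \<Longrightarrow> (\<And>i. i \<in> I \<Longrightarrow> smooth_on S (f i)) \<Longrightarrow> smooth_on S (\<lambda>x. \<Prod>i\<in>I. f i x)"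
  by (induction I rule: infinite_finite_induct) (auto intro: smooth_on_const smooth_on_mult)

lemma smooth_on_inverse:
  fixes f :: "'a::real_normed_vector \<Rightarrow> real"
  shows "smooth_on S f \<Longrightarrow> (\<And>x. x \<in> S \<Longrightarrow> f x \<noteq> 0) \<Longrightarrow> smooth_on S (\<lambda>x. inverse (f x))"
  by (simp add: smooth_on_def Ck_on_inverse)

lemma smooth_on_Pair: "smooth_on S f \<Longrightarrow> smooth_on S g \<Longrightarrow> smooth_on S (\<lambda>x. (f x, g x))"
  by (simp add: smooth_on_def Ck_on_Pair)

lemma smooth_on_compose:
  fixes f :: "'a::real_normed_vector \<Rightarrow> 'b::euclidean_space"
  shows "smooth_on S f \<Longrightarrow> smooth_on T g \<Longrightarrow> f ` S \<subseteq> T \<Longrightarrow> smooth_on S (g \<circ> f)"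
  unfolding smooth_on_def using Ck_on_compose by blast

lemma smooth_on_linear_compose:
  "bounded_linear h \<Longrightarrow> smooth_on S f \<Longrightarrow> smooth_on S (\<lambda>x. h (f x :: 'b::euclidean_space))"
  using smooth_on_compose[of S f UNIV h] by (auto simp: o_def intro: smooth_on_linear)

lemma smooth_on_euclidean:
  fixes f :: "'a::real_normed_vector \<Rightarrow> 'b::euclidean_space"
  assumes "open S" "\<And>b. b \<in> Basis \<Longrightarrow> smooth_on S (\<lambda>x. f x \<bullet> b)"
  shows "smooth_on S f"
proof -
  have "smooth_on S (\<lambda>x. \<Sum>b\<in>Basis. (f x \<bullet> b) *\<^sub>R b)"
    by (intro smooth_on_sum smooth_on_scaleR smooth_on_const assms)
  then show ?thesis by (simp add: euclidean_representation)
qed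

lemma smooth_on_deriv: "smooth_on S f \<Longrightarrow> smooth_on S (\<lambda>x. frechet_derivative f (at x) v)"
  unfolding smooth_on_def
proof (elim conjE, intro conjI allI)
  fix k assume "\<forall>k. Ck_on k S f"
  then have "Ck_on (Suc k) S f" ..
  then show "Ck_on k S (\<lambda>x. frechet_derivative f (at x) v)" by simp
qed

lemma smooth_on_differentiable: "smooth_on S f \<Longrightarrow> x \<in> S \<Longrightarrow> f differentiable (at x)"
  by (auto simp: smooth_on_def dest: spec[of _ "Suc 0"])

lemma smooth_on_continuous: "smooth_on S f \<Longrightarrow> continuous_on S f"
  by (auto simp: smooth_on_def dest: spec[of _ 0])

lemma smooth_on_has_derivative:
  "smooth_on S f \<Longrightarrow> x \<in> S \<Longrightarrow> (f has_derivative frechet_derivative f (at x)) (at x)"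
  by (simp add: iffD1[OF frechet_derivative_works] smooth_on_differentiable)

lemma smooth_on_vimage_open:
  "smooth_on S f \<Longrightarrow> open T \<Longrightarrow> open (S \<inter> f -` T)"
  by (metis Int_commute continuous_on_open_vimage smooth_on_continuous smooth_on_open)

text \<open>The form in which derivatives occur below: of one function, at the points of a second one, in
  the directions given by a third one.\<close>

lemma smooth_on_deriv2:
  fixes f :: "'a::euclidean_space \<Rightarrow> 'b::real_normed_vector" 
  assumes f: "smooth_on S f" and h: "smooth_on R h" and g: "smooth_on R g" "g ` R \<subseteq> S"
  shows "smooth_on R (\<lambda>x. frechet_derivative f (at (g x)) (h x))"
proof -
  have "smooth_on R (\<lambda>x. \<Sum>b\<in>Basis. (h x \<bullet> b) *\<^sub>R ((\<lambda>y. frechet_derivative f (at y) b) \<circ> g) x)"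
    by (intro smooth_on_sum smooth_on_scaleR smooth_on_compose[OF g(1) _ g(2)] smooth_on_deriv
        smooth_on_linear_compose[OF bounded_linear_inner_left] f h smooth_on_open[OF h])
  then show ?thesis
  proof (rule smooth_on_cong)
    fix x assume "x \<in> R"
    then have lin: "linear (frechet_derivative f (at (g x)))"
      using f g by (intro linear_frechet_derivative smooth_on_differentiable) auto
    show "(\<Sum>b\<in>Basis. (h x \<bullet> b) *\<^sub>R ((\<lambda>y. frechet_derivative f (at y) b) \<circ> g) x) = frechet_derivative f (at (g x)) (h x)"
      by (simp add: linear_sum[OF lin, symmetric] linear_scale[OF lin, symmetric] euclidean_representation)
  qed
qed

lemma MVT_directional:
  fixes f :: "'a::real_normed_vector \<Rightarrow> real"
  assumes "h > 0" "\<And>t. 0 \<le> t \<Longrightarrow> t \<le> h \<Longrightarrow> f differentiable (at (q + t *\<^sub>R u))"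
  obtains t where "0 < t" "t < h" "f (q + h *\<^sub>R u) - f q = h * frechet_derivative f (at (q + t *\<^sub>R u)) u"
proof -
  have d: "((\<lambda>t. f (q + t *\<^sub>R u)) has_real_derivative frechet_derivative f (at (q + t *\<^sub>R u)) u) (at t)"
    if "0 \<le> t" "t \<le> h" for t
  proof -
    have "(f \<circ> (\<lambda>t. q + t *\<^sub>R u) has_derivative
        frechet_derivative f (at (q + t *\<^sub>R u)) \<circ> (\<lambda>t. t *\<^sub>R u)) (at t)"
      by (rule diff_chain_at) (use assms(2)[OF that] in \<open>auto intro!: derivative_eq_intros iffD1[OF frechet_derivative_works]\<close>)
    moreover have "frechet_derivative f (at (q + t *\<^sub>R u)) \<circ> (\<lambda>t. t *\<^sub>R u) = (*) (frechet_derivative f (at (q + t *\<^sub>R u)) u)"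
      using linear_frechet_derivative[OF assms(2)[OF that]] by (auto simp: fun_eq_iff linear_scale)
    ultimately show ?thesis by (simp add: has_field_derivative_def o_def)
  qed
  have "\<exists>t>0. t < h \<and> f (q + h *\<^sub>R u) - f (q + 0 *\<^sub>R u) = (h - 0) * frechet_derivative f (at (q + t *\<^sub>R u)) u"
    by (rule MVT2[OF assms(1)]) (rule d)
  then show thesis using that by auto
qed

text \<open>The mean value theorem, applied first along \<open>u\<close> to the increment of \<open>f\<close> along \<open>v\<close> and then along
  \<open>v\<close> to the derivative in direction \<open>u\<close>. The left-hand side is symmetric in \<open>u\<close> and \<open>v\<close>.\<close>

lemma second_difference_quotient:
  fixes f :: "'a::real_normed_vector \<Rightarrow> real"
  assumes f: "Ck_on 2 S f" and h: "h > 0"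
    and S: "\<And>s t. 0 \<le> s \<Longrightarrow> s \<le> h \<Longrightarrow> 0 \<le> t \<Longrightarrow> t \<le> h \<Longrightarrow> p + s *\<^sub>R u + t *\<^sub>R v \<in> S"
  obtains s t where "0 < s" "s < h" "0 < t" "t < h"
    "f (p + h *\<^sub>R u + h *\<^sub>R v) - f (p + h *\<^sub>R u) - f (p + h *\<^sub>R v) + f p =
       h * h * frechet_derivative (\<lambda>q. frechet_derivative f (at q) u) (at (p + s *\<^sub>R u + t *\<^sub>R v)) v"
proof -
  let ?D = "\<lambda>q. frechet_derivative f (at q) u"
  have f1: "f differentiable at q" "?D differentiable at q" if "q \<in> S" for q
    using f that by (auto simp: numeral_2_eq_2)
  let ?g = "\<lambda>q. f (q + h *\<^sub>R v) - f q"
  have d: "(?g has_derivative (\<lambda>w. frechet_derivative f (at (p + s *\<^sub>R u + h *\<^sub>R v)) w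
      - frechet_derivative f (at (p + s *\<^sub>R u)) w)) (at (p + s *\<^sub>R u))" if "0 \<le> s" "s \<le> h" for s
  proof -
    have "(f \<circ> (\<lambda>q. q + h *\<^sub>R v) has_derivative frechet_derivative f (at (p + s *\<^sub>R u + h *\<^sub>R v)) \<circ> (\<lambda>w. w)) (at (p + s *\<^sub>R u))"
      by (rule diff_chain_at)
         (use S[of s h] that h f1 in \<open>auto intro!: derivative_eq_intros iffD1[OF frechet_derivative_works]\<close>)
    then show ?thesis
      by (intro has_derivative_diff) (use S[of s 0] that h f1 in \<open>auto simp: o_def intro!: iffD1[OF frechet_derivative_works]\<close>)
  qed
  obtain s where s: "0 < s" "s < h"
     "?g (p + h *\<^sub>R u) - ?g p = h * frechet_derivative ?g (at (p + s *\<^sub>R u)) u"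
    by (rule MVT_directional[OF h, of ?g p u]) (use d in \<open>auto simp: differentiable_def\<close>)
  have e: "frechet_derivative ?g (at (p + s *\<^sub>R u)) u = ?D (p + s *\<^sub>R u + h *\<^sub>R v) - ?D (p + s *\<^sub>R u)"
    using fun_cong[OF frechet_derivative_at[OF d[of s]], of u] s(1,2) by simp
  obtain t where t: "0 < t" "t < h"
     "?D (p + s *\<^sub>R u + h *\<^sub>R v) - ?D (p + s *\<^sub>R u) = h * frechet_derivative ?D (at (p + s *\<^sub>R u + t *\<^sub>R v)) v"
    by (rule MVT_directional[OF h, of ?D "p + s *\<^sub>R u" v]) (use f1 S s in auto)
  show thesis using that[OF s(1,2) t(1,2)] s(3) t(3) e by (simp add: algebra_simps)
qed

text \<open>Schwarz's theorem. The second difference divided by \<open>h\<^sup>2\<close> is a value of either mixed derivative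
  at a point close to \<open>p\<close>; both are continuous, so they agree in the limit.\<close>

lemma second_derivative_symmetric:
  fixes f :: "'a::real_normed_vector \<Rightarrow> real"
  assumes f: "Ck_on 2 S f" and "open S" "p \<in> S"
  shows "frechet_derivative (\<lambda>q. frechet_derivative f (at q) u) (at p) v =
         frechet_derivative (\<lambda>q. frechet_derivative f (at q) v) (at p) u"
proof -
  let ?A = "\<lambda>u v q. frechet_derivative (\<lambda>q. frechet_derivative f (at q) u) (at q) v"
  have cont: "isCont (?A u v) p" for u v
    using f assms(2,3) by (auto simp: numeral_2_eq_2 continuous_on_eq_continuous_at)
  obtain r where r: "r > 0" "ball p r \<subseteq> S" using assms openE by blast
  have "\<bar>?A u v p - ?A v u p\<bar> \<le> e" if e: "e > 0" for e
  proof -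
    obtain d1 where d1: "d1 > 0" "\<And>q. dist q p < d1 \<Longrightarrow> dist (?A u v q) (?A u v p) < e/2"
      using cont[of u v] e unfolding continuous_at_eps_delta by (metis half_gt_zero)
    obtain d2 where d2: "d2 > 0" "\<And>q. dist q p < d2 \<Longrightarrow> dist (?A v u q) (?A v u p) < e/2"
      using cont[of v u] e unfolding continuous_at_eps_delta by (metis half_gt_zero)
    define d where "d = min r (min d1 d2)"
    define N where "N = norm u + norm v + 1"
    define h where "h = d / (2 * N)"
    have n: "N > 0" by (simp add: N_def add_nonneg_pos)
    have d: "d > 0" using r d1 d2 by (simp add: d_def)
    have h: "h > 0" using d n by (simp add: h_def)
    have hd: "h * (norm u + norm v) < d"
    proof -
      have "h * (norm u + norm v) \<le> h * N" using h by (intro mult_left_mono) (auto simp: N_def)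
      also have "\<dots> = d / 2" using n by (simp add: h_def)
      also have "\<dots> < d" using d by simp
      finally show ?thesis .
    qed
    have near: "dist (p + s *\<^sub>R u + t *\<^sub>R v) p < d" if "0 \<le> s" "s \<le> h" "0 \<le> t" "t \<le> h" for s t
    proof -
      have "dist (p + s *\<^sub>R u + t *\<^sub>R v) p = norm (s *\<^sub>R u + t *\<^sub>R v)" by (simp add: dist_norm algebra_simps)
      also have "\<dots> \<le> s * norm u + t * norm v" using norm_triangle_ineq[of "s *\<^sub>R u" "t *\<^sub>R v"] that by simp
      also have "\<dots> \<le> h * norm u + h * norm v" using that by (intro add_mono mult_right_mono) auto
      finally show ?thesis using hd by (simp add: algebra_simps)
    qed
    have inS: "p + s *\<^sub>R u + t *\<^sub>R v \<in> S" if "0 \<le> s" "s \<le> h" "0 \<le> t" "t \<le> h" for s t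
      using near[OF that] r(2) by (auto simp: d_def dist_commute)
    have inS': "p + s *\<^sub>R v + t *\<^sub>R u \<in> S" if "0 \<le> s" "s \<le> h" "0 \<le> t" "t \<le> h" for s t
      using inS[of t s] that by (simp add: algebra_simps)
    obtain s t where 1: "0 < s" "s < h" "0 < t" "t < h"
      "f (p + h *\<^sub>R u + h *\<^sub>R v) - f (p + h *\<^sub>R u) - f (p + h *\<^sub>R v) + f p = h * h * ?A u v (p + s *\<^sub>R u + t *\<^sub>R v)"
      by (rule second_difference_quotient[OF f h inS]) auto
    obtain s' t' where 2: "0 < s'" "s' < h" "0 < t'" "t' < h"
      "f (p + h *\<^sub>R v + h *\<^sub>R u) - f (p + h *\<^sub>R v) - f (p + h *\<^sub>R u) + f p = h * h * ?A v u (p + s' *\<^sub>R v + t' *\<^sub>R u)"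
      by (rule second_difference_quotient[OF f h inS']) auto
    have "h * h * ?A u v (p + s *\<^sub>R u + t *\<^sub>R v) = h * h * ?A v u (p + t' *\<^sub>R u + s' *\<^sub>R v)"
      using 1(5) 2(5) by (simp add: algebra_simps)
    then have eq: "?A u v (p + s *\<^sub>R u + t *\<^sub>R v) = ?A v u (p + t' *\<^sub>R u + s' *\<^sub>R v)" using h by simp
    have "dist (?A u v (p + s *\<^sub>R u + t *\<^sub>R v)) (?A u v p) < e/2"
      "dist (?A v u (p + t' *\<^sub>R u + s' *\<^sub>R v)) (?A v u p) < e/2"
      by (rule d1(2), use near[of s t] 1 in \<open>simp add: d_def\<close>)
         (rule d2(2), use near[of t' s'] 2 in \<open>simp add: d_def\<close>)
    then show ?thesis unfolding eq dist_real_def by linarith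
  qed
  then have "\<bar>?A u v p - ?A v u p\<bar> \<le> 0" by (rule field_le_epsilon) simp
  then show ?thesis by simp
qed

text \<open>Cramer's rule expresses the solution through determinants, which are polynomials in smooth
  entries.\<close>

lemma smooth_on_solution_of_linear_system:
  fixes C :: "'a::real_normed_vector \<Rightarrow> real^'k^'k"
  assumes "open S" and C: "\<And>i j. smooth_on S (\<lambda>s. C s $ i $ j)" and b: "smooth_on S b"
    and inv: "\<And>s. s \<in> S \<Longrightarrow> invertible (C s)" and sol: "\<And>s. s \<in> S \<Longrightarrow> C s *v X s = b s"
  shows "smooth_on S X"
proof -
  have det: "smooth_on S (\<lambda>s. det (D s))" if "\<And>i j. smooth_on S (\<lambda>s. D s $ i $ j)" for D :: "'a \<Rightarrow> real^'k^'k"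
    unfolding det_def by (intro smooth_on_sum smooth_on_mult smooth_on_prod smooth_on_const that assms(1))
  have bi: "smooth_on S (\<lambda>s. b s $ i)" for i
    using smooth_on_linear_compose[OF bounded_linear_vec_nth b] .
  have Ck: "smooth_on S (\<lambda>s. if j = k then b s $ i else C s $ i $ j)" for i j k
    using C bi by (cases "j = k") auto
  have X: "smooth_on S (\<lambda>s. X s \<bullet> axis k 1)" for k
  proof (rule smooth_on_cong)
    show "smooth_on S (\<lambda>s. det (\<chi> i j. if j = k then b s $ i else C s $ i $ j) * inverse (det (C s)))"
      by (intro smooth_on_mult det smooth_on_inverse) (use Ck C inv in \<open>auto simp: invertible_det_nz\<close>)
    show "det (\<chi> i j. if j = k then b s $ i else C s $ i $ j) * inverse (det (C s)) = X s \<bullet> axis k 1"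
      if "s \<in> S" for s
    proof -
      have "X s = (\<chi> k. det (\<chi> i j. if j = k then b s $ i else C s $ i $ j) / det (C s))"
        using cramer[of "C s" "X s" "b s"] inv sol that by (auto simp: invertible_det_nz)
      then show ?thesis by (simp add: inner_axis field_simps vec_eq_iff)
    qed
  qed
  show ?thesis
  proof (rule smooth_on_euclidean[OF assms(1)])
    fix v :: "real^'k" assume "v \<in> Basis"
    then obtain k where "v = axis k 1" by (auto simp: Basis_vec_def)
    then show "smooth_on S (\<lambda>s. X s \<bullet> v)" using X by simp
  qed
qed

section \<open>Smooth maps between manifolds\<close>

text \<open>The conditions of \<^const>\<open>smooth_manifold\<close> on the charts alone; for the total space of a vector
  bundle they come directly from the local trivialisations.\<close>

definition smooth_atlas :: "('p, 'v::euclidean_space) atlas \<Rightarrow> bool" where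
  "smooth_atlas A \<longleftrightarrow>
     (\<forall>(U, \<phi>)\<in>A. inj_on \<phi> U \<and> open (\<phi> ` U)) \<and>
     (\<forall>(U, \<phi>)\<in>A. \<forall>(V, \<psi>)\<in>A. smooth_on (\<phi> ` (U \<inter> V)) (\<psi> \<circ> inv_into U \<phi>))"

lemma smooth_atlasD:
  assumes "smooth_atlas A" "(U, \<phi>) \<in> A"
  shows "inj_on \<phi> U" "open (\<phi> ` U)" "(V, \<psi>) \<in> A \<Longrightarrow> smooth_on (\<phi> ` (U \<inter> V)) (\<psi> \<circ> inv_into U \<phi>)"
  using assms unfolding smooth_atlas_def by auto

lemma smooth_manifold_imp_atlas: "smooth_manifold A \<Longrightarrow> smooth_atlas A"
  by (simp add: smooth_manifold_def smooth_atlas_def)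

lemma mopenD: "mopen A W \<Longrightarrow> (U, \<phi>) \<in> A \<Longrightarrow> open (\<phi> ` (U \<inter> W))" "mopen A W \<Longrightarrow> W \<subseteq> carrier A"
  unfolding mopen_def by auto

lemma mopenI:
  "W \<subseteq> carrier A \<Longrightarrow> (\<And>U \<phi>. (U, \<phi>) \<in> A \<Longrightarrow> open (\<phi> ` (U \<inter> W))) \<Longrightarrow> mopen A W"
  unfolding mopen_def by auto

lemma carrierE: "p \<in> carrier A \<Longrightarrow> (\<And>U \<phi>. (U, \<phi>) \<in> A \<Longrightarrow> p \<in> U \<Longrightarrow> thesis) \<Longrightarrow> thesis"
  unfolding carrier_def by auto

lemma chart_subset_carrier: "(U, \<phi>) \<in> A \<Longrightarrow> U \<subseteq> carrier A"
  unfolding carrier_def by auto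

lemma mopen_chart: "smooth_atlas A \<Longrightarrow> (U, \<phi>) \<in> A \<Longrightarrow> mopen A U"
  by (rule mopenI) (auto simp: chart_subset_carrier dest: smooth_atlasD(3) smooth_on_open)

lemma mopen_Int:
  assumes "smooth_atlas A" "mopen A V" "mopen A W"
  shows "mopen A (V \<inter> W)"
proof (rule mopenI)
  show "V \<inter> W \<subseteq> carrier A" using mopenD(2)[OF assms(2)] by blast
  fix U \<phi> assume c: "(U, \<phi>) \<in> A"
  have "\<phi> ` (U \<inter> (V \<inter> W)) = \<phi> ` (U \<inter> V) \<inter> \<phi> ` (U \<inter> W)"
    using smooth_atlasD(1)[OF assms(1) c] by (auto simp: inj_on_def)
  then show "open (\<phi> ` (U \<inter> (V \<inter> W)))" using mopenD(1)[OF assms(2) c] mopenD(1)[OF assms(3) c] by auto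
qed

lemma mopen_local:
  assumes "\<And>p. p \<in> W \<Longrightarrow> \<exists>V. p \<in> V \<and> V \<subseteq> W \<and> mopen A V"
  shows "mopen A W"
proof (rule mopenI)
  show "W \<subseteq> carrier A" using assms mopenD(2) by blast
  fix U \<phi> assume c: "(U, \<phi>) \<in> A"
  show "open (\<phi> ` (U \<inter> W))"
  proof (subst open_subopen, rule ballI)
    fix s assume "s \<in> \<phi> ` (U \<inter> W)"
    then obtain p where p: "p \<in> U" "p \<in> W" "s = \<phi> p" by auto
    obtain V where V: "p \<in> V" "V \<subseteq> W" "mopen A V" using assms[OF p(2)] by auto
    show "\<exists>T. open T \<and> s \<in> T \<and> T \<subseteq> \<phi> ` (U \<inter> W)"
      by (rule exI[of _ "\<phi> ` (U \<inter> V)"]) (use p V mopenD(1)[OF V(3) c] in auto)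
  qed
qed

lemma carrier_flat [simp]: "carrier flat = UNIV" by (simp add: carrier_def flat_def)

lemma mopen_flat [simp]: "mopen flat S \<longleftrightarrow> open S" by (simp add: mopen_def flat_def carrier_def)

lemma inv_into_UNIV_ident [simp]: "inv_into UNIV (\<lambda>v. v) = (\<lambda>v. v)"
  using inv_id unfolding id_def .

lemma smooth_atlas_flat: "smooth_atlas flat"
  by (auto simp: smooth_atlas_def flat_def o_def intro: smooth_on_linear[OF bounded_linear_ident])

lemma smooth_mapD:
  assumes "smooth_map A B W h"
  shows "mopen A W" "h ` W \<subseteq> carrier B"
    "(U, \<phi>) \<in> A \<Longrightarrow> (V, \<psi>) \<in> B \<Longrightarrow> smooth_on (\<phi> ` (U \<inter> W \<inter> h -` V)) (\<psi> \<circ> h \<circ> inv_into U \<phi>)"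
  using assms unfolding smooth_map_def by auto

lemma smooth_mapI:
  assumes "mopen A W" "\<And>p. p \<in> W \<Longrightarrow> h p \<in> carrier B"
    "\<And>U \<phi> V \<psi>. (U, \<phi>) \<in> A \<Longrightarrow> (V, \<psi>) \<in> B \<Longrightarrow> smooth_on (\<phi> ` (U \<inter> W \<inter> h -` V)) (\<psi> \<circ> h \<circ> inv_into U \<phi>)"
  shows "smooth_map A B W h"
  using assms unfolding smooth_map_def by auto

lemma smooth_map_flat_flat [simp]: "smooth_map flat flat S f \<longleftrightarrow> smooth_on S f"
  by (auto simp: smooth_map_def flat_def carrier_def mopen_def o_def smooth_on_open)

lemma smooth_map_to_flat:
  "smooth_map A flat W f \<longleftrightarrow> mopen A W \<and> (\<forall>(U, \<phi>)\<in>A. smooth_on (\<phi> ` (U \<inter> W)) (f \<circ> inv_into U \<phi>))"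
  by (auto simp: smooth_map_def flat_def carrier_def o_def)

text \<open>Near a point, insert a chart of \<open>B\<close> between the two maps; openness of the preimage of \<open>V\<close>
  follows from continuity of \<open>h\<close> in charts.\<close>

lemma smooth_map_compose:
  assumes A: "smooth_atlas A" and B: "smooth_atlas B"
    and h: "smooth_map A B W h" and g: "smooth_map B C V g"
  shows "smooth_map A C (W \<inter> h -` V) (g \<circ> h)"
proof -
  have key: "\<exists>T. \<phi> p \<in> T \<and> T \<subseteq> \<phi> ` (U \<inter> W \<inter> h -` (N \<inter> O')) \<and>
      smooth_on T (\<theta> \<circ> h \<circ> inv_into U \<phi>) \<and> (\<theta> \<circ> h \<circ> inv_into U \<phi>) ` T \<subseteq> \<theta> ` (N \<inter> O')"
    if c: "(U, \<phi>) \<in> A" "(N, \<theta>) \<in> B" and o: "open (\<theta> ` (N \<inter> O'))" and p: "p \<in> U" "p \<in> W" "h p \<in> N" "h p \<in> O'"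
    for U \<phi> N \<theta> O' p
  proof -
    define F where "F = \<theta> \<circ> h \<circ> inv_into U \<phi>"
    define S where "S = \<phi> ` (U \<inter> W \<inter> h -` N)"
    have F: "smooth_on S F" unfolding S_def F_def using smooth_mapD(3)[OF h c] .
    have i: "inv_into U \<phi> (\<phi> q) = q" if "q \<in> U" for q
      using smooth_atlasD(1)[OF A c(1)] that by simp
    have T: "open (S \<inter> F -` (\<theta> ` (N \<inter> O')))" by (rule smooth_on_vimage_open[OF F o])
    have m: "\<phi> p \<in> S \<inter> F -` (\<theta> ` (N \<inter> O'))"
      using p by (auto simp: S_def F_def i)
    have sub: "S \<inter> F -` (\<theta> ` (N \<inter> O')) \<subseteq> \<phi> ` (U \<inter> W \<inter> h -` (N \<inter> O'))"
    proof
      fix s assume s: "s \<in> S \<inter> F -` (\<theta> ` (N \<inter> O'))"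
      then obtain q where q: "q \<in> U" "q \<in> W" "h q \<in> N" "s = \<phi> q" by (auto simp: S_def)
      with s obtain r where "r \<in> N" "r \<in> O'" "\<theta> (h q) = \<theta> r" by (auto simp: F_def i)
      then have "h q = r" using smooth_atlasD(1)[OF B c(2)] q(3) by (auto simp: inj_on_def)
      with \<open>r \<in> O'\<close> q show "s \<in> \<phi> ` (U \<inter> W \<inter> h -` (N \<inter> O'))" by auto
    qed
    show ?thesis
    proof (intro exI conjI)
      show "smooth_on (S \<inter> F -` (\<theta> ` (N \<inter> O'))) (\<theta> \<circ> h \<circ> inv_into U \<phi>)"
        using smooth_on_subset[OF F T] by (simp add: F_def)
    qed (use m sub in \<open>auto simp: F_def\<close>)
  qed
  show ?thesis
  proof (rule smooth_mapI)
    show "mopen A (W \<inter> h -` V)"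
    proof (rule mopenI)
      show "W \<inter> h -` V \<subseteq> carrier A" using mopenD(2)[OF smooth_mapD(1)[OF h]] by blast
      fix U \<phi> assume c: "(U, \<phi>) \<in> A"
      show "open (\<phi> ` (U \<inter> (W \<inter> h -` V)))"
      proof (subst open_subopen, rule ballI)
        fix s assume "s \<in> \<phi> ` (U \<inter> (W \<inter> h -` V))"
        then obtain p where p: "p \<in> U" "p \<in> W" "h p \<in> V" "s = \<phi> p" by auto
        obtain N \<theta> where n: "(N, \<theta>) \<in> B" "h p \<in> N"
          using carrierE mopenD(2)[OF smooth_mapD(1)[OF g]] p(3) by (metis subsetD)
        obtain T where T: "\<phi> p \<in> T" "T \<subseteq> \<phi> ` (U \<inter> W \<inter> h -` (N \<inter> V))" "smooth_on T (\<theta> \<circ> h \<circ> inv_into U \<phi>)"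
          using key[OF c n(1) mopenD(1)[OF smooth_mapD(1)[OF g] n(1)] p(1,2) n(2) p(3)] by (elim exE conjE)
        show "\<exists>T. open T \<and> s \<in> T \<and> T \<subseteq> \<phi> ` (U \<inter> (W \<inter> h -` V))"
          by (rule exI[of _ T]) (use T smooth_on_open[OF T(3)] p(4) in auto)
      qed
    qed
    show "(g \<circ> h) p \<in> carrier C" if "p \<in> W \<inter> h -` V" for p
      using smooth_mapD(2)[OF g] that by auto
    fix U \<phi> R \<omega> assume c: "(U, \<phi>) \<in> A" and r: "(R, \<omega>) \<in> C"
    show "smooth_on (\<phi> ` (U \<inter> (W \<inter> h -` V) \<inter> (g \<circ> h) -` R)) (\<omega> \<circ> (g \<circ> h) \<circ> inv_into U \<phi>)"
    proof (rule smooth_on_local)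
      fix s assume "s \<in> \<phi> ` (U \<inter> (W \<inter> h -` V) \<inter> (g \<circ> h) -` R)"
      then obtain p where p: "p \<in> U" "p \<in> W" "h p \<in> V" "g (h p) \<in> R" "s = \<phi> p" by auto
      obtain N \<theta> where n: "(N, \<theta>) \<in> B" "h p \<in> N"
        using carrierE mopenD(2)[OF smooth_mapD(1)[OF g]] p(3) by (metis subsetD)
      let ?O = "V \<inter> g -` R"
      have G: "smooth_on (\<theta> ` (N \<inter> ?O)) (\<omega> \<circ> g \<circ> inv_into N \<theta>)"
        using smooth_mapD(3)[OF g n(1) r] by (simp add: Int_assoc)
      have "h p \<in> ?O" using p by simp
      from key[OF c n(1) smooth_on_open[OF G] p(1,2) n(2) this]
      obtain T where T: "\<phi> p \<in> T" "T \<subseteq> \<phi> ` (U \<inter> W \<inter> h -` (N \<inter> ?O))"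
          "smooth_on T (\<theta> \<circ> h \<circ> inv_into U \<phi>)" "(\<theta> \<circ> h \<circ> inv_into U \<phi>) ` T \<subseteq> \<theta> ` (N \<inter> ?O)"
        by (elim exE conjE)
      have "smooth_on T ((\<omega> \<circ> g \<circ> inv_into N \<theta>) \<circ> (\<theta> \<circ> h \<circ> inv_into U \<phi>))"
        by (rule smooth_on_compose[OF T(3) G T(4)])
      then have "smooth_on T (\<omega> \<circ> (g \<circ> h) \<circ> inv_into U \<phi>)"
      proof (rule smooth_on_cong)
        fix q assume "q \<in> T"
        then obtain q' where q': "q' \<in> U" "h q' \<in> N" "q = \<phi> q'" using T(2) by auto
        then have "inv_into U \<phi> q = q'" using smooth_atlasD(1)[OF A c] by simp
        then show "((\<omega> \<circ> g \<circ> inv_into N \<theta>) \<circ> (\<theta> \<circ> h \<circ> inv_into U \<phi>)) q = (\<omega> \<circ> (g \<circ> h) \<circ> inv_into U \<phi>) q"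
          using q' smooth_atlasD(1)[OF B n(1)] by simp
      qed
      moreover have "T \<subseteq> \<phi> ` (U \<inter> (W \<inter> h -` V) \<inter> (g \<circ> h) -` R)" using T(2) by auto
      ultimately show "\<exists>T. s \<in> T \<and> T \<subseteq> \<phi> ` (U \<inter> (W \<inter> h -` V) \<inter> (g \<circ> h) -` R) \<and>
          smooth_on T (\<omega> \<circ> (g \<circ> h) \<circ> inv_into U \<phi>)" using T(1) p(5) by blast
    qed
  qed
qed

lemma smooth_map_cong:
  assumes A: "smooth_atlas A" and f: "smooth_map A B W f" and eq: "\<And>p. p \<in> W \<Longrightarrow> f p = g p"
  shows "smooth_map A B W g"
proof (rule smooth_mapI)
  show "mopen A W" using smooth_mapD(1)[OF f] .
  show "g p \<in> carrier B" if "p \<in> W" for p using smooth_mapD(2)[OF f] eq[OF that, symmetric] that by auto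
  fix U \<phi> V \<psi> assume c: "(U, \<phi>) \<in> A" "(V, \<psi>) \<in> B"
  have s: "U \<inter> W \<inter> f -` V = U \<inter> W \<inter> g -` V" using eq by auto
  show "smooth_on (\<phi> ` (U \<inter> W \<inter> g -` V)) (\<psi> \<circ> g \<circ> inv_into U \<phi>)"
    by (rule smooth_on_cong[OF smooth_mapD(3)[OF f c, unfolded s]])
       (use eq smooth_atlasD(1)[OF A c(1)] in auto)
qed

lemma smooth_map_subset:
  assumes A: "smooth_atlas A" and f: "smooth_map A B W f" and V: "mopen A V" "V \<subseteq> W"
  shows "smooth_map A B V f"
proof (rule smooth_mapI[OF V(1)])
  show "f p \<in> carrier B" if "p \<in> V" for p using smooth_mapD(2)[OF f] V(2) that by auto
  fix U \<phi> R \<psi> assume c: "(U, \<phi>) \<in> A" "(R, \<psi>) \<in> B"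
  have "\<phi> ` (U \<inter> V \<inter> f -` R) = \<phi> ` (U \<inter> W \<inter> f -` R) \<inter> \<phi> ` (U \<inter> V)"
    using smooth_atlasD(1)[OF A c(1)] V(2) by (auto simp: inj_on_def)
  then have "open (\<phi> ` (U \<inter> V \<inter> f -` R))"
    using smooth_on_open[OF smooth_mapD(3)[OF f c]] mopenD(1)[OF V(1) c(1)] by auto
  then show "smooth_on (\<phi> ` (U \<inter> V \<inter> f -` R)) (\<psi> \<circ> f \<circ> inv_into U \<phi>)"
    by (rule smooth_on_subset[OF smooth_mapD(3)[OF f c]]) (use V(2) in auto)
qed

lemma smooth_map_local:
  assumes loc: "\<And>p. p \<in> W \<Longrightarrow> \<exists>V. p \<in> V \<and> V \<subseteq> W \<and> smooth_map A B V f"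
  shows "smooth_map A B W f"
proof (rule smooth_mapI)
  show "mopen A W"
  proof (rule mopen_local)
    fix p assume "p \<in> W"
    then obtain V where V: "p \<in> V" "V \<subseteq> W" "smooth_map A B V f" using loc by blast
    then show "\<exists>V. p \<in> V \<and> V \<subseteq> W \<and> mopen A V" using smooth_mapD(1)[OF V(3)] by blast
  qed
  show "f p \<in> carrier B" if p: "p \<in> W" for p
  proof -
    obtain V where V: "p \<in> V" "V \<subseteq> W" "smooth_map A B V f" using loc[OF p] by blast
    then show ?thesis using smooth_mapD(2)[OF V(3)] by blast
  qed
  fix U \<phi> R \<psi> assume c: "(U, \<phi>) \<in> A" "(R, \<psi>) \<in> B"
  show "smooth_on (\<phi> ` (U \<inter> W \<inter> f -` R)) (\<psi> \<circ> f \<circ> inv_into U \<phi>)"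
  proof (rule smooth_on_local)
    fix s assume "s \<in> \<phi> ` (U \<inter> W \<inter> f -` R)"
    then obtain p where p: "p \<in> U" "p \<in> W" "f p \<in> R" "s = \<phi> p" by auto
    obtain V where V: "p \<in> V" "V \<subseteq> W" "smooth_map A B V f" using loc[OF p(2)] by blast
    show "\<exists>T. s \<in> T \<and> T \<subseteq> \<phi> ` (U \<inter> W \<inter> f -` R) \<and> smooth_on T (\<psi> \<circ> f \<circ> inv_into U \<phi>)"
      by (rule exI[of _ "\<phi> ` (U \<inter> V \<inter> f -` R)"]) (use V p smooth_mapD(3)[OF V(3) c] in auto)
  qed
qed

lemma local_chartD:
  assumes "local_chart A U x"
  shows "inj_on x U" "smooth_map A flat U x" "smooth_map flat A (x ` U) (inv_into U x)"
    "mopen A U" "open (x ` U)" "p \<in> U \<Longrightarrow> inv_into U x (x p) = p"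
  using assms smooth_mapD(1) unfolding local_chart_def by (auto simp: inv_into_f_f dest: smooth_mapD(1))

lemma local_chart_atlas:
  assumes A: "smooth_atlas A" and c: "(U, \<phi>) \<in> A"
  shows "local_chart A U \<phi>"
  unfolding local_chart_def
proof (intro conjI)
  show "inj_on \<phi> U" by (rule smooth_atlasD(1)[OF A c])
  show "smooth_map A flat U \<phi>"
    unfolding smooth_map_to_flat using mopen_chart[OF A c] smooth_atlasD(3)[OF A _ c] by auto
  show "smooth_map flat A (\<phi> ` U) (inv_into U \<phi>)"
  proof (rule smooth_mapI)
    show "mopen flat (\<phi> ` U)" using smooth_atlasD(2)[OF A c] by simp
    show "inv_into U \<phi> p \<in> carrier A" if "p \<in> \<phi> ` U" for p
      using chart_subset_carrier[OF c] inv_into_into[OF that] by auto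
    fix W f V \<psi> assume w: "(W, f :: 'b \<Rightarrow> 'b) \<in> flat" and v: "(V, \<psi>) \<in> A"
    have "\<phi> ` U \<inter> inv_into U \<phi> -` V = \<phi> ` (U \<inter> V)"
      using smooth_atlasD(1)[OF A c] by (auto simp: inv_into_f_f)
    then show "smooth_on (f ` (W \<inter> \<phi> ` U \<inter> inv_into U \<phi> -` V)) (\<psi> \<circ> inv_into U \<phi> \<circ> inv_into W f)"
      using smooth_atlasD(3)[OF A c v] w by (simp add: flat_def o_def)
  qed
qed

context
  fixes A :: "('p, 'v::euclidean_space) atlas" and U x
  assumes A: "smooth_atlas A" and ch: "local_chart A U x"
begin

lemma smooth_map_in_chart:
  assumes "smooth_map A C W f"
  shows "smooth_map flat C (x ` (U \<inter> W)) (f \<circ> inv_into U x)"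
proof -
  have "x ` U \<inter> inv_into U x -` W = x ` (U \<inter> W)"
    using local_chartD(6)[OF ch] by auto
  then show ?thesis using smooth_map_compose[OF smooth_atlas_flat A local_chartD(3)[OF ch] assms] by simp
qed

lemma smooth_on_in_chart:
  assumes "smooth_map A flat W f" "W \<subseteq> U"
  shows "smooth_on (x ` W) (f \<circ> inv_into U x)"
  using smooth_map_in_chart[OF assms(1)] assms(2) by (simp add: Int_absorb1)

lemma smooth_map_from_chart:
  assumes F: "smooth_map flat C S F"
  shows "smooth_map A C (U \<inter> x -` S) (F \<circ> x)"
  by (rule smooth_map_compose[OF A smooth_atlas_flat local_chartD(2)[OF ch] F])

text \<open>The coordinate map \<open>x\<close> is smooth, and \<open>f\<close> is its own coordinate expression composed with \<open>x\<close>.\<close>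

lemma smooth_map_fromI:
  assumes "smooth_on (x ` W) (f \<circ> inv_into U x)" "W \<subseteq> U"
  shows "smooth_map A flat W f"
proof -
  have "U \<inter> x -` (x ` W) = W" using assms(2) local_chartD(1)[OF ch] by (auto simp: inj_on_def)
  then have "smooth_map A flat W ((f \<circ> inv_into U x) \<circ> x)"
    using smooth_map_from_chart[of flat "x ` W" "f \<circ> inv_into U x"] assms(1) by simp
  then show ?thesis
    by (rule smooth_map_cong[OF A]) (use assms(2) local_chartD(6)[OF ch] in auto)
qed

text \<open>The domain of a smooth map is open by definition, so openness can be transported as
  smoothness of \<open>x\<close> and of a constant function.\<close>

lemma mopen_iff_in_chart: "W \<subseteq> U \<Longrightarrow> mopen A W \<longleftrightarrow> open (x ` W)"
proof
  assume W: "W \<subseteq> U" "mopen A W"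
  show "open (x ` W)"
    using smooth_on_open[OF smooth_on_in_chart[OF smooth_map_subset[OF A local_chartD(2)[OF ch] W(2,1)] W(1)]] .
next
  assume W: "W \<subseteq> U" "open (x ` W)"
  show "mopen A W"
    by (rule smooth_mapD(1)[OF smooth_map_fromI[of W "\<lambda>_. 0 :: real"]])
       (use W in \<open>auto simp: o_def intro: smooth_on_const\<close>)
qed

lemma smooth_at_iff_in_chart:
  assumes p: "p \<in> U"
  shows "smooth_at A p f \<longleftrightarrow> (\<exists>S. x p \<in> S \<and> S \<subseteq> x ` U \<and> smooth_on S (f \<circ> inv_into U x))"
proof
  assume "smooth_at A p f"
  then obtain W where "p \<in> W" "smooth_map A flat W f" unfolding smooth_at_def by auto
  then show "\<exists>S. x p \<in> S \<and> S \<subseteq> x ` U \<and> smooth_on S (f \<circ> inv_into U x)"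
    using smooth_map_in_chart[of flat W f] p by (intro exI[of _ "x ` (U \<inter> W)"]) auto
next
  assume "\<exists>S. x p \<in> S \<and> S \<subseteq> x ` U \<and> smooth_on S (f \<circ> inv_into U x)"
  then obtain S where S: "x p \<in> S" "S \<subseteq> x ` U" "smooth_on S (f \<circ> inv_into U x)" by auto
  let ?W = "U \<inter> x -` S"
  have "x ` ?W = S" using S(2) by auto
  then have "smooth_map A flat ?W f" using S(3) by (intro smooth_map_fromI) auto
  then show "smooth_at A p f" unfolding smooth_at_def using S(1) p by (intro exI[of _ ?W]) auto
qed

lemma smooth_at_obtain_open:
  assumes "smooth_at A p f" "p \<in> U" "open O'" "x p \<in> O'"
  obtains S where "x p \<in> S" "S \<subseteq> x ` U" "S \<subseteq> O'" "smooth_on S (f \<circ> inv_into U x)" "open S"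
proof -
  obtain S where S: "x p \<in> S" "S \<subseteq> x ` U" "smooth_on S (f \<circ> inv_into U x)"
    using assms smooth_at_iff_in_chart by auto
  then have "smooth_on (S \<inter> O') (f \<circ> inv_into U x)"
    using assms(3) smooth_on_open[OF S(3)] by (intro smooth_on_subset[OF S(3)]) auto
  then show thesis using S assms by (intro that[of "S \<inter> O'"]) (auto simp: smooth_on_open)
qed

end

lemma has_derivative_transform_near:
  assumes "(f has_derivative D) (at x)" "open S" "x \<in> S" "\<And>y. y \<in> S \<Longrightarrow> f y = g y"
  shows "(g has_derivative D) (at x)"
  using has_derivative_transform_within_open[OF assms(1-3)] assms(4) by simp

lemma frechet_derivative_cong_near:
  assumes "smooth_on S f" "x \<in> S" "\<And>y. y \<in> S \<Longrightarrow> f y = g y"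
  shows "frechet_derivative g (at x) = frechet_derivative f (at x)"
  by (rule frechet_derivative_at[symmetric],
      rule has_derivative_transform_near[OF smooth_on_has_derivative smooth_on_open])
     (use assms in auto)

lemma frechet_derivative_chain:
  assumes f: "smooth_on S f" "x \<in> S" and g: "smooth_on T g" "f x \<in> T"
    and eq: "\<And>y. y \<in> R \<Longrightarrow> h y = g (f y)" "open R" "x \<in> R"
  shows "frechet_derivative h (at x) v = frechet_derivative g (at (f x)) (frechet_derivative f (at x) v)"
proof -
  have "(g \<circ> f has_derivative frechet_derivative g (at (f x)) \<circ> frechet_derivative f (at x)) (at x)"
    by (rule diff_chain_at[OF smooth_on_has_derivative[OF f] smooth_on_has_derivative[OF g]])
  then have "(h has_derivative frechet_derivative g (at (f x)) \<circ> frechet_derivative f (at x)) (at x)"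
    by (rule has_derivative_transform_near[OF _ eq(2,3)]) (simp add: eq(1))
  from frechet_derivative_at[OF this] show ?thesis by (simp add: fun_eq_iff)
qed

section \<open>Tangent vectors and vector fields in a chart\<close>

context
  fixes A :: "('p, 'v::euclidean_space) atlas" and U x
  assumes A: "smooth_atlas A" and ch: "local_chart A U x"
begin

lemma coord_vec_linear:
  assumes p: "p \<in> U"
  shows "coord_vec A U x (v + w) p = coord_vec A U x v p + coord_vec A U x w p"
    and "coord_vec A U x (v - w) p = coord_vec A U x v p - coord_vec A U x w p"
    and "coord_vec A U x (r *\<^sub>R v) p f = r * coord_vec A U x v p f"
    and "coord_vec A U x (- v) p = - coord_vec A U x v p"
    and "coord_vec A U x (sum V I) p f = (\<Sum>i\<in>I. coord_vec A U x (V i) p f)"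
proof -
  have lin: "linear (\<lambda>v. coord_vec A U x v p f)" for f
  proof (cases "smooth_at A p f")
    case True
    then obtain S where "x p \<in> S" "smooth_on S (f \<circ> inv_into U x)"
      using smooth_at_iff_in_chart[OF A ch p] by auto
    then have "linear (frechet_derivative (f \<circ> inv_into U x) (at (x p)))"
      by (intro linear_frechet_derivative smooth_on_differentiable)
    then show ?thesis using True by (simp add: coord_vec_def)
  next
    case False then show ?thesis by (simp add: coord_vec_def linear_iff)
  qed
  show "coord_vec A U x (v + w) p = coord_vec A U x v p + coord_vec A U x w p"
    using linear_add[OF lin] by (auto simp: fun_eq_iff)
  show "coord_vec A U x (v - w) p = coord_vec A U x v p - coord_vec A U x w p"
    using linear_diff[OF lin] by (auto simp: fun_eq_iff)
  show "coord_vec A U x (r *\<^sub>R v) p f = r * coord_vec A U x v p f"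
    using linear_scale[OF lin] by simp
  show "coord_vec A U x (- v) p = - coord_vec A U x v p"
    using linear_neg[OF lin] by (auto simp: fun_eq_iff)
  show "coord_vec A U x (sum V I) p f = (\<Sum>i\<in>I. coord_vec A U x (V i) p f)"
    using linear_sum[OF lin] by simp
qed

text \<open>Only the germ of \<open>f\<close> matters, so \<open>f\<close> may be replaced by any smooth coordinate expression of it
  near the point.\<close>

lemma coord_vec_eq_near:
  assumes p: "p \<in> U" and F: "smooth_on S F" "x p \<in> S" "S \<subseteq> x ` U"
    and eq: "\<And>q. q \<in> U \<Longrightarrow> x q \<in> S \<Longrightarrow> f q = F (x q)"
  shows "smooth_at A p f" "coord_vec A U x v p f = frechet_derivative F (at (x p)) v"
proof -
  have e: "F s = (f \<circ> inv_into U x) s" if s: "s \<in> S" for s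
  proof -
    obtain q where "q \<in> U" "s = x q" using s F(3) by auto
    then show ?thesis using eq s local_chartD(6)[OF ch] by simp
  qed
  have "smooth_on S (f \<circ> inv_into U x)" by (rule smooth_on_cong[OF F(1) e])
  then show s: "smooth_at A p f" using smooth_at_iff_in_chart[OF A ch p] F by auto
  show "coord_vec A U x v p f = frechet_derivative F (at (x p)) v"
    using frechet_derivative_cong_near[OF F(1,2) e] s by (simp add: coord_vec_def o_def)
qed

lemma coord_vec_component:
  assumes p: "p \<in> U"
  shows "smooth_at A p (\<lambda>q. x q \<bullet> b)" "coord_vec A U x v p (\<lambda>q. x q \<bullet> b) = v \<bullet> b"
proof -
  have sm: "smooth_on (x ` U) (\<lambda>s. s \<bullet> b)"
    by (rule smooth_on_linear[OF bounded_linear_inner_left local_chartD(5)[OF ch]])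
  have "((\<lambda>s. s \<bullet> b) has_derivative (\<lambda>s. s \<bullet> b)) (at (x p))"
    by (rule bounded_linear_imp_has_derivative[OF bounded_linear_inner_left])
  then have d: "frechet_derivative (\<lambda>s. s \<bullet> b) (at (x p)) v = v \<bullet> b"
    by (rule fun_cong[OF frechet_derivative_at, symmetric])
  show "smooth_at A p (\<lambda>q. x q \<bullet> b)" "coord_vec A U x v p (\<lambda>q. x q \<bullet> b) = v \<bullet> b"
    using coord_vec_eq_near(1)[OF p sm, of "\<lambda>q. x q \<bullet> b"] coord_vec_eq_near(2)[OF p sm, of "\<lambda>q. x q \<bullet> b" v] p d
    by auto
qed

lemma coord_vec_inject:
  assumes "p \<in> U" "coord_vec A U x v p = coord_vec A U x w p"
  shows "v = w"
proof (rule euclidean_eqI)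
  fix b :: 'v
  show "v \<bullet> b = w \<bullet> b"
    using coord_vec_component(2)[OF assms(1), of v b] coord_vec_component(2)[OF assms(1), of w b] assms(2) by simp
qed

text \<open>The velocity of a curve is the coordinate vector whose components are the velocity of its
  coordinate expression; conversely a straight line in the chart realises any components.\<close>

lemma tangent_space_eq_coord_vec:
  assumes p: "p \<in> U"
  shows "tangent_space A p = range (\<lambda>v. coord_vec A U x v p)"
proof (intro set_eqI iffI)
  fix u assume "u \<in> tangent_space A p"
  then obtain c S where c: "u = velocity A c" "c 0 = p" "0 \<in> S" "smooth_map flat A S c"
    unfolding tangent_space_def by auto
  define R where "R = S \<inter> c -` U"
  have xc: "smooth_on R (x \<circ> c)"
    unfolding R_def using smooth_map_compose[OF smooth_atlas_flat A c(4) local_chartD(2)[OF ch]] by simp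
  have 0: "0 \<in> R" using c(2,3) p by (simp add: R_def)
  have "u f = coord_vec A U x (frechet_derivative (x \<circ> c) (at 0) 1) p f" for f
  proof (cases "smooth_at A p f")
    case True
    obtain T where T: "x p \<in> T" "T \<subseteq> x ` U" "smooth_on T (f \<circ> inv_into U x)"
      using True smooth_at_iff_in_chart[OF A ch p] by auto
    have eq: "f (c t) = (f \<circ> inv_into U x) ((x \<circ> c) t)" if "t \<in> R" for t
      using that local_chartD(6)[OF ch] by (simp add: R_def)
    have dc: "((x \<circ> c) has_derivative frechet_derivative (x \<circ> c) (at 0)) (at 0)"
      by (rule smooth_on_has_derivative[OF xc 0])
    have "((f \<circ> inv_into U x) \<circ> (x \<circ> c) has_derivative
        frechet_derivative (f \<circ> inv_into U x) (at (x p)) \<circ> frechet_derivative (x \<circ> c) (at 0)) (at 0)"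
      by (rule diff_chain_at[OF dc]) (use smooth_on_has_derivative[OF T(3,1)] c(2) in simp)
    then have d: "((\<lambda>t. f (c t)) has_derivative
        frechet_derivative (f \<circ> inv_into U x) (at (x p)) \<circ> frechet_derivative (x \<circ> c) (at 0)) (at 0)"
      by (rule has_derivative_transform_near[OF _ smooth_on_open[OF xc] 0]) (simp add: eq)
    have lin: "linear (frechet_derivative (f \<circ> inv_into U x) (at (x p)) \<circ> frechet_derivative (x \<circ> c) (at 0))"
      using d has_derivative_linear by blast
    have "((\<lambda>t. f (c t)) has_real_derivative
        frechet_derivative (f \<circ> inv_into U x) (at (x p)) (frechet_derivative (x \<circ> c) (at 0) 1)) (at 0)"
    proof (rule has_derivative_imp_has_field_derivative[OF d])
      fix t :: real
      show "t * frechet_derivative (f \<circ> inv_into U x) (at (x p)) (frechet_derivative (x \<circ> c) (at 0) 1) =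
        (frechet_derivative (f \<circ> inv_into U x) (at (x p)) \<circ> frechet_derivative (x \<circ> c) (at 0)) t"
        using linear_scale[OF lin, of t 1] by simp
    qed
    then show ?thesis using True c(1,2) by (simp add: velocity_def coord_vec_def DERIV_imp_deriv)
  next
    case False then show ?thesis using c(1,2) by (simp add: velocity_def coord_vec_def)
  qed
  then show "u \<in> range (\<lambda>v. coord_vec A U x v p)" by (auto simp: fun_eq_iff)
next
  fix u assume "u \<in> range (\<lambda>v. coord_vec A U x v p)"
  then obtain v where u: "u = coord_vec A U x v p" by auto
  define l where "l = (\<lambda>t::real. x p + t *\<^sub>R v)"
  define c where "c = inv_into U x \<circ> l"
  have bl: "bounded_linear (\<lambda>t::real. t *\<^sub>R v)" by (rule bounded_linear_scaleR_left)
  have l: "smooth_on UNIV l"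
    unfolding l_def by (intro smooth_on_add smooth_on_const smooth_on_linear[OF bl]) auto
  have c: "smooth_map flat A (UNIV \<inter> l -` (x ` U)) c"
    unfolding c_def
    by (rule smooth_map_compose[OF smooth_atlas_flat smooth_atlas_flat _ local_chartD(3)[OF ch]]) (simp add: l)
  have c0: "c 0 = p" using local_chartD(6)[OF ch p] by (simp add: c_def l_def)
  have dl: "(l has_derivative (\<lambda>t. t *\<^sub>R v)) (at 0)"
    unfolding l_def by (auto intro!: derivative_eq_intros)
  have vel: "u = velocity A c"
  proof
    fix f
    show "u f = velocity A c f"
    proof (cases "smooth_at A p f")
      case True
      obtain T where T: "x p \<in> T" "T \<subseteq> x ` U" "smooth_on T (f \<circ> inv_into U x)"
        using True smooth_at_iff_in_chart[OF A ch p] by auto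
      have F: "((f \<circ> inv_into U x) has_derivative frechet_derivative (f \<circ> inv_into U x) (at (x p))) (at (l 0))"
        using smooth_on_has_derivative[OF T(3,1)] by (simp add: l_def)
      have "((f \<circ> inv_into U x) \<circ> l has_derivative frechet_derivative (f \<circ> inv_into U x) (at (x p)) \<circ> (\<lambda>t. t *\<^sub>R v)) (at 0)"
        by (rule diff_chain_at[OF dl F])
      moreover have "linear (frechet_derivative (f \<circ> inv_into U x) (at (x p)))"
          by (intro linear_frechet_derivative smooth_on_differentiable[OF T(3,1)])
      ultimately have "((\<lambda>t. f (c t)) has_real_derivative frechet_derivative (f \<circ> inv_into U x) (at (x p)) v) (at 0)"
        by (intro has_derivative_imp_has_field_derivative) (auto simp: c_def o_def linear_scale mult.commute)
      then show ?thesis using True c0 u by (simp add: velocity_def coord_vec_def DERIV_imp_deriv)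
    next
      case False then show ?thesis using c0 u by (simp add: velocity_def coord_vec_def)
    qed
  qed
  have "0 \<in> UNIV \<inter> l -` (x ` U)" using p by (simp add: l_def)
  then have "\<exists>S. 0 \<in> S \<and> smooth_map flat A S c" using c by (intro exI conjI)
  then show "u \<in> tangent_space A p" 
    unfolding tangent_space_def mem_Collect_eq by (intro exI[of _ c] conjI vel c0)
qed

lemma vector_fieldI:
  assumes W: "W \<subseteq> U" and F: "smooth_on (x ` W) F"
    and X: "\<And>p. p \<in> W \<Longrightarrow> X p = coord_vec A U x (F (x p)) p"
  shows "vector_field A W X"
  unfolding vector_field_def
proof (intro conjI ballI allI impI)
  show "mopen A W" using mopen_iff_in_chart[OF A ch W] smooth_on_open[OF F] by simp
  show "X p \<in> tangent_space A p" if "p \<in> W" for p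
    using X[OF that] tangent_space_eq_coord_vec[of p] W that by auto
  fix V and f :: "'p \<Rightarrow> real" assume V: "V \<subseteq> W" "smooth_map A flat V f"
  then have VU: "V \<subseteq> U" using W by auto
  have f: "smooth_on (x ` V) (f \<circ> inv_into U x)" by (rule smooth_on_in_chart[OF A ch V(2) VU])
  have oV: "open (x ` V)" using smooth_on_open[OF f] .
  show "smooth_map A flat V (\<lambda>p. X p f)"
  proof (rule smooth_map_fromI[OF A ch _ VU], rule smooth_on_cong)
    show "smooth_on (x ` V) (\<lambda>s. frechet_derivative (f \<circ> inv_into U x) (at s) (F s))"
      by (rule smooth_on_deriv2[OF f smooth_on_subset[OF F oV] smooth_on_linear[OF bounded_linear_ident oV]])
         (use V in auto)
    fix s assume "s \<in> x ` V"
    then obtain p where p: "p \<in> V" "s = x p" by auto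
    then have "smooth_at A p f" using V(2) unfolding smooth_at_def by auto
    then show "frechet_derivative (f \<circ> inv_into U x) (at s) (F s) = ((\<lambda>p. X p f) \<circ> inv_into U x) s"
      using p local_chartD(6)[OF ch subsetD[OF VU p(1)]] X[OF subsetD[OF V(1) p(1)]]
      by (simp add: coord_vec_def)
  qed
qed

text \<open>The coordinate functions are smooth, so a smooth vector field applied to them yields smooth
  components.\<close>

lemma vector_field_in_chart:
  assumes X: "vector_field A W X" and W: "W \<subseteq> U"
  obtains F where "smooth_on (x ` W) F" "\<And>p. p \<in> W \<Longrightarrow> X p = coord_vec A U x (F (x p)) p"
proof -
  define F where "F = (\<lambda>s. \<Sum>b\<in>Basis. X (inv_into U x s) (\<lambda>q. x q \<bullet> b) *\<^sub>R b)"
  have o: "open (x ` W)" using X mopen_iff_in_chart[OF A ch W] by (simp add: vector_field_def)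
  have "smooth_on (x ` W) ((\<lambda>p. X p (\<lambda>q. x q \<bullet> b)) \<circ> inv_into U x)" for b
  proof (rule smooth_on_in_chart[OF A ch _ W])
    have "smooth_map A flat W (\<lambda>q. x q \<bullet> b)"
    proof (rule smooth_map_fromI[OF A ch _ W], rule smooth_on_cong)
      show "smooth_on (x ` W) (\<lambda>s. s \<bullet> b)" by (rule smooth_on_linear[OF bounded_linear_inner_left o])
      show "s \<bullet> b = ((\<lambda>q. x q \<bullet> b) \<circ> inv_into U x) s" if "s \<in> x ` W" for s
        using that W local_chartD(6)[OF ch] by auto
    qed
    then show "smooth_map A flat W (\<lambda>p. X p (\<lambda>q. x q \<bullet> b))"
      using X unfolding vector_field_def by blast
  qed
  then have F: "smooth_on (x ` W) F"
    unfolding F_def o_def by (intro smooth_on_sum smooth_on_scaleR smooth_on_const o) auto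
  moreover have "X p = coord_vec A U x (F (x p)) p" if p: "p \<in> W" for p
  proof -
    have pU: "p \<in> U" using p W by auto
    have "X p \<in> tangent_space A p" using X p by (simp add: vector_field_def)
    then obtain v where v: "X p = coord_vec A U x v p" using tangent_space_eq_coord_vec[OF pU] by auto
    have "F (x p) = v"
      unfolding F_def local_chartD(6)[OF ch pU] v coord_vec_component(2)[OF pU] by (rule euclidean_representation)
    then show ?thesis using v by simp
  qed
  ultimately show thesis by (rule that)
qed

end

lemma vector_field_local:
  fixes A :: "('p, 'v::euclidean_space) atlas"
  assumes loc: "\<And>p. p \<in> W \<Longrightarrow> \<exists>V. p \<in> V \<and> V \<subseteq> W \<and> vector_field A V X" and A: "smooth_atlas A"
  shows "vector_field A W X"
  unfolding vector_field_def
proof (intro conjI ballI allI impI)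
  show "mopen A W"
  proof (rule mopen_local)
    fix p assume "p \<in> W"
    then obtain V where "p \<in> V" "V \<subseteq> W" "vector_field A V X" using loc by blast
    then show "\<exists>V. p \<in> V \<and> V \<subseteq> W \<and> mopen A V" by (auto simp: vector_field_def)
  qed
  show "X p \<in> tangent_space A p" if p: "p \<in> W" for p
    using loc[OF p] by (auto simp: vector_field_def)
  fix V and f :: "'p \<Rightarrow> real" assume V: "V \<subseteq> W" "smooth_map A flat V f"
  show "smooth_map A flat V (\<lambda>p. X p f)"
  proof (rule smooth_map_local)
    fix p assume p: "p \<in> V"
    then obtain R where R: "p \<in> R" "vector_field A R X" using loc V(1) by blast
    have "mopen A (V \<inter> R)"
      using R(2) mopen_Int[OF A smooth_mapD(1)[OF V(2)]] by (simp add: vector_field_def)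
    then have "smooth_map A flat (V \<inter> R) f" by (rule smooth_map_subset[OF A V(2)]) auto
    then have "smooth_map A flat (V \<inter> R) (\<lambda>p. X p f)" using R(2) by (simp add: vector_field_def)
    then show "\<exists>V'. p \<in> V' \<and> V' \<subseteq> V \<and> smooth_map A flat V' (\<lambda>p. X p f)"
      using p R(1) by (intro exI[of _ "V \<inter> R"]) auto
  qed
qed

text \<open>The product rule yields a first-order term and the second derivative of \<open>F\<close> in the directions
  \<open>Y s\<close> and \<open>w\<close>; symmetry of the latter makes it linear in \<open>Y s\<close> and collapses the sum over the basis.\<close>

lemma frechet_derivative_directional:
  fixes F :: "'v::euclidean_space \<Rightarrow> real" and Y :: "'v \<Rightarrow> 'v"
  assumes F: "smooth_on S F" and Y: "smooth_on S Y" and s: "s \<in> S"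
  shows "frechet_derivative (\<lambda>s. frechet_derivative F (at s) (Y s)) (at s) w =
      frechet_derivative F (at s) (frechet_derivative Y (at s) w)
      + frechet_derivative (\<lambda>r. frechet_derivative F (at r) w) (at s) (Y s)"
proof -
  let ?D = "\<lambda>r. frechet_derivative F (at r)"
  let ?H = "\<lambda>u. frechet_derivative (\<lambda>r. ?D r u) (at s)"
  have lin: "linear (?D r)" if "r \<in> S" for r
    by (intro linear_frechet_derivative smooth_on_differentiable[OF F that])
  have linH: "linear (?H u)" for u
    by (intro linear_frechet_derivative smooth_on_differentiable[OF smooth_on_deriv[OF F] s])
  have sym: "?H u v = ?H v u" for u v
    using second_derivative_symmetric[of S F s u v] F s by (simp add: smooth_on_def)
  have dY: "((\<lambda>r. Y r \<bullet> b) has_derivative (\<lambda>w. frechet_derivative Y (at s) w \<bullet> b)) (at s)" for b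
    by (rule bounded_linear.has_derivative[OF bounded_linear_inner_left smooth_on_has_derivative[OF Y s]])
  have "((\<lambda>r. \<Sum>b\<in>Basis. (Y r \<bullet> b) * ?D r b) has_derivative
      (\<lambda>w. \<Sum>b\<in>Basis. (Y s \<bullet> b) * ?H b w + (frechet_derivative Y (at s) w \<bullet> b) * ?D s b)) (at s)"
    by (rule has_derivative_sum, rule has_derivative_mult[OF dY])
       (rule smooth_on_has_derivative[OF smooth_on_deriv[OF F] s])
  then have "((\<lambda>r. ?D r (Y r)) has_derivative
      (\<lambda>w. \<Sum>b\<in>Basis. (Y s \<bullet> b) * ?H b w + (frechet_derivative Y (at s) w \<bullet> b) * ?D s b)) (at s)"
    by (rule has_derivative_transform_near[OF _ smooth_on_open[OF F] s])
       (use linear_eq_sum_Basis[OF lin] in simp)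
  from fun_cong[OF frechet_derivative_at[OF this], of w, symmetric]
  have "frechet_derivative (\<lambda>r. ?D r (Y r)) (at s) w =
      (\<Sum>b\<in>Basis. (Y s \<bullet> b) * ?H w b) + (\<Sum>b\<in>Basis. (frechet_derivative Y (at s) w \<bullet> b) * ?D s b)"
    by (simp add: sum.distrib sym[of _ w])
  also have "\<dots> = ?H w (Y s) + ?D s (frechet_derivative Y (at s) w)"
    using linear_eq_sum_Basis[OF linH, of "Y s" w] linear_eq_sum_Basis[OF lin[OF s]] by simp
  finally show ?thesis by simp
qed

text \<open>In \<open>X (Y f) - Y (X f)\<close> the second derivatives of \<open>f\<close> cancel by symmetry.\<close>

lemma lie_bracket_in_chart:
  fixes A :: "('p, 'v::euclidean_space) atlas"
  assumes A: "smooth_atlas A" and ch: "local_chart A U x" and W: "W \<subseteq> U" and p: "p \<in> W"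
    and F: "smooth_on (x ` W) F" "\<And>p. p \<in> W \<Longrightarrow> X p = coord_vec A U x (F (x p)) p"
    and G: "smooth_on (x ` W) G" "\<And>p. p \<in> W \<Longrightarrow> Y p = coord_vec A U x (G (x p)) p"
  shows "lie_bracket A X Y p = coord_vec A U x
    (frechet_derivative G (at (x p)) (F (x p)) - frechet_derivative F (at (x p)) (G (x p))) p"
proof
  fix f
  have pU: "p \<in> U" using p W by auto
  show "lie_bracket A X Y p f = coord_vec A U x
    (frechet_derivative G (at (x p)) (F (x p)) - frechet_derivative F (at (x p)) (G (x p))) p f"
  proof (cases "smooth_at A p f")
    case True
    obtain S where S: "x p \<in> S" "S \<subseteq> x ` U" "S \<subseteq> x ` W" "smooth_on S (f \<circ> inv_into U x)"
      by (rule smooth_at_obtain_open[OF A ch True pU smooth_on_open[OF F(1)] imageI[OF p]])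
    let ?f = "f \<circ> inv_into U x"
    have XY: "Z p (\<lambda>q. Z' q f) = frechet_derivative (\<lambda>s. frechet_derivative ?f (at s) (H s)) (at (x p)) (K (x p))"
      if K: "\<And>p. p \<in> W \<Longrightarrow> Z p = coord_vec A U x (K (x p)) p"
      and H: "smooth_on (x ` W) H" "\<And>p. p \<in> W \<Longrightarrow> Z' p = coord_vec A U x (H (x p)) p"
      for Z Z' K H
      unfolding K[OF p]
    proof (rule coord_vec_eq_near(2)[OF A ch pU _ S(1,2)])
      show "smooth_on S (\<lambda>s. frechet_derivative ?f (at s) (H s))"
        by (rule smooth_on_deriv2[OF S(4) smooth_on_subset[OF H(1) smooth_on_open[OF S(4)] S(3)]
              smooth_on_linear[OF bounded_linear_ident smooth_on_open[OF S(4)]]]) auto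
      fix q assume q: "q \<in> U" "x q \<in> S"
      then have "q \<in> W" using S(3) W local_chartD(1)[OF ch] by (auto simp: inj_on_def)
      moreover have "smooth_at A q f" using smooth_at_iff_in_chart[OF A ch q(1)] q(2) S by auto
      ultimately show "Z' q f = frechet_derivative ?f (at (x q)) (H (x q))"
        using H(2) by (simp add: coord_vec_def)
    qed
    have FS: "smooth_on S F" "smooth_on S G"
      using smooth_on_subset[OF _ smooth_on_open[OF S(4)] S(3)] F(1) G(1) by auto
    have lin: "linear (frechet_derivative ?f (at (x p)))"
      by (intro linear_frechet_derivative smooth_on_differentiable[OF S(4,1)])
    have sym: "frechet_derivative (\<lambda>r. frechet_derivative ?f (at r) (F (x p))) (at (x p)) (G (x p)) =
       frechet_derivative (\<lambda>r. frechet_derivative ?f (at r) (G (x p))) (at (x p)) (F (x p))"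
      using second_derivative_symmetric[of S ?f] S by (simp add: smooth_on_def)
    show ?thesis
      using True sym linear_diff[OF lin]
      by (simp add: lie_bracket_def coord_vec_def XY[OF F(2) G] XY[OF G(2) F]
         frechet_derivative_directional[OF S(4) FS(2) S(1)] frechet_derivative_directional[OF S(4) FS(1) S(1)])
  next
    case False then show ?thesis by (simp add: lie_bracket_def coord_vec_def)
  qed
qed

text \<open>The chain rule, read in charts.\<close>

lemma tangent_map_coord_vec:
  fixes A :: "('p, 'v::euclidean_space) atlas" and B :: "('q, 'w::euclidean_space) atlas"
  assumes A: "smooth_atlas A" and chA: "local_chart A U x" and B: "smooth_atlas B" and chB: "local_chart B V y"
    and p: "p \<in> U" "h p \<in> V" and h: "smooth_map A B W h" "p \<in> W"
  shows "tangent_map B h p (coord_vec A U x v p) =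
    coord_vec B V y (frechet_derivative (y \<circ> h \<circ> inv_into U x) (at (x p)) v) (h p)"
proof
  fix f
  show "tangent_map B h p (coord_vec A U x v p) f =
    coord_vec B V y (frechet_derivative (y \<circ> h \<circ> inv_into U x) (at (x p)) v) (h p) f"
  proof (cases "smooth_at B (h p) f")
    case True
    then obtain R where R: "h p \<in> R" "smooth_map B flat R f" unfolding smooth_at_def by auto
    have "smooth_map A flat (W \<inter> h -` R) (f \<circ> h)" by (rule smooth_map_compose[OF A B h(1) R(2)])
    then have fh: "smooth_at A p (f \<circ> h)" 
      unfolding smooth_at_def using R(1) h(2) by (intro exI[of _ "W \<inter> h -` R"]) simp
    obtain S where S: "y (h p) \<in> S" "smooth_on S (f \<circ> inv_into V y)"
      using True smooth_at_iff_in_chart[OF B chB p(2)] by auto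
    define T where "T = x ` (U \<inter> (W \<inter> h -` V))"
    have H: "smooth_on T (y \<circ> h \<circ> inv_into U x)"
      unfolding T_def
      using smooth_map_in_chart[OF A chA smooth_map_compose[OF A B h(1) local_chartD(2)[OF chB]]] by simp
    have i: "inv_into U x (x p) = p" by (rule local_chartD(6)[OF chA p(1)])
    have m: "x p \<in> T" using p h by (auto simp: T_def)
    have "frechet_derivative (f \<circ> h \<circ> inv_into U x) (at (x p)) v =
      frechet_derivative (f \<circ> inv_into V y) (at ((y \<circ> h \<circ> inv_into U x) (x p)))
        (frechet_derivative (y \<circ> h \<circ> inv_into U x) (at (x p)) v)"
    proof (rule frechet_derivative_chain[OF H m S(2) _ _ smooth_on_open[OF H] m])
      show "(y \<circ> h \<circ> inv_into U x) (x p) \<in> S" using S(1) i by simp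
      fix s assume "s \<in> T"
      then obtain q where "q \<in> U" "h q \<in> V" "s = x q" by (auto simp: T_def)
      then show "(f \<circ> h \<circ> inv_into U x) s = (f \<circ> inv_into V y) ((y \<circ> h \<circ> inv_into U x) s)"
        using local_chartD(6)[OF chA, of q] local_chartD(6)[OF chB, of "h q"] by simp
    qed
    then show ?thesis using True fh i by (simp add: tangent_map_def coord_vec_def)
  next
    case False then show ?thesis by (simp add: tangent_map_def coord_vec_def)
  qed
qed

section \<open>The total space of a vector bundle\<close>

lemma smooth_map_Pair:
  assumes "smooth_map A flat W f" "smooth_map A flat W g"
  shows "smooth_map A flat W (\<lambda>p. (f p, g p))"
proof -
  have "smooth_on (\<phi> ` (U \<inter> W)) ((\<lambda>p. (f p, g p)) \<circ> inv_into U \<phi>)" if "(U, \<phi>) \<in> A" for U \<phi>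
    using assms that smooth_on_Pair[of "\<phi> ` (U \<inter> W)" "f \<circ> inv_into U \<phi>" "g \<circ> inv_into U \<phi>"]
    by (auto simp: smooth_map_to_flat o_def)
  then show ?thesis using smooth_mapD(1)[OF assms(1)] by (auto simp: smooth_map_to_flat)
qed

lemma local_chart_subset:
  assumes A: "smooth_atlas A" and ch: "local_chart A U x" and N: "mopen A N" "N \<subseteq> U"
  shows "local_chart A N x"
  unfolding local_chart_def
proof (intro conjI)
  show "inj_on x N" by (rule inj_on_subset[OF local_chartD(1)[OF ch] N(2)])
  show "smooth_map A flat N x" by (rule smooth_map_subset[OF A local_chartD(2)[OF ch] N])
  have "smooth_map flat A (x ` N) (inv_into U x)"
    by (rule smooth_map_subset[OF smooth_atlas_flat local_chartD(3)[OF ch]])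
       (use mopen_iff_in_chart[OF A ch N(2)] N in auto)
  then show "smooth_map flat A (x ` N) (inv_into N x)"
  proof (rule smooth_map_cong[OF smooth_atlas_flat])
    fix s assume "s \<in> x ` N"
    then obtain p where p: "p \<in> N" "s = x p" by auto
    show "inv_into U x s = inv_into N x s"
      unfolding p(2) inv_into_f_f[OF \<open>inj_on x N\<close> p(1)]
      by (rule local_chartD(6)[OF ch]) (use p N in auto)
  qed
qed

lemma smooth_on_fst: "open S \<Longrightarrow> smooth_on S (fst :: 'a::real_normed_vector \<times> 'b::real_normed_vector \<Rightarrow> 'a)"
  by (rule smooth_on_linear[OF bounded_linear_fst])

lemma smooth_on_snd: "open S \<Longrightarrow> smooth_on S (snd :: 'a::real_normed_vector \<times> 'b::real_normed_vector \<Rightarrow> 'b)"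
  by (rule smooth_on_linear[OF bounded_linear_snd])

lemma smooth_on_fst_compose:
  fixes f :: "'a::euclidean_space \<Rightarrow> 'c::real_normed_vector"
  assumes "smooth_on S f"
  shows "smooth_on (S \<times> (UNIV :: 'b::euclidean_space set)) (\<lambda>q. f (fst q))"
proof -
  have o: "open (S \<times> (UNIV :: 'b set))" by (intro open_Times smooth_on_open[OF assms] open_UNIV)
  show ?thesis using smooth_on_compose[OF smooth_on_fst[OF o] assms] by (auto simp: o_def)
qed

text \<open>Fibre coordinates enter linearly, so smoothness in the base point for each fixed fibre
  coordinate gives joint smoothness.\<close>

lemma smooth_on_family_linear:
  fixes L :: "'a::euclidean_space \<Rightarrow> 'b::euclidean_space \<Rightarrow> 'c::real_normed_vector"
  assumes S: "open S" and L: "\<And>b. smooth_on S (\<lambda>s. L s b)" and lin: "\<And>s. s \<in> S \<Longrightarrow> linear (L s)"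
  shows "smooth_on (S \<times> UNIV) (\<lambda>q. L (fst q) (snd q))"
proof (rule smooth_on_cong)
  have o: "open (S \<times> (UNIV :: 'b set))" by (intro open_Times S open_UNIV)
  show "smooth_on (S \<times> UNIV) (\<lambda>q. \<Sum>b\<in>Basis. (snd q \<bullet> b) *\<^sub>R L (fst q) b)"
    by (intro smooth_on_sum smooth_on_scaleR smooth_on_fst_compose L o
        smooth_on_linear_compose[OF bounded_linear_inner_left] smooth_on_snd)
  show "(\<Sum>b\<in>Basis. (snd q \<bullet> b) *\<^sub>R L (fst q) b) = L (fst q) (snd q)" if "q \<in> S \<times> UNIV" for q
    by (rule linear_eq_sum_Basis[OF lin]) (use that in auto)
qed

lemma vector_bundleD:
  assumes "vector_bundle B"
  shows "smooth_atlas (base B)"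
    "m \<in> carrier (base B) \<Longrightarrow> e \<in> fibre B m \<Longrightarrow> e' \<in> fibre B m \<Longrightarrow> vadd B e e' \<in> fibre B m"
    "m \<in> carrier (base B) \<Longrightarrow> e \<in> fibre B m \<Longrightarrow> vscale B r e \<in> fibre B m"
    "(V, y) \<in> triv B \<Longrightarrow> mopen (base B) V"
    "(V, y) \<in> triv B \<Longrightarrow> fibrewise_linear B V y"
    "(V, y) \<in> triv B \<Longrightarrow> m \<in> V \<Longrightarrow> bij_betw y (fibre B m) UNIV"
    "(V, y) \<in> triv B \<Longrightarrow> (V', y') \<in> triv B \<Longrightarrow>
       smooth_map (base B) flat (V \<inter> V') (\<lambda>m. y' (inv_into (fibre B m) y v))"
    "m \<in> carrier (base B) \<Longrightarrow> \<exists>V y. (V, y) \<in> triv B \<and> m \<in> V"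
proof -
  note d = assms[unfolded vector_bundle_def]
  show "smooth_atlas (base B)" using d by (auto intro: smooth_manifold_imp_atlas)
  show "m \<in> carrier (base B) \<Longrightarrow> e \<in> fibre B m \<Longrightarrow> e' \<in> fibre B m \<Longrightarrow> vadd B e e' \<in> fibre B m"
    "m \<in> carrier (base B) \<Longrightarrow> e \<in> fibre B m \<Longrightarrow> vscale B r e \<in> fibre B m"
    "(V, y) \<in> triv B \<Longrightarrow> mopen (base B) V"
    "(V, y) \<in> triv B \<Longrightarrow> fibrewise_linear B V y"
    "(V, y) \<in> triv B \<Longrightarrow> m \<in> V \<Longrightarrow> bij_betw y (fibre B m) UNIV"
    using d by auto
  have t: "\<forall>(V, y)\<in>triv B. \<forall>(V', y')\<in>triv B. \<forall>v.
        smooth_map (base B) flat (V \<inter> V') (\<lambda>m. y' (inv_into (fibre B m) y v))"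
    using d by (elim conjE)
  show "smooth_map (base B) flat (V \<inter> V') (\<lambda>m. y' (inv_into (fibre B m) y v))"
    if "(V, y) \<in> triv B" "(V', y') \<in> triv B"
    using bspec[OF bspec[OF t that(1), unfolded prod.case] that(2), unfolded prod.case] by (rule spec)
  have "carrier (base B) = (\<Union>(U, y)\<in>triv B. U)" using d by simp
  then show "\<exists>V y. (V, y) \<in> triv B \<and> m \<in> V" if "m \<in> carrier (base B)"
    using that by auto
qed

lemma fibre_inv:
  assumes "bij_betw y (fibre B m) UNIV"
  shows "proj B (inv_into (fibre B m) y v) = m" "y (inv_into (fibre B m) y v) = v"
    "inv_into (fibre B m) y v \<in> fibre B m"
    "proj B e = m \<Longrightarrow> inv_into (fibre B m) y (y e) = e"
proof -
  have v: "v \<in> y ` fibre B m" using assms by (simp add: bij_betw_def)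
  show "inv_into (fibre B m) y v \<in> fibre B m" by (rule inv_into_into[OF v])
  then show "proj B (inv_into (fibre B m) y v) = m" by (simp add: fibre_def)
  show "y (inv_into (fibre B m) y v) = v" by (rule f_inv_into_f[OF v])
  show "inv_into (fibre B m) y (y e) = e" if "proj B e = m"
    by (rule inv_into_f_f) (use assms that in \<open>auto simp: bij_betw_def fibre_def\<close>)
qed

lemma fibrewise_linearD:
  assumes "fibrewise_linear B U y" "m \<in> U"
  shows "e \<in> fibre B m \<Longrightarrow> e' \<in> fibre B m \<Longrightarrow> y (vadd B e e') = y e + y e'"
    "e \<in> fibre B m \<Longrightarrow> y (vscale B r e) = r *\<^sub>R y e"
  using assms unfolding fibrewise_linear_def by auto

lemma fibre_inv_linear:
  assumes vb: "vector_bundle B" and m: "m \<in> carrier (base B)" "m \<in> U"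
    and y: "fibrewise_linear B U y" "bij_betw y (fibre B m) UNIV"
  shows "inv_into (fibre B m) y (v + w) = vadd B (inv_into (fibre B m) y v) (inv_into (fibre B m) y w)"
    and "inv_into (fibre B m) y (r *\<^sub>R v) = vscale B r (inv_into (fibre B m) y v)"
proof -
  note f = fibre_inv[OF y(2)]
  have i: "inv_into (fibre B m) y (y e) = e" if "e \<in> fibre B m" for e
    using that f(4) by (simp add: fibre_def)
  show "inv_into (fibre B m) y (v + w) = vadd B (inv_into (fibre B m) y v) (inv_into (fibre B m) y w)"
    using i[OF vector_bundleD(2)[OF vb m(1) f(3) f(3)]] fibrewise_linearD(1)[OF y(1) m(2) f(3) f(3)] by (simp add: f(2))
  show "inv_into (fibre B m) y (r *\<^sub>R v) = vscale B r (inv_into (fibre B m) y v)"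
    using i[OF vector_bundleD(3)[OF vb m(1) f(3)]] fibrewise_linearD(2)[OF y(1) m(2) f(3)] by (simp add: f(2))
qed

lemma linear_transition:
  assumes vb: "vector_bundle B" and m: "m \<in> carrier (base B)" "m \<in> U" "m \<in> V"
    and y: "fibrewise_linear B U y" "bij_betw y (fibre B m) UNIV" and y': "fibrewise_linear B V y'"
  shows "linear (\<lambda>v. y' (inv_into (fibre B m) y v))"
  by (rule linearI)
     (simp_all add: fibre_inv_linear[OF vb m(1,2) y] fibrewise_linearD[OF y' m(3)] fibre_inv(3)[OF y(2)])

lemma fibred_chart_image:
  fixes B :: "('m, 'e, 'n::finite, 'k::finite) vbundle" and x :: "'m \<Rightarrow> real^'n" and y :: "'e \<Rightarrow> real^'k"
  assumes "\<And>m. m \<in> W \<Longrightarrow> bij_betw y (fibre B m) UNIV"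
  shows "fibred_chart B x y ` (proj B -` W) = x ` W \<times> UNIV"
proof (intro set_eqI iffI)
  fix q assume "q \<in> x ` W \<times> (UNIV :: (real^'k) set)"
  then obtain m where m: "m \<in> W" "fst q = x m" by auto
  let ?e = "inv_into (fibre B m) y (snd q)"
  have "fibred_chart B x y ?e = q" "?e \<in> proj B -` W"
    using fibre_inv[OF assms[OF m(1)]] m by (auto simp: fibred_chart_def prod_eq_iff)
  then show "q \<in> fibred_chart B x y ` (proj B -` W)" by (metis imageI)
qed (auto simp: fibred_chart_def)

lemma fibred_chart_inj:
  assumes "\<And>m. m \<in> W \<Longrightarrow> bij_betw y (fibre B m) UNIV" "inj_on x W"
  shows "inj_on (fibred_chart B x y) (proj B -` W)"
proof (rule inj_onI)
  fix e e' assume e: "e \<in> proj B -` W" "e' \<in> proj B -` W" "fibred_chart B x y e = fibred_chart B x y e'"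
  then have p: "proj B e = proj B e'" using assms(2) by (auto simp: fibred_chart_def inj_on_def)
  have y: "y e = y e'" using e(3) by (simp add: fibred_chart_def)
  have bij: "bij_betw y (fibre B (proj B e)) UNIV" using assms(1) e(1) by simp
  have "e = inv_into (fibre B (proj B e)) y (y e)" using fibre_inv(4)[OF bij refl] by (rule sym)
  also have "\<dots> = e'" unfolding y by (rule fibre_inv(4)[OF bij p[symmetric]])
  finally show "e = e'" .
qed

lemma fibred_chart_inv:
  assumes "\<And>m. m \<in> W \<Longrightarrow> bij_betw y (fibre B m) UNIV" "inj_on x W" "m \<in> W"
  shows "inv_into (proj B -` W) (fibred_chart B x y) (x m, v) = inv_into (fibre B m) y v"
  by (rule inv_into_f_eq[OF fibred_chart_inj[OF assms(1,2)]])
     (use fibre_inv[OF assms(1)[OF assms(3)]] assms(3) in \<open>auto simp: fibred_chart_def\<close>)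

lemma total_atlasE:
  assumes "(P, \<phi>) \<in> total_atlas B"
  obtains U x V y where "P = proj B -` (U \<inter> V)" "\<phi> = fibred_chart B x y" "(U, x) \<in> base B" "(V, y) \<in> triv B"
  using assms unfolding total_atlas_def by auto

text \<open>A change of trivialisation is linear on fibres, and its values on a fixed vector are smooth on
  the base by assumption.\<close>

lemma smooth_atlas_total:
  fixes B :: "('m, 'e, 'n::finite, 'k::finite) vbundle"
  assumes vb: "vector_bundle B"
  shows "smooth_atlas (total_atlas B)"
proof -
  note bas = vector_bundleD(1)[OF vb]
  have 1: "inj_on \<phi> P \<and> open (\<phi> ` P)" if c: "(P, \<phi>) \<in> total_atlas B" for P \<phi>
    using c
  proof (rule total_atlasE)
    fix U x V y assume c: "P = proj B -` (U \<inter> V)" "\<phi> = fibred_chart B x y" "(U, x) \<in> base B" "(V, y) \<in> triv B"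
    have b: "\<And>m. m \<in> U \<inter> V \<Longrightarrow> bij_betw y (fibre B m) UNIV" using vector_bundleD(6)[OF vb c(4)] by auto
    have i: "inj_on x (U \<inter> V)" by (rule inj_on_subset[OF smooth_atlasD(1)[OF bas c(3)]]) auto
    have "open (x ` (U \<inter> V) \<times> (UNIV :: (real^'k) set))"
      by (intro open_Times mopenD(1)[OF vector_bundleD(4)[OF vb c(4)] c(3)] open_UNIV)
    moreover have "\<phi> ` P = x ` (U \<inter> V) \<times> UNIV" unfolding c by (rule fibred_chart_image[OF b])
    moreover have "inj_on \<phi> P" unfolding c by (rule fibred_chart_inj[OF b i])
    ultimately show ?thesis by simp
  qed
  have 2: "smooth_on (\<phi> ` (P \<inter> P')) (\<phi>' \<circ> inv_into P \<phi>)"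
    if c: "(P, \<phi>) \<in> total_atlas B" and c': "(P', \<phi>') \<in> total_atlas B" for P \<phi> P' \<phi>'
  proof -
    obtain U x V y where c: "P = proj B -` (U \<inter> V)" "\<phi> = fibred_chart B x y" "(U, x) \<in> base B" "(V, y) \<in> triv B"
      using c by (rule total_atlasE)
    obtain U' x' V' y' where c': "P' = proj B -` (U' \<inter> V')" "\<phi>' = fibred_chart B x' y'" "(U', x') \<in> base B" "(V', y') \<in> triv B"
      using c' by (rule total_atlasE)
    have b: "\<And>m. m \<in> U \<inter> V \<Longrightarrow> bij_betw y (fibre B m) UNIV" using vector_bundleD(6)[OF vb c(4)] by auto
    have i: "inj_on x (U \<inter> V)" by (rule inj_on_subset[OF smooth_atlasD(1)[OF bas c(3)]]) auto
    define W where "W = (U \<inter> V) \<inter> (U' \<inter> V')"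
    have PP: "P \<inter> P' = proj B -` W" by (auto simp: c c' W_def)
    have im: "\<phi> ` (P \<inter> P') = x ` W \<times> UNIV"
      unfolding PP c(2) by (rule fibred_chart_image) (use b in \<open>auto simp: W_def\<close>)
    have mW: "mopen (base B) W" unfolding W_def
      by (intro mopen_Int[OF bas] mopen_chart[OF bas c(3)] mopen_chart[OF bas c'(3)]
          vector_bundleD(4)[OF vb c(4)] vector_bundleD(4)[OF vb c'(4)])
    have WU: "W \<subseteq> U" by (auto simp: W_def)
    note lc = local_chart_atlas[OF bas c(3)]
    have oW: "open (x ` W)" using mopen_iff_in_chart[OF bas lc WU] mW by simp
    have x': "smooth_on (x ` W) (x' \<circ> inv_into U x)"
      by (rule smooth_on_in_chart[OF bas lc smooth_map_subset[OF bas local_chartD(2)[OF local_chart_atlas[OF bas c'(3)]] mW] WU])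
         (auto simp: W_def)
    have t: "smooth_on (x ` W) ((\<lambda>m. y' (inv_into (fibre B m) y v)) \<circ> inv_into U x)" for v
      by (rule smooth_on_in_chart[OF bas lc smooth_map_subset[OF bas vector_bundleD(7)[OF vb c(4) c'(4)] mW] WU])
         (auto simp: W_def)
    have iU: "inv_into U x (x m) = m" if "m \<in> W" for m using local_chartD(6)[OF lc] that WU by auto
    let ?L = "\<lambda>s v. y' (inv_into (fibre B (inv_into U x s)) y v)"
    have lin: "linear (?L s)" if "s \<in> x ` W" for s
    proof -
      obtain m where m: "m \<in> W" "s = x m" using \<open>s \<in> x ` W\<close> by auto
      have "linear (\<lambda>v. y' (inv_into (fibre B m) y v))"
        by (rule linear_transition[OF vb, of m V V'])
           (use m mopenD(2)[OF mW] b vector_bundleD(5)[OF vb c(4)] vector_bundleD(5)[OF vb c'(4)] in \<open>auto simp: W_def\<close>)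
      then show ?thesis using m iU by simp
    qed
    have "smooth_on (x ` W \<times> UNIV) (\<lambda>q. ((x' \<circ> inv_into U x) (fst q), ?L (fst q) (snd q)))"
      by (intro smooth_on_Pair smooth_on_fst_compose[OF x'] smooth_on_family_linear[OF oW _ lin]) (use t in \<open>auto simp: o_def\<close>)
    then show ?thesis
      unfolding im
    proof (rule smooth_on_cong)
      fix q assume "q \<in> x ` W \<times> (UNIV :: (real^'k) set)"
      then obtain m v where m: "m \<in> W" "q = (x m, v)" by auto
      have mm: "m \<in> U \<inter> V" using m by (auto simp: W_def)
      have "inv_into P \<phi> q = inv_into (fibre B m) y v"
        unfolding m(2) c by (rule fibred_chart_inv[OF b i mm])
      then show "((x' \<circ> inv_into U x) (fst q), ?L (fst q) (snd q)) = (\<phi>' \<circ> inv_into P \<phi>) q"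
        using m iU[OF m(1)] fibre_inv(1)[OF b[OF mm]] by (simp add: c' fibred_chart_def)
    qed
  qed
  show ?thesis unfolding smooth_atlas_def using 1 2 by auto
qed

lemma carrier_total_atlas:
  assumes vb: "vector_bundle B"
  shows "carrier (total_atlas B) = total B"
proof (intro set_eqI iffI)
  fix e assume "e \<in> carrier (total_atlas B)"
  then obtain P \<phi> where "(P, \<phi>) \<in> total_atlas B" "e \<in> P" by (rule carrierE)
  then show "e \<in> total B" using chart_subset_carrier by (auto elim!: total_atlasE simp: total_def)
next
  fix e assume e: "e \<in> total B"
  then have m: "proj B e \<in> carrier (base B)" by (simp add: total_def)
  obtain U x where "(U, x) \<in> base B" "proj B e \<in> U" using m by (rule carrierE)
  moreover obtain V y where "(V, y) \<in> triv B" "proj B e \<in> V" using vector_bundleD(8)[OF vb m] by auto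
  ultimately show "e \<in> carrier (total_atlas B)" unfolding carrier_def total_atlas_def by blast
qed

lemma smooth_map_proj:
  fixes B :: "('m, 'e, 'n::finite, 'k::finite) vbundle"
  assumes vb: "vector_bundle B"
  shows "smooth_map (total_atlas B) (base B) (total B) (proj B)"
proof (rule smooth_mapI)
  note A = smooth_atlas_total[OF vb] and bas = vector_bundleD(1)[OF vb]
  show "mopen (total_atlas B) (total B)"
    unfolding carrier_total_atlas[OF vb, symmetric]
  proof (rule mopenI)
    fix P \<phi> assume c: "(P, \<phi>) \<in> total_atlas B"
    have "P \<inter> carrier (total_atlas B) = P" using chart_subset_carrier[OF c] by auto
    then show "open (\<phi> ` (P \<inter> carrier (total_atlas B)))" using smooth_atlasD(2)[OF A c] by simp
  qed auto
  show "proj B e \<in> carrier (base B)" if "e \<in> total B" for e using that by (simp add: total_def)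
  fix P \<phi> U' x' assume c: "(P, \<phi>) \<in> total_atlas B" and c': "(U', x') \<in> base B"
  obtain U x V y where c: "P = proj B -` (U \<inter> V)" "\<phi> = fibred_chart B x y" "(U, x) \<in> base B" "(V, y) \<in> triv B"
    using c by (rule total_atlasE)
  have b: "\<And>m. m \<in> U \<inter> V \<Longrightarrow> bij_betw y (fibre B m) UNIV" using vector_bundleD(6)[OF vb c(4)] by auto
  have i: "inj_on x (U \<inter> V)" by (rule inj_on_subset[OF smooth_atlasD(1)[OF bas c(3)]]) auto
  define W where "W = (U \<inter> V) \<inter> U'"
  have WU: "W \<subseteq> U" by (auto simp: W_def)
  have mW: "mopen (base B) W" unfolding W_def
    by (intro mopen_Int[OF bas] mopen_chart[OF bas c(3)] mopen_chart[OF bas c'] vector_bundleD(4)[OF vb c(4)])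
  have PP: "P \<inter> total B \<inter> proj B -` U' = proj B -` W"
    using mopenD(2)[OF mW] by (auto simp: c W_def total_def)
  have im: "\<phi> ` (P \<inter> total B \<inter> proj B -` U') = x ` W \<times> UNIV"
    unfolding PP c(2) by (rule fibred_chart_image) (use b in \<open>auto simp: W_def\<close>)
  note lc = local_chart_atlas[OF bas c(3)]
  have x': "smooth_on (x ` W) (x' \<circ> inv_into U x)"
    by (rule smooth_on_in_chart[OF bas lc smooth_map_subset[OF bas local_chartD(2)[OF local_chart_atlas[OF bas c']] mW] WU])
       (auto simp: W_def)
  have "smooth_on (x ` W \<times> (UNIV :: (real^'k) set)) (\<lambda>q. (x' \<circ> inv_into U x) (fst q))"
    by (rule smooth_on_fst_compose[OF x'])
  then show "smooth_on (\<phi> ` (P \<inter> total B \<inter> proj B -` U')) (x' \<circ> proj B \<circ> inv_into P \<phi>)"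
    unfolding im
  proof (rule smooth_on_cong)
    fix q assume "q \<in> x ` W \<times> (UNIV :: (real^'k) set)"
    then obtain m v where m: "m \<in> W" "q = (x m, v)" by auto
    have mm: "m \<in> U \<inter> V" using m by (auto simp: W_def)
    have "inv_into P \<phi> q = inv_into (fibre B m) y v"
      unfolding m(2) c by (rule fibred_chart_inv[OF b i mm])
    then show "(x' \<circ> inv_into U x) (fst q) = (x' \<circ> proj B \<circ> inv_into P \<phi>) q"
      using m local_chartD(6)[OF lc, of m] mm fibre_inv(1)[OF b[OF mm]] by simp
  qed
qed

lemma smooth_map_compose_proj:
  assumes vb: "vector_bundle B" and f: "smooth_map (base B) flat W f"
  shows "smooth_map (total_atlas B) flat (proj B -` W) (f \<circ> proj B)"
proof -
  have "smooth_map (total_atlas B) flat (total B \<inter> proj B -` W) (f \<circ> proj B)"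
    by (rule smooth_map_compose[OF smooth_atlas_total[OF vb] vector_bundleD(1)[OF vb] smooth_map_proj[OF vb] f])
  moreover have "total B \<inter> proj B -` W = proj B -` W" using mopenD(2)[OF smooth_mapD(1)[OF f]] by (auto simp: total_def)
  ultimately show ?thesis by simp
qed

lemma linear_fibre_coordsD:
  assumes "linear_fibre_coords B U y"
  shows "mopen (base B) U" "fibrewise_linear B U y" "m \<in> U \<Longrightarrow> bij_betw y (fibre B m) UNIV"
    "smooth_map (total_atlas B) flat (proj B -` U) y"
  using assms unfolding linear_fibre_coords_def by auto

text \<open>The point is smoothness of the inverse, that is, of \<open>y1\<close> as a function of \<open>x\<close> and \<open>y\<close> for each
  trivialisation \<open>y1\<close>. What is given is the converse, smoothness of \<open>y\<close> in terms of \<open>y1\<close>. Since the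
  change of fibre coordinates is linear, this amounts to inverting a matrix that depends smoothly on
  the base point.\<close>

lemma local_chart_fibred_chart:
  fixes B :: "('m, 'e, 'n::finite, 'k::finite) vbundle"
  assumes vb: "vector_bundle B" and ch: "local_chart (base B) U x" and fc: "linear_fibre_coords B U y"
  shows "local_chart (total_atlas B) (proj B -` U) (fibred_chart B x y)"
  unfolding local_chart_def
proof (intro conjI)
  note A = smooth_atlas_total[OF vb] and bas = vector_bundleD(1)[OF vb]
  note y = linear_fibre_coordsD[OF fc]
  let ?P = "proj B -` U" and ?\<Phi> = "fibred_chart B x y"
  show inj: "inj_on ?\<Phi> ?P" by (rule fibred_chart_inj[OF y(3) local_chartD(1)[OF ch]])
  show "smooth_map (total_atlas B) flat ?P ?\<Phi>"
    using smooth_map_Pair[OF smooth_map_compose_proj[OF vb local_chartD(2)[OF ch]] y(4)]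
    by (simp add: fibred_chart_def o_def)
  have imU: "?\<Phi> ` ?P = x ` U \<times> UNIV" by (rule fibred_chart_image[OF y(3)])
  show "smooth_map flat (total_atlas B) (?\<Phi> ` ?P) (inv_into ?P ?\<Phi>)"
  proof (rule smooth_mapI)
    show "mopen flat (?\<Phi> ` ?P)" unfolding imU using local_chartD(5)[OF ch] by (simp add: open_Times)
    show "inv_into ?P ?\<Phi> q \<in> carrier (total_atlas B)" if "q \<in> ?\<Phi> ` ?P" for q
      using inv_into_into[OF that] mopenD(2)[OF y(1)] unfolding carrier_total_atlas[OF vb] by (auto simp: total_def)
    fix D and f :: "(real^'n) \<times> (real^'k) \<Rightarrow> (real^'n) \<times> (real^'k)" and P \<phi>
    assume "(D, f) \<in> flat" and c: "(P, \<phi>) \<in> total_atlas B"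
    then have f: "D = UNIV" "f = (\<lambda>v. v)" by (auto simp: flat_def)
    have lcP: "local_chart (total_atlas B) P \<phi>" by (rule local_chart_atlas[OF A c])
    obtain U1 x1 V1 y1 where c: "P = proj B -` (U1 \<inter> V1)" "\<phi> = fibred_chart B x1 y1" "(U1, x1) \<in> base B" "(V1, y1) \<in> triv B"
      using c by (rule total_atlasE)
    have b1: "\<And>m. m \<in> U1 \<inter> V1 \<Longrightarrow> bij_betw y1 (fibre B m) UNIV" using vector_bundleD(6)[OF vb c(4)] by auto
    have i1: "inj_on x1 (U1 \<inter> V1)" by (rule inj_on_subset[OF smooth_atlasD(1)[OF bas c(3)]]) auto
    define W where "W = U \<inter> (U1 \<inter> V1)"
    have WU: "W \<subseteq> U" by (auto simp: W_def)
    have mW: "mopen (base B) W" unfolding W_def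
      by (intro mopen_Int[OF bas] mopen_chart[OF bas c(3)] y(1) vector_bundleD(4)[OF vb c(4)])
    have oW: "open (x ` W)" using mopen_iff_in_chart[OF bas ch WU] mW by simp
    have iU: "inv_into U x (x m) = m" if "m \<in> W" for m using local_chartD(6)[OF ch] that WU by auto
    have inv: "inv_into ?P ?\<Phi> (x m, v) = inv_into (fibre B m) y v" if "m \<in> W" for m v
      by (rule fibred_chart_inv[OF y(3) local_chartD(1)[OF ch]]) (use that WU in auto)
    have set: "f ` (D \<inter> ?\<Phi> ` ?P \<inter> inv_into ?P ?\<Phi> -` P) = x ` W \<times> UNIV"
    proof (intro set_eqI iffI)
      fix q assume "q \<in> f ` (D \<inter> ?\<Phi> ` ?P \<inter> inv_into ?P ?\<Phi> -` P)"
      then have "q \<in> ?\<Phi> ` ?P" "inv_into ?P ?\<Phi> q \<in> P" by (auto simp: f)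
      then obtain e where e: "e \<in> ?P" "q = ?\<Phi> e" "e \<in> P" using inj by auto
      then show "q \<in> x ` W \<times> UNIV" by (auto simp: c W_def fibred_chart_def)
    next
      fix q assume "q \<in> x ` W \<times> (UNIV :: (real^'k) set)"
      then obtain m v where m: "m \<in> W" "q = (x m, v)" by auto
      have "q \<in> ?\<Phi> ` ?P" unfolding imU using m WU by auto
      moreover have "proj B (inv_into ?P ?\<Phi> q) = m"
        unfolding m(2) inv[OF m(1)] by (rule fibre_inv(1)[OF y(3)]) (use m WU in auto)
      ultimately show "q \<in> f ` (D \<inter> ?\<Phi> ` ?P \<inter> inv_into ?P ?\<Phi> -` P)"
        using m(1) by (auto simp: f c W_def)
    qed
    have x1: "smooth_on (x ` W) (x1 \<circ> inv_into U x)"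
      by (rule smooth_on_in_chart[OF bas ch smooth_map_subset[OF bas local_chartD(2)[OF local_chart_atlas[OF bas c(3)]] mW] WU])
         (auto simp: W_def)
    have y1: "smooth_on (\<phi> ` (P \<inter> ?P)) (y \<circ> inv_into P \<phi>)"
      using smooth_map_in_chart[OF A lcP y(4)] by simp
    \<comment> \<open>The matrix of the change of fibre coordinates from \<open>y1\<close> to \<open>y\<close>; it depends on the first
      component of \<open>q\<close> alone, but the linear system below has the second component as right-hand side.\<close>
    define C where "C = (\<lambda>q :: (real^'n) \<times> (real^'k). matrix (\<lambda>u. y (inv_into (fibre B (inv_into U x (fst q))) y1 u)))"
    have col: "smooth_on (x ` W) (\<lambda>s. y (inv_into (fibre B (inv_into U x s)) y1 u))" for u
    proof (rule smooth_on_cong)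
      show "smooth_on (x ` W) ((y \<circ> inv_into P \<phi>) \<circ> (\<lambda>s. ((x1 \<circ> inv_into U x) s, u)))"
      proof (rule smooth_on_compose[OF _ y1])
        show "smooth_on (x ` W) (\<lambda>s. ((x1 \<circ> inv_into U x) s, u))"
          by (intro smooth_on_Pair x1 smooth_on_const oW)
        have "\<phi> ` (P \<inter> ?P) = x1 ` W \<times> UNIV"
        proof -
          have PW: "P \<inter> ?P = proj B -` W" by (auto simp: c W_def)
          show ?thesis unfolding PW c(2) by (rule fibred_chart_image) (use b1 in \<open>auto simp: W_def\<close>)
        qed
        then show "(\<lambda>s. ((x1 \<circ> inv_into U x) s, u)) ` (x ` W) \<subseteq> \<phi> ` (P \<inter> ?P)" using iU by auto
      qed
      fix s assume "s \<in> x ` W"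
      then obtain m where m: "m \<in> W" "s = x m" by auto
      have mm: "m \<in> U1 \<inter> V1" using m by (auto simp: W_def)
      have "inv_into P \<phi> (x1 m, u) = inv_into (fibre B m) y1 u"
        unfolding c by (rule fibred_chart_inv[OF b1 i1 mm])
      then show "((y \<circ> inv_into P \<phi>) \<circ> (\<lambda>s. ((x1 \<circ> inv_into U x) s, u))) s = y (inv_into (fibre B (inv_into U x s)) y1 u)"
        using m iU by simp
    qed
    have oWU: "open (x ` W \<times> (UNIV :: (real^'k) set))" by (intro open_Times oW open_UNIV)
    have smC: "smooth_on (x ` W \<times> UNIV) (\<lambda>q. C q $ i $ j)" for i j
      using smooth_on_linear_compose[OF bounded_linear_vec_nth smooth_on_fst_compose[OF col, of "axis j 1"], of i]
      by (simp add: C_def matrix_def)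
    have lin: "linear (\<lambda>u. y (inv_into (fibre B m) y1 u))" and lin': "linear (\<lambda>u. y1 (inv_into (fibre B m) y u))"
      and inv1: "y (inv_into (fibre B m) y1 (y1 (inv_into (fibre B m) y v))) = v"
      and inv2: "y1 (inv_into (fibre B m) y (y (inv_into (fibre B m) y1 v))) = v"
      if m: "m \<in> W" for m v
    proof -
      have mm: "m \<in> U" "m \<in> U1 \<inter> V1" "m \<in> carrier (base B)" "m \<in> V1" using m mopenD(2)[OF mW] by (auto simp: W_def)
      show "linear (\<lambda>u. y (inv_into (fibre B m) y1 u))"
        by (rule linear_transition[OF vb mm(3,4,1) vector_bundleD(5)[OF vb c(4)] b1[OF mm(2)] y(2)])
      show "linear (\<lambda>u. y1 (inv_into (fibre B m) y u))"
        by (rule linear_transition[OF vb mm(3,1,4) y(2) y(3)[OF mm(1)] vector_bundleD(5)[OF vb c(4)]])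
      show "y (inv_into (fibre B m) y1 (y1 (inv_into (fibre B m) y v))) = v"
        using fibre_inv[OF y(3)[OF mm(1)]] fibre_inv(4)[OF b1[OF mm(2)]] by simp
      show "y1 (inv_into (fibre B m) y (y (inv_into (fibre B m) y1 v))) = v"
        using fibre_inv[OF b1[OF mm(2)]] fibre_inv(4)[OF y(3)[OF mm(1)]] by simp
    qed
    have X: "smooth_on (x ` W \<times> (UNIV :: (real^'k) set)) (\<lambda>q. y1 (inv_into (fibre B (inv_into U x (fst q))) y (snd q)))"
    proof (rule smooth_on_solution_of_linear_system[OF oWU smC smooth_on_snd[OF oWU]])
      fix q assume "q \<in> x ` W \<times> (UNIV :: (real^'k) set)"
      then obtain m where m: "m \<in> W" "inv_into U x (fst q) = m" using iU by auto
      let ?f = "\<lambda>u. y (inv_into (fibre B m) y1 u)" and ?g = "\<lambda>u. y1 (inv_into (fibre B m) y u)"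
      have Cq: "C q = matrix ?f" by (simp add: C_def m)
      have "matrix ?g ** matrix ?f = matrix (?g \<circ> ?f)"
        by (rule matrix_compose[symmetric, OF lin[OF m(1)] lin'[OF m(1)]])
      also have "?g \<circ> ?f = id" using inv2[OF m(1)] by (auto simp: fun_eq_iff)
      finally have "matrix ?g ** matrix ?f = mat 1" unfolding matrix_id_mat_1 .
      then show "invertible (C q)" unfolding Cq invertible_left_inverse by blast
      show "C q *v y1 (inv_into (fibre B (inv_into U x (fst q))) y (snd q)) = snd q"
        unfolding Cq m(2) fun_cong[OF matrix_vector_mul(2)[OF lin[OF m(1)]]] by (rule inv1[OF m(1)])
    qed
    have "smooth_on (x ` W \<times> (UNIV :: (real^'k) set)) (\<lambda>q. ((x1 \<circ> inv_into U x) (fst q), y1 (inv_into (fibre B (inv_into U x (fst q))) y (snd q))))"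
      by (intro smooth_on_Pair smooth_on_fst_compose[OF x1] X)
    then show "smooth_on (f ` (D \<inter> ?\<Phi> ` ?P \<inter> inv_into ?P ?\<Phi> -` P)) (\<phi> \<circ> inv_into ?P ?\<Phi> \<circ> inv_into D f)"
      unfolding set
    proof (rule smooth_on_cong)
      fix q assume "q \<in> x ` W \<times> (UNIV :: (real^'k) set)"
      then obtain m v where m: "m \<in> W" "q = (x m, v)" by auto
      have "proj B (inv_into (fibre B m) y v) = m" by (rule fibre_inv(1)[OF y(3)]) (use m WU in auto)
      then show "((x1 \<circ> inv_into U x) (fst q), y1 (inv_into (fibre B (inv_into U x (fst q))) y (snd q)))
         = (\<phi> \<circ> inv_into ?P ?\<Phi> \<circ> inv_into D f) q"
        using m iU inv by (simp add: f c(2) fibred_chart_def)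
    qed
  qed
qed

lemma linear_fibre_coords_triv:
  assumes vb: "vector_bundle B" and c: "(U, x) \<in> base B" "(V, y) \<in> triv B"
  shows "local_chart (base B) (U \<inter> V) x" "linear_fibre_coords B (U \<inter> V) y"
proof -
  note A = smooth_atlas_total[OF vb] and bas = vector_bundleD(1)[OF vb]
  have m: "mopen (base B) (U \<inter> V)"
    by (intro mopen_Int[OF bas] mopen_chart[OF bas c(1)] vector_bundleD(4)[OF vb c(2)])
  show "local_chart (base B) (U \<inter> V) x"
    by (rule local_chart_subset[OF bas local_chart_atlas[OF bas c(1)] m]) auto
  have "(proj B -` (U \<inter> V), fibred_chart B x y) \<in> total_atlas B" using c unfolding total_atlas_def by blast
  note s = local_chartD(2)[OF local_chart_atlas[OF A this]]
  have "smooth_map (total_atlas B) flat (proj B -` (U \<inter> V) \<inter> fibred_chart B x y -` UNIV) (snd \<circ> fibred_chart B x y)"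
    by (rule smooth_map_compose[OF A smooth_atlas_flat s]) (simp add: smooth_on_snd)
  then have "smooth_map (total_atlas B) flat (proj B -` (U \<inter> V)) y" by (simp add: fibred_chart_def o_def)
  then show "linear_fibre_coords B (U \<inter> V) y"
    using m vector_bundleD(5,6)[OF vb c(2)] unfolding linear_fibre_coords_def by (auto simp: fibrewise_linear_def)
qed

section \<open>Connections in coordinates\<close>

context
  fixes S :: "'a::euclidean_space set"
    and G :: "'a \<Rightarrow> 'b::euclidean_space \<Rightarrow> 'c::euclidean_space \<Rightarrow> 'd::euclidean_space"
  assumes smooth: "\<And>a v. smooth_on S (\<lambda>s. G s a v)"
    and lin1: "\<And>s v. s \<in> S \<Longrightarrow> linear (\<lambda>a. G s a v)" and lin2: "\<And>s a. s \<in> S \<Longrightarrow> linear (G s a)"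
begin

text \<open>The families meant here are the coordinate expressions of linear connections: bilinear in \<open>a\<close>
  and \<open>v\<close>, and smooth in \<open>s\<close> when these are fixed. Expanding in bases makes all joint properties
  consequences of the product rule.\<close>

lemma bilinear_family_expand:
  assumes "s \<in> S"
  shows "(\<Sum>c\<in>Basis. \<Sum>b\<in>Basis. ((a \<bullet> c) * (v \<bullet> b)) *\<^sub>R G s c b) = G s a v"
proof -
  have "(\<Sum>c\<in>Basis. \<Sum>b\<in>Basis. ((a \<bullet> c) * (v \<bullet> b)) *\<^sub>R G s c b)
      = (\<Sum>c\<in>Basis. (a \<bullet> c) *\<^sub>R (\<Sum>b\<in>Basis. (v \<bullet> b) *\<^sub>R G s c b))"
    by (simp add: scaleR_right.sum)
  also have "\<dots> = (\<Sum>c\<in>Basis. (a \<bullet> c) *\<^sub>R G s c v)"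
    by (simp only: linear_eq_sum_Basis[OF lin2[OF assms]])
  also have "\<dots> = G s a v"
    by (rule linear_eq_sum_Basis[OF lin1[OF assms]])
  finally show ?thesis .
qed

lemma bilinear_family_derivative_expand:
  assumes s: "s \<in> S"
  shows "(\<Sum>c\<in>Basis. \<Sum>b\<in>Basis. ((a \<bullet> c) * (v \<bullet> b)) *\<^sub>R frechet_derivative (\<lambda>s. G s c b) (at s) w) =
    frechet_derivative (\<lambda>s. G s a v) (at s) w"
proof -
  have "((\<lambda>r. \<Sum>c\<in>Basis. \<Sum>b\<in>Basis. ((a \<bullet> c) * (v \<bullet> b)) *\<^sub>R G r c b) has_derivative
      (\<lambda>w. \<Sum>c\<in>Basis. \<Sum>b\<in>Basis. ((a \<bullet> c) * (v \<bullet> b)) *\<^sub>R frechet_derivative (\<lambda>s. G s c b) (at s) w)) (at s)"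
    by (intro has_derivative_sum has_derivative_scaleR_right smooth_on_has_derivative[OF smooth s])
  then have "((\<lambda>r. G r a v) has_derivative
      (\<lambda>w. \<Sum>c\<in>Basis. \<Sum>b\<in>Basis. ((a \<bullet> c) * (v \<bullet> b)) *\<^sub>R frechet_derivative (\<lambda>s. G s c b) (at s) w)) (at s)"
    by (rule has_derivative_transform_near[OF _ smooth_on_open[OF smooth] s]) (rule bilinear_family_expand)
  then show ?thesis by (rule fun_cong[OF frechet_derivative_at])
qed

lemma bilinear_family_smooth:
  assumes A: "smooth_on R A" and R: "R \<subseteq> S \<times> UNIV"
  shows "smooth_on R (\<lambda>q. G (fst q) (A q) (snd q))"
proof (rule smooth_on_cong)
  note o = smooth_on_open[OF A]
  have g: "smooth_on R (\<lambda>q. G (fst q) c b)" for c b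
    by (rule smooth_on_subset[OF smooth_on_fst_compose[OF smooth] o R])
  show "smooth_on R (\<lambda>q. \<Sum>c\<in>Basis. \<Sum>b\<in>Basis. ((A q \<bullet> c) * (snd q \<bullet> b)) *\<^sub>R G (fst q) c b)"
    by (intro smooth_on_sum smooth_on_scaleR smooth_on_mult o g
        smooth_on_linear_compose[OF bounded_linear_inner_left] A smooth_on_snd)
  show "(\<Sum>c\<in>Basis. \<Sum>b\<in>Basis. ((A q \<bullet> c) * (snd q \<bullet> b)) *\<^sub>R G (fst q) c b) = G (fst q) (A q) (snd q)"
    if "q \<in> R" for q
    by (rule bilinear_family_expand) (use that R in auto)
qed

lemma bilinear_family_derivative:
  assumes A: "smooth_on R A" and R: "R \<subseteq> S \<times> UNIV" and q: "q \<in> R"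
  shows "((\<lambda>q. G (fst q) (A q) (snd q)) has_derivative (\<lambda>w.
    frechet_derivative (\<lambda>s. G s (A q) (snd q)) (at (fst q)) (fst w)
    + G (fst q) (frechet_derivative A (at q) w) (snd q) + G (fst q) (A q) (snd w))) (at q)"
proof -
  have sS: "fst q \<in> S" using q R by auto
  have dA: "((\<lambda>q. A q \<bullet> c) has_derivative (\<lambda>w. frechet_derivative A (at q) w \<bullet> c)) (at q)" for c
    by (rule bounded_linear.has_derivative[OF bounded_linear_inner_left smooth_on_has_derivative[OF A q]])
  have ds: "((\<lambda>q. snd q \<bullet> b) has_derivative (\<lambda>w. snd w \<bullet> b)) (at q)" for b
    by (rule bounded_linear_imp_has_derivative)
       (rule bounded_linear_compose[OF bounded_linear_inner_left bounded_linear_snd])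
  have dG: "((\<lambda>q. G (fst q) c b) has_derivative (\<lambda>w. frechet_derivative (\<lambda>s. G s c b) (at (fst q)) (fst w))) (at q)" for c b
  proof -
    have "((\<lambda>s. G s c b) \<circ> fst has_derivative frechet_derivative (\<lambda>s. G s c b) (at (fst q)) \<circ> fst) (at q)"
      by (rule diff_chain_at[OF bounded_linear_imp_has_derivative[OF bounded_linear_fst] smooth_on_has_derivative[OF smooth sS]])
    then show ?thesis by (simp add: o_def)
  qed
  have "((\<lambda>q. \<Sum>c\<in>Basis. \<Sum>b\<in>Basis. ((A q \<bullet> c) * (snd q \<bullet> b)) *\<^sub>R G (fst q) c b) has_derivative
     (\<lambda>w. \<Sum>c\<in>Basis. \<Sum>b\<in>Basis.
        ((A q \<bullet> c) * (snd q \<bullet> b)) *\<^sub>R frechet_derivative (\<lambda>s. G s c b) (at (fst q)) (fst w)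
        + ((A q \<bullet> c) * (snd w \<bullet> b) + (frechet_derivative A (at q) w \<bullet> c) * (snd q \<bullet> b)) *\<^sub>R G (fst q) c b)) (at q)"
    by (intro has_derivative_sum has_derivative_scaleR has_derivative_mult dA ds dG)
  then have "((\<lambda>q. \<Sum>c\<in>Basis. \<Sum>b\<in>Basis. ((A q \<bullet> c) * (snd q \<bullet> b)) *\<^sub>R G (fst q) c b) has_derivative
     (\<lambda>w. (\<Sum>c\<in>Basis. \<Sum>b\<in>Basis. ((A q \<bullet> c) * (snd q \<bullet> b)) *\<^sub>R frechet_derivative (\<lambda>s. G s c b) (at (fst q)) (fst w))
       + (\<Sum>c\<in>Basis. \<Sum>b\<in>Basis. ((frechet_derivative A (at q) w \<bullet> c) * (snd q \<bullet> b)) *\<^sub>R G (fst q) c b)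
       + (\<Sum>c\<in>Basis. \<Sum>b\<in>Basis. ((A q \<bullet> c) * (snd w \<bullet> b)) *\<^sub>R G (fst q) c b))) (at q)"
    by (simp only: scaleR_left_distrib sum.distrib add.assoc add.commute add.left_commute)
  then have "((\<lambda>q. \<Sum>c\<in>Basis. \<Sum>b\<in>Basis. ((A q \<bullet> c) * (snd q \<bullet> b)) *\<^sub>R G (fst q) c b) has_derivative
     (\<lambda>w. frechet_derivative (\<lambda>s. G s (A q) (snd q)) (at (fst q)) (fst w)
    + G (fst q) (frechet_derivative A (at q) w) (snd q) + G (fst q) (A q) (snd w))) (at q)"
    by (simp only: bilinear_family_expand[OF sS] bilinear_family_derivative_expand[OF sS])
  then show ?thesis
    by (rule has_derivative_transform_near[OF _ smooth_on_open[OF A] q])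
       (rule bilinear_family_expand, use R in auto)
qed

end

locale bundle_coords =
  fixes B :: "('m, 'e, 'n::finite, 'k::finite) vbundle" and U :: "'m set"
    and x :: "'m \<Rightarrow> real^'n" and y :: "'e \<Rightarrow> real^'k"
  assumes vb: "vector_bundle B" and ch: "local_chart (base B) U x" and fc: "linear_fibre_coords B U y"
begin

abbreviation "TA \<equiv> total_atlas B"
abbreviation "P \<equiv> proj B -` U"
abbreviation "\<Phi> \<equiv> fibred_chart B x y"

lemmas total_smooth = smooth_atlas_total[OF vb]
lemmas base_smooth = vector_bundleD(1)[OF vb]
lemmas fibred = local_chart_fibred_chart[OF vb ch fc]
lemmas yD = linear_fibre_coordsD[OF fc]

text \<open>The point of the total space with coordinates \<open>(s, v)\<close>.\<close>

definition pt :: "real^'n \<Rightarrow> real^'k \<Rightarrow> 'e" where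
  "pt s v = inv_into (fibre B (inv_into U x s)) y v"

lemma image_fibred: "\<Phi> ` P = x ` U \<times> UNIV" by (rule fibred_chart_image[OF yD(3)])

lemma U_carrier: "m \<in> U \<Longrightarrow> m \<in> carrier (base B)" using mopenD(2)[OF yD(1)] by auto

lemma P_total: "e \<in> P \<Longrightarrow> e \<in> total B" using U_carrier by (simp add: total_def)

lemma pt_proj: "e \<in> P \<Longrightarrow> pt (x (proj B e)) (y e) = e"
  unfolding pt_def using fibre_inv(4)[OF yD(3)] local_chartD(6)[OF ch] by simp

lemma
  assumes "s \<in> x ` U"
  shows pt_in: "pt s v \<in> P" and proj_pt: "proj B (pt s v) = inv_into U x s"
    and x_pt: "x (proj B (pt s v)) = s" and y_pt: "y (pt s v) = v"
    and inv_fibred: "inv_into P \<Phi> (s, v) = pt s v"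
proof -
  obtain m where m: "m \<in> U" "s = x m" using assms by auto
  note i = local_chartD(6)[OF ch m(1)] and f = fibre_inv[OF yD(3)[OF m(1)]]
  show "pt s v \<in> P" "proj B (pt s v) = inv_into U x s" "x (proj B (pt s v)) = s" "y (pt s v) = v"
    using f m by (simp_all add: pt_def i)
  show "inv_into P \<Phi> (s, v) = pt s v"
    unfolding m(2) pt_def i by (rule fibred_chart_inv[OF yD(3) local_chartD(1)[OF ch] m(1)])
qed

lemma tangent_map_proj:
  assumes e: "e \<in> P"
  shows "tangent_map (base B) (proj B) e (coord_vec TA P \<Phi> w e) = coord_vec (base B) U x (fst w) (proj B e)"
proof -
  have o: "open (\<Phi> ` P)" by (rule local_chartD(5)[OF fibred])
  have "frechet_derivative (x \<circ> proj B \<circ> inv_into P \<Phi>) (at (\<Phi> e)) = frechet_derivative fst (at (\<Phi> e))"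
  proof (rule frechet_derivative_cong_near[OF smooth_on_fst[OF o]])
    fix q assume "q \<in> \<Phi> ` P"
    then obtain s v where q: "q = (s, v)" "s \<in> x ` U" unfolding image_fibred by auto
    show "fst q = (x \<circ> proj B \<circ> inv_into P \<Phi>) q" by (simp add: q inv_fibred x_pt)
  qed (use e in simp)
  also have "\<dots> = fst"
    by (rule frechet_derivative_at[OF bounded_linear_imp_has_derivative[OF bounded_linear_fst], symmetric])
  finally show ?thesis
    using tangent_map_coord_vec[OF total_smooth fibred base_smooth ch e _ smooth_map_proj[OF vb] P_total[OF e], of w] e by simp
qed

lemma section_in_coords:
  assumes \<sigma>: "local_section B m \<sigma>" and m: "m \<in> U"
  obtains W where "m \<in> W" "W \<subseteq> U" "smooth_map (base B) TA W \<sigma>" "smooth_on (x ` W) (y \<circ> \<sigma> \<circ> inv_into U x)"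
    "\<forall>q\<in>W. proj B (\<sigma> q) = q"
proof -
  obtain W where W: "m \<in> W" "smooth_map (base B) TA W \<sigma>" "\<And>q. q \<in> W \<Longrightarrow> proj B (\<sigma> q) = q"
    using \<sigma> unfolding local_section_def by auto
  have WU: "W \<inter> \<sigma> -` P = W \<inter> U" using W(3) by auto
  have s: "smooth_map (base B) flat (W \<inter> U) (y \<circ> \<sigma>)"
    using smooth_map_compose[OF base_smooth total_smooth W(2) yD(4)] unfolding WU .
  have "smooth_map (base B) TA (W \<inter> U) \<sigma>"
    by (rule smooth_map_subset[OF base_smooth W(2) smooth_mapD(1)[OF s]]) auto
  then show thesis
    by (rule that[rotated 2]) (use smooth_on_in_chart[OF base_smooth ch s] W m in auto)
qed

lemma tangent_map_section:
  assumes \<sigma>: "local_section B m \<sigma>" and m: "m \<in> U"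
  shows "tangent_map TA \<sigma> m (coord_vec (base B) U x a m) =
    coord_vec TA P \<Phi> (a, frechet_derivative (y \<circ> \<sigma> \<circ> inv_into U x) (at (x m)) a) (\<sigma> m)"
proof -
  obtain W where W: "m \<in> W" "W \<subseteq> U" "smooth_map (base B) TA W \<sigma>" "smooth_on (x ` W) (y \<circ> \<sigma> \<circ> inv_into U x)"
    "\<forall>q\<in>W. proj B (\<sigma> q) = q"
    using section_in_coords[OF \<sigma> m] .
  let ?S = "y \<circ> \<sigma> \<circ> inv_into U x"
  have "((\<lambda>s. (s, ?S s)) has_derivative (\<lambda>a. (a, frechet_derivative ?S (at (x m)) a))) (at (x m))"
    by (rule has_derivative_Pair[OF has_derivative_ident smooth_on_has_derivative[OF W(4)]]) (use W in auto)
  then have "(\<Phi> \<circ> \<sigma> \<circ> inv_into U x has_derivative (\<lambda>a. (a, frechet_derivative ?S (at (x m)) a))) (at (x m))"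
  proof (rule has_derivative_transform_near[OF _ smooth_on_open[OF W(4)]])
    fix s assume "s \<in> x ` W"
    then obtain q where "q \<in> W" "s = x q" by auto
    then show "(s, ?S s) = (\<Phi> \<circ> \<sigma> \<circ> inv_into U x) s"
      using W(2,5) local_chartD(6)[OF ch, of q] by (auto simp: fibred_chart_def)
  qed (use W in auto)
  from fun_cong[OF frechet_derivative_at[OF this], of a]
  have d: "frechet_derivative (\<Phi> \<circ> \<sigma> \<circ> inv_into U x) (at (x m)) a = (a, frechet_derivative ?S (at (x m)) a)" by simp
  have "\<sigma> m \<in> P" using W m by auto
  from tangent_map_coord_vec[OF base_smooth ch total_smooth fibred m this W(3,1), of a] show ?thesis unfolding d .
qed

lemma smooth_at_fibre_component:
  assumes "e \<in> P" shows "smooth_at TA e (\<lambda>e. y e \<bullet> b)"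
    and "coord_vec TA P \<Phi> w e (\<lambda>e. y e \<bullet> b) = snd w \<bullet> b"
proof -
  have eq: "(\<lambda>e. \<Phi> e \<bullet> (0, b)) = (\<lambda>e. y e \<bullet> b)" by (simp add: fibred_chart_def fun_eq_iff)
  show "smooth_at TA e (\<lambda>e. y e \<bullet> b)"
    using coord_vec_component(1)[OF total_smooth fibred assms, of "(0, b)"] unfolding eq .
  show "coord_vec TA P \<Phi> w e (\<lambda>e. y e \<bullet> b) = snd w \<bullet> b"
    using coord_vec_component(2)[OF total_smooth fibred assms, of w "(0, b)"] unfolding eq by (simp add: inner_Pair_0)
qed

lemma base_component:
  assumes "e \<in> P" shows "coord_vec TA P \<Phi> w e (\<lambda>e. x (proj B e) $ l) = fst w $ l"
proof -
  have eq: "(\<lambda>e. \<Phi> e \<bullet> (axis l 1, 0)) = (\<lambda>e. x (proj B e) $ l)"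
    by (simp add: fibred_chart_def fun_eq_iff inner_axis)
  show ?thesis
    using coord_vec_component(2)[OF total_smooth fibred assms, of w "(axis l 1, 0)"] unfolding eq
    by (simp add: inner_Pair_0 inner_axis)
qed

text \<open>Stated for an arbitrary map \<open>\<tau>\<close>, because sums, multiples and tensor products of sections are
  differentiated through their coordinate expression \<open>F\<close> only.\<close>

lemma tangent_map_fibre_component:
  assumes m: "m \<in> U" and F: "smooth_on S F" "x m \<in> S" "S \<subseteq> x ` U"
    and eq: "\<And>q. q \<in> U \<Longrightarrow> x q \<in> S \<Longrightarrow> y (\<tau> q) = F (x q)" and \<tau>: "\<tau> m \<in> P"
  shows "tangent_map TA \<tau> m (coord_vec (base B) U x a m) (\<lambda>e. y e \<bullet> b) =
    frechet_derivative F (at (x m)) a \<bullet> b"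
proof -
  have sm: "smooth_on S (\<lambda>s. F s \<bullet> b)"
    by (rule smooth_on_linear_compose[OF bounded_linear_inner_left F(1)])
  have "((\<lambda>s. F s \<bullet> b) has_derivative (\<lambda>a. frechet_derivative F (at (x m)) a \<bullet> b)) (at (x m))"
    by (rule bounded_linear.has_derivative[OF bounded_linear_inner_left smooth_on_has_derivative[OF F(1,2)]])
  from fun_cong[OF frechet_derivative_at[OF this], of a]
  have d: "frechet_derivative (\<lambda>s. F s \<bullet> b) (at (x m)) a = frechet_derivative F (at (x m)) a \<bullet> b" by simp
  have "coord_vec (base B) U x a m ((\<lambda>e. y e \<bullet> b) \<circ> \<tau>) = frechet_derivative (\<lambda>s. F s \<bullet> b) (at (x m)) a"
    by (rule coord_vec_eq_near(2)[OF base_smooth ch m sm F(2,3)]) (use eq in simp)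
  then show ?thesis unfolding d tangent_map_def using smooth_at_fibre_component(1)[OF \<tau>] by simp
qed

end

text \<open>The fibre components of the horizontal lift to \<open>e\<close> of the base vector with components \<open>a\<close>: the
  derivative of a section that represents the jet \<open>K e\<close>.\<close>

definition horizontal :: "('m, 'e, 'n::finite, 'k::finite) vbundle \<Rightarrow> ('e \<Rightarrow> ('m, 'e) jet) \<Rightarrow> 'm set \<Rightarrow>
    ('m \<Rightarrow> real^'n) \<Rightarrow> ('e \<Rightarrow> real^'k) \<Rightarrow> 'e \<Rightarrow> real^'n \<Rightarrow> real^'k" where
  "horizontal B K U x y e a = frechet_derivative (y \<circ> rep (K e) \<circ> inv_into U x) (at (x (proj B e))) a"

lemma jetE:
  assumes "\<theta> \<in> J1 B"
  shows "local_section B (proj B (fst \<theta>)) (rep \<theta>)" "rep \<theta> (proj B (fst \<theta>)) = fst \<theta>"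
    and "rep \<theta> \<in> snd \<theta>"
proof -
  obtain m \<Psi> where \<theta>: "\<theta> = j1 B m \<Psi>" "local_section B m \<Psi>" using assms unfolding J1_def by blast
  have p: "proj B (\<Psi> m) = m" using \<theta>(2) unfolding local_section_def by auto
  have "\<Psi> \<in> snd \<theta>" using \<theta>(2) unfolding \<theta>(1) j1_def by simp
  then show r: "rep \<theta> \<in> snd \<theta>" unfolding rep_def by (rule someI[of "\<lambda>\<Psi>. \<Psi> \<in> snd \<theta>"])
  show "local_section B (proj B (fst \<theta>)) (rep \<theta>)" "rep \<theta> (proj B (fst \<theta>)) = fst \<theta>"
    using r[unfolded \<theta>(1) j1_def] p unfolding \<theta>(1) by (auto simp: j1_def)
qed

locale connection_coords = bundle_coords B U x y
  for B :: "('m, 'e, 'n::finite, 'k::finite) vbundle" and U x y +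
  fixes K :: "'e \<Rightarrow> ('m, 'e) jet"
  assumes conn: "linear_connection B K"
begin

abbreviation "H \<equiv> horizontal B K U x y"
abbreviation "G s a v \<equiv> H (pt s v) a"

lemma K_jet: "e \<in> total B \<Longrightarrow> K e \<in> J1 B" "e \<in> total B \<Longrightarrow> fst (K e) = e"
  using conn unfolding linear_connection_def by auto

lemma rep_section:
  assumes "e \<in> total B"
  shows "local_section B (proj B e) (rep (K e))" "rep (K e) (proj B e) = e"
  using jetE(1,2)[OF K_jet(1)[OF assms]] unfolding K_jet(2)[OF assms] .

lemma connection_form_coords:
  assumes e: "e \<in> P"
  shows "connection_form B K e (coord_vec TA P \<Phi> w e) = coord_vec TA P \<Phi> (fst w, H e (fst w)) e"
proof -
  have m: "proj B e \<in> U" using e by simp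
  show ?thesis
    unfolding connection_form_def tangent_map_proj[OF e] tangent_map_section[OF rep_section(1)[OF P_total[OF e]] m]
      rep_section(2)[OF P_total[OF e]] horizontal_def ..
qed

lemma section_smooth:
  assumes e: "e \<in> P"
  obtains W where "proj B e \<in> W" "W \<subseteq> U" "smooth_on (x ` W) (y \<circ> rep (K e) \<circ> inv_into U x)"
    "\<forall>q\<in>W. proj B (rep (K e) q) = q"
proof -
  have m: "proj B e \<in> U" using e by simp
  obtain W where W: "proj B e \<in> W" "W \<subseteq> U" "smooth_map (base B) TA W (rep (K e))"
    "smooth_on (x ` W) (y \<circ> rep (K e) \<circ> inv_into U x)" "\<forall>q\<in>W. proj B (rep (K e) q) = q"
    using section_in_coords[OF rep_section(1)[OF P_total[OF e]] m] .
  show thesis by (rule that[OF W(1,2,4,5)])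
qed

lemma horizontal_linear: 
  assumes e: "e \<in> P" shows "linear (H e)"
proof -
  obtain W where W: "proj B e \<in> W" "W \<subseteq> U" "smooth_on (x ` W) (y \<circ> rep (K e) \<circ> inv_into U x)"
    "\<forall>q\<in>W. proj B (rep (K e) q) = q" using section_smooth[OF e] .
  have "linear (frechet_derivative (y \<circ> rep (K e) \<circ> inv_into U x) (at (x (proj B e))))"
    by (rule linear_frechet_derivative[OF smooth_on_differentiable[OF W(3)]]) (use W(1) in simp)
  then show ?thesis unfolding horizontal_def by (simp add: eta_contract_eq)
qed

text \<open>A jet determines the tangent map at its base point, so any map that defines the same jet may be
  differentiated in place of the chosen representative.\<close>

lemma horizontal_eqI:
  assumes e: "e \<in> P" and K: "K e = j1 B (proj B e) \<tau>"
    and F: "smooth_on S F" "x (proj B e) \<in> S" "S \<subseteq> x ` U"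
    and eq: "\<And>q. q \<in> U \<Longrightarrow> x q \<in> S \<Longrightarrow> y (\<tau> q) = F (x q)"
  shows "H e a = frechet_derivative F (at (x (proj B e))) a"
proof (rule euclidean_eqI)
  fix b :: "real^'k"
  let ?m = "proj B e" and ?v = "coord_vec (base B) U x a (proj B e)"
  have m: "?m \<in> U" using e by simp
  have \<tau>: "\<tau> ?m = e" using K_jet(2)[OF P_total[OF e]] unfolding K j1_def by simp
  have v: "?v \<in> tangent_space (base B) ?m" unfolding tangent_space_eq_coord_vec[OF base_smooth ch m] by simp
  have "tangent_map TA (rep (K e)) ?m ?v = tangent_map TA \<tau> ?m ?v"
    using jetE(3)[OF K_jet(1)[OF P_total[OF e]]] v unfolding K j1_def by simp
  moreover have "tangent_map TA (rep (K e)) ?m ?v (\<lambda>e. y e \<bullet> b) = H e a \<bullet> b"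
    unfolding tangent_map_section[OF rep_section(1)[OF P_total[OF e]] m] rep_section(2)[OF P_total[OF e]]
      smooth_at_fibre_component(2)[OF e] horizontal_def by simp
  moreover have "tangent_map TA \<tau> ?m ?v (\<lambda>e. y e \<bullet> b) = frechet_derivative F (at (x ?m)) a \<bullet> b"
    by (rule tangent_map_fibre_component[OF m F eq]) (use \<tau> e in auto)
  ultimately show "H e a \<bullet> b = frechet_derivative F (at (x (proj B e))) a \<bullet> b" by simp
qed

lemma horizontal_vadd:
  assumes e: "e \<in> P" "e' \<in> P" "proj B e = proj B e'"
  shows "H (vadd B e e') a = H e a + H e' a"
proof -
  have m: "proj B e \<in> U" using e by simp
  have f: "e \<in> fibre B (proj B e)" "e' \<in> fibre B (proj B e)" using e by (auto simp: fibre_def)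
  have p: "proj B (vadd B e e') = proj B e"
    using vector_bundleD(2)[OF vb U_carrier[OF m] f] by (simp add: fibre_def)
  obtain W where W: "proj B e \<in> W" "W \<subseteq> U" "smooth_on (x ` W) (y \<circ> rep (K e) \<circ> inv_into U x)"
    "\<forall>q\<in>W. proj B (rep (K e) q) = q" using section_smooth[OF e(1)] .
  obtain W' where W': "proj B e' \<in> W'" "W' \<subseteq> U" "smooth_on (x ` W') (y \<circ> rep (K e') \<circ> inv_into U x)"
    "\<forall>q\<in>W'. proj B (rep (K e') q) = q" using section_smooth[OF e(2)] .
  let ?S = "x ` W \<inter> x ` W'"
  have o: "open ?S" using smooth_on_open[OF W(3)] smooth_on_open[OF W'(3)] by auto
  have s: "smooth_on ?S (y \<circ> rep (K e) \<circ> inv_into U x)" "smooth_on ?S (y \<circ> rep (K e') \<circ> inv_into U x)"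
    by (rule smooth_on_subset[OF W(3) o], simp, rule smooth_on_subset[OF W'(3) o], simp)
  have xS: "x (proj B e) \<in> ?S" using W(1) W'(1) e(3) by auto
  have K: "K (vadd B e e') = j1 B (proj B e) (\<lambda>q. vadd B (rep (K e) q) (rep (K e') q))"
    using conn P_total[OF e(1)] P_total[OF e(2)] e(3) K_jet(2)[OF P_total[OF e(1)]]
    unfolding linear_connection_def jet_add_def by auto
  have "H (vadd B e e') a =
      frechet_derivative (\<lambda>s. (y \<circ> rep (K e) \<circ> inv_into U x) s + (y \<circ> rep (K e') \<circ> inv_into U x) s)
        (at (x (proj B (vadd B e e')))) a"
  proof (rule horizontal_eqI)
    show "vadd B e e' \<in> P" using p m by simp
    show "K (vadd B e e') = j1 B (proj B (vadd B e e')) (\<lambda>q. vadd B (rep (K e) q) (rep (K e') q))"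
      unfolding p by (rule K)
    show "smooth_on ?S (\<lambda>s. (y \<circ> rep (K e) \<circ> inv_into U x) s + (y \<circ> rep (K e') \<circ> inv_into U x) s)"
      by (rule smooth_on_add[OF s])
    show "x (proj B (vadd B e e')) \<in> ?S" unfolding p by (rule xS)
    show "?S \<subseteq> x ` U" using W(2) by auto
    fix q assume q: "q \<in> U" "x q \<in> ?S"
    then have qW: "q \<in> W" "q \<in> W'" using W(2) W'(2) local_chartD(1)[OF ch] by (auto simp: inj_on_def subset_iff)
    have "rep (K e) q \<in> fibre B q" "rep (K e') q \<in> fibre B q" using W(4) W'(4) qW by (auto simp: fibre_def)
    then show "y (vadd B (rep (K e) q) (rep (K e') q)) =
        (y \<circ> rep (K e) \<circ> inv_into U x) (x q) + (y \<circ> rep (K e') \<circ> inv_into U x) (x q)"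
      using fibrewise_linearD(1)[OF yD(2) q(1)] local_chartD(6)[OF ch q(1)] by simp
  qed
  also have "\<dots> = H e a + H e' a"
    unfolding p horizontal_def
    using fun_cong[OF frechet_derivative_at[OF has_derivative_add[OF smooth_on_has_derivative[OF s(1) xS] smooth_on_has_derivative[OF s(2) xS]]], of a] e(3)
    by simp
  finally show ?thesis .
qed

lemma horizontal_vscale:
  assumes e: "e \<in> P"
  shows "H (vscale B r e) a = r *\<^sub>R H e a"
proof -
  have m: "proj B e \<in> U" using e by simp
  have f: "e \<in> fibre B (proj B e)" by (auto simp: fibre_def)
  have p: "proj B (vscale B r e) = proj B e"
    using vector_bundleD(3)[OF vb U_carrier[OF m] f] by (simp add: fibre_def)
  obtain W where W: "proj B e \<in> W" "W \<subseteq> U" "smooth_on (x ` W) (y \<circ> rep (K e) \<circ> inv_into U x)"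
    "\<forall>q\<in>W. proj B (rep (K e) q) = q" using section_smooth[OF e(1)] .
  have xS: "x (proj B e) \<in> x ` W" using W(1) by auto
  have K: "K (vscale B r e) = j1 B (proj B e) (\<lambda>q. vscale B r (rep (K e) q))"
    using conn P_total[OF e] K_jet(2)[OF P_total[OF e]] unfolding linear_connection_def jet_scale_def by auto
  have "H (vscale B r e) a =
      frechet_derivative (\<lambda>s. r *\<^sub>R (y \<circ> rep (K e) \<circ> inv_into U x) s) (at (x (proj B (vscale B r e)))) a"
  proof (rule horizontal_eqI)
    show "vscale B r e \<in> P" using p m by simp
    show "K (vscale B r e) = j1 B (proj B (vscale B r e)) (\<lambda>q. vscale B r (rep (K e) q))"
      unfolding p by (rule K)
    show "smooth_on (x ` W) (\<lambda>s. r *\<^sub>R (y \<circ> rep (K e) \<circ> inv_into U x) s)"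
      by (rule smooth_on_linear_compose[OF bounded_linear_scaleR_right W(3)])
    show "x (proj B (vscale B r e)) \<in> x ` W" unfolding p by (rule xS)
    show "x ` W \<subseteq> x ` U" using W(2) by auto
    fix q assume q: "q \<in> U" "x q \<in> x ` W"
    then have qW: "q \<in> W" using W(2) local_chartD(1)[OF ch] by (auto simp: inj_on_def subset_iff)
    have "rep (K e) q \<in> fibre B q" using W(4) qW by (auto simp: fibre_def)
    then show "y (vscale B r (rep (K e) q)) = r *\<^sub>R (y \<circ> rep (K e) \<circ> inv_into U x) (x q)"
      using fibrewise_linearD(2)[OF yD(2) q(1)] local_chartD(6)[OF ch q(1)] by simp
  qed
  also have "\<dots> = r *\<^sub>R H e a"
    unfolding p horizontal_def
    using fun_cong[OF frechet_derivative_at[OF has_derivative_scaleR_right[OF smooth_on_has_derivative[OF W(3) xS]]], of r a]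
    by simp
  finally show ?thesis .
qed

text \<open>Linearity in \<open>v\<close> is the linearity of the connection; linearity in \<open>a\<close> is that of a derivative.\<close>

lemma G_linear:
  assumes s: "s \<in> x ` U"
  shows "linear (\<lambda>a. G s a v)" "linear (G s a)"
proof -
  show "linear (\<lambda>a. G s a v)" using horizontal_linear[OF pt_in[OF s]] by (simp add: eta_contract_eq)
  let ?m = "inv_into U x s"
  have m: "?m \<in> U" using s by (rule inv_into_into)
  note l = fibre_inv_linear[OF vb U_carrier[OF m] m yD(2) yD(3)[OF m], folded pt_def]
  show "linear (G s a)"
    by (rule linearI)
       (simp_all only: l horizontal_vadd[OF pt_in[OF s] pt_in[OF s]] horizontal_vscale[OF pt_in[OF s]] proj_pt[OF s])
qed

end

text \<open>In the charts of the atlas the horizontal coefficients are among the jet coordinates, in which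
  the connection is smooth by definition.\<close>

lemma horizontal_smooth_triv:
  fixes B :: "('m, 'e, 'n::finite, 'k::finite) vbundle"
  assumes vb: "vector_bundle B" and conn: "linear_connection B K" and c: "(U, x) \<in> base B" "(V, y) \<in> triv B"
  shows "smooth_on (fibred_chart B x y ` (proj B -` (U \<inter> V)))
     (\<lambda>q. horizontal B K (U \<inter> V) x y (inv_into (proj B -` (U \<inter> V)) (fibred_chart B x y) q) (axis l 1))"
proof -
  interpret N: connection_coords B "U \<inter> V" x y K
    by unfold_locales (use vb conn linear_fibre_coords_triv[OF vb c] in auto)
  let ?P = "proj B -` (U \<inter> V)" and ?\<Phi> = "fibred_chart B x y"
  let ?J = "{\<theta> \<in> J1 B. proj B (fst \<theta>) \<in> U \<inter> V}"
  have 1: "(?P, ?\<Phi>) \<in> total_atlas B" using c unfolding total_atlas_def by blast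
  have 2: "(?J, jet_coords B U x y) \<in> jet_atlas B" using c unfolding jet_atlas_def by blast
  have K: "smooth_map (total_atlas B) (jet_atlas B) (total B) K" using conn unfolding linear_connection_def by (elim conjE)
  have dom: "?P \<inter> total B \<inter> K -` ?J = ?P"
    using N.P_total N.K_jet by auto
  have sm: "smooth_on (?\<Phi> ` ?P) (jet_coords B U x y \<circ> K \<circ> inv_into ?P ?\<Phi>)"
    using smooth_mapD(3)[OF K 1 2] unfolding dom .
  have bl: "bounded_linear (\<lambda>t :: (real^'n) \<times> (real^'k) \<times> ((real^'k)^'n). snd (snd t) $ l)"
    by (intro bounded_linear_compose[OF bounded_linear_vec_nth] bounded_linear_compose[OF bounded_linear_snd] bounded_linear_snd)
  show ?thesis
  proof (rule smooth_on_cong[OF smooth_on_linear_compose[OF bl sm]])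
    fix q assume "q \<in> ?\<Phi> ` ?P"
    then obtain e where e: "e \<in> ?P" "inv_into ?P ?\<Phi> q = e" using local_chartD(6)[OF N.fibred] by auto
    obtain W where W: "proj B e \<in> W" "W \<subseteq> U \<inter> V" "smooth_on (x ` W) (y \<circ> rep (K e) \<circ> inv_into (U \<inter> V) x)"
      "\<forall>q\<in>W. proj B (rep (K e) q) = q" using N.section_smooth[OF e(1)] .
    have "frechet_derivative (y \<circ> rep (K e) \<circ> inv_into U x) (at (x (proj B e))) =
      frechet_derivative (y \<circ> rep (K e) \<circ> inv_into (U \<inter> V) x) (at (x (proj B e)))"
    proof (rule frechet_derivative_cong_near[OF W(3)])
      fix s assume "s \<in> x ` W"
      then obtain m where m: "m \<in> W" "s = x m" by auto
      have "inv_into U x (x m) = m" "inv_into (U \<inter> V) x (x m) = m"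
        using m W(2) local_chartD(6)[OF N.ch] local_chartD(6)[OF local_chart_atlas[OF N.base_smooth c(1)]] by auto
      then show "(y \<circ> rep (K e) \<circ> inv_into (U \<inter> V) x) s = (y \<circ> rep (K e) \<circ> inv_into U x) s" by (simp add: m)
    qed (use W in simp)
    then show "snd (snd ((jet_coords B U x y \<circ> K \<circ> inv_into ?P ?\<Phi>) q)) $ l =
        horizontal B K (U \<inter> V) x y (inv_into ?P ?\<Phi> q) (axis l 1)"
      unfolding comp_apply e(2) by (simp add: jet_coords_def horizontal_def N.K_jet(2)[OF N.P_total[OF e(1)]] o_def)
  qed
qed

lemma app_form_apply: "(Q \<cdot> X) p = Q p (X p)"
  by (simp add: app_form_def)

text \<open>Smoothness is local, so the charts of the atlas suffice. The conclusion, in contrast to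
  smoothness of the coefficients, does not mention coordinates.\<close>

lemma vector_field_connection_form:
  fixes B :: "('m, 'e, 'n::finite, 'k::finite) vbundle"
  assumes vb: "vector_bundle B" and conn: "linear_connection B K" and X: "vector_field (total_atlas B) W X"
  shows "vector_field (total_atlas B) W (connection_form B K \<cdot> X)"
proof (rule vector_field_local)
  note A = smooth_atlas_total[OF vb]
  show "smooth_atlas (total_atlas B)" by (rule A)
  fix e assume e: "e \<in> W"
  have mW: "mopen (total_atlas B) W" using X by (simp add: vector_field_def)
  have m: "proj B e \<in> carrier (base B)" using mopenD(2)[OF mW] e carrier_total_atlas[OF vb] by (auto simp: total_def)
  obtain U x where c1: "(U, x) \<in> base B" "proj B e \<in> U" using m by (rule carrierE)
  obtain V y where c2: "(V, y) \<in> triv B" "proj B e \<in> V" using vector_bundleD(8)[OF vb m] by auto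
  interpret N: connection_coords B "U \<inter> V" x y K
    by unfold_locales (use vb conn linear_fibre_coords_triv[OF vb c1(1) c2(1)] in auto)
  let ?P = "proj B -` (U \<inter> V)" and ?\<Phi> = "fibred_chart B x y"
  let ?R = "W \<inter> ?P"
  have mR: "mopen (total_atlas B) ?R" by (rule mopen_Int[OF A mW local_chartD(4)[OF N.fibred]])
  have "vector_field (total_atlas B) ?R X" using X mR unfolding vector_field_def by simp
  then obtain F where F: "smooth_on (?\<Phi> ` ?R) F" "\<And>p. p \<in> ?R \<Longrightarrow> X p = coord_vec (total_atlas B) ?P ?\<Phi> (F (?\<Phi> p)) p"
    by (rule vector_field_in_chart[OF A N.fibred]) auto
  let ?h = "\<lambda>q. horizontal B K (U \<inter> V) x y (inv_into ?P ?\<Phi> q)"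
  have F1: "smooth_on (?\<Phi> ` ?R) (\<lambda>q. fst (F q))" by (rule smooth_on_linear_compose[OF bounded_linear_fst F(1)])
  note o = smooth_on_open[OF F(1)]
  have "smooth_on (?\<Phi> ` ?R) (\<lambda>q. \<Sum>l\<in>UNIV. (fst (F q) $ l) *\<^sub>R ?h q (axis l 1))"
    by (intro smooth_on_sum smooth_on_scaleR o smooth_on_linear_compose[OF bounded_linear_vec_nth F1]
        smooth_on_subset[OF horizontal_smooth_triv[OF vb conn c1(1) c2(1)] o]) auto
  then have "smooth_on (?\<Phi> ` ?R) (\<lambda>q. ?h q (fst (F q)))"
  proof (rule smooth_on_cong)
    fix q assume "q \<in> ?\<Phi> ` ?R"
    then obtain p where p: "p \<in> ?R" "inv_into ?P ?\<Phi> q = p" using local_chartD(6)[OF N.fibred] by auto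
    have lin: "linear (?h q)" unfolding p(2) by (rule N.horizontal_linear) (use p in auto)
    show "(\<Sum>l\<in>UNIV. (fst (F q) $ l) *\<^sub>R ?h q (axis l 1)) = ?h q (fst (F q))"
      by (rule linear_eq_sum_axis[OF lin, symmetric])
  qed
  then have sm: "smooth_on (?\<Phi> ` ?R) (\<lambda>q. (fst (F q), ?h q (fst (F q))))" by (rule smooth_on_Pair[OF F1])
  have "vector_field (total_atlas B) ?R (connection_form B K \<cdot> X)"
  proof (rule vector_fieldI[OF A N.fibred _ sm])
    fix p assume p: "p \<in> ?R"
    then have pP: "p \<in> ?P" by auto
    have i: "inv_into ?P ?\<Phi> (?\<Phi> p) = p" by (rule local_chartD(6)[OF N.fibred pP])
    show "(connection_form B K \<cdot> X) p =
      coord_vec (total_atlas B) ?P ?\<Phi> (fst (F (?\<Phi> p)), ?h (?\<Phi> p) (fst (F (?\<Phi> p)))) p"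
      unfolding app_form_apply F(2)[OF p] i by (rule N.connection_form_coords[OF pP])
  qed auto
  then show "\<exists>V. e \<in> V \<and> V \<subseteq> W \<and> vector_field (total_atlas B) V (connection_form B K \<cdot> X)"
    by (intro exI[of _ ?R]) (use e c1 c2 in auto)
qed

section \<open>Curvature in coordinates\<close>

lemma fn_bracket_apply:
  "fn_bracket A Q Q X Y p = lie_bracket A (Q \<cdot> X) (Q \<cdot> Y) p - lie_bracket A (Q \<cdot> Y) (Q \<cdot> X) p
     - Q p (lie_bracket A (Q \<cdot> X) Y p - lie_bracket A (Q \<cdot> Y) X p)
     - Q p (lie_bracket A (Q \<cdot> X) Y p - lie_bracket A (Q \<cdot> Y) X p)
     + (Q p (Q p (lie_bracket A X Y p)) + Q p (Q p (lie_bracket A X Y p)))"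
  by (simp add: fn_bracket_def app_form_apply)

context connection_coords
begin

lemma vector_field_base_vec: "vector_field TA P (base_vec B U x y l)"
  by (rule vector_fieldI[OF total_smooth fibred subset_refl smooth_on_const[OF local_chartD(5)[OF fibred]]])
     (simp add: base_vec_def)

text \<open>Only charts of the atlas see the smoothness of jets directly, but the coefficients in arbitrary
  linear coordinates are the components of the images of the coordinate vector fields under the
  connection form.\<close>

lemma G_smooth: "smooth_on (x ` U) (\<lambda>s. G s a v)"
proof -
  have ax: "smooth_on (x ` U) (\<lambda>s. G s (axis l 1) v)" for l
  proof -
    obtain F where F: "smooth_on (\<Phi> ` P) F"
      "\<And>p. p \<in> P \<Longrightarrow> (connection_form B K \<cdot> base_vec B U x y l) p = coord_vec TA P \<Phi> (F (\<Phi> p)) p"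
      by (rule vector_field_in_chart[OF total_smooth fibred vector_field_connection_form[OF vb conn vector_field_base_vec[of l]]]) auto
    have o: "open (x ` U)" by (rule local_chartD(5)[OF ch])
    have "smooth_on (x ` U) (F \<circ> (\<lambda>s. (s, v)))"
      by (rule smooth_on_compose[OF smooth_on_Pair[OF smooth_on_linear[OF bounded_linear_ident o] smooth_on_const[OF o]] F(1)])
         (auto simp: image_fibred)
    from smooth_on_linear_compose[OF bounded_linear_snd this]
    show ?thesis
    proof (rule smooth_on_cong)
      fix s assume s: "s \<in> x ` U"
      have \<Phi>: "\<Phi> (pt s v) = (s, v)" by (simp add: fibred_chart_def x_pt[OF s] y_pt[OF s])
      have "coord_vec TA P \<Phi> (F (s, v)) (pt s v) = coord_vec TA P \<Phi> (axis l 1, G s (axis l 1) v) (pt s v)"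
        using F(2)[OF pt_in[OF s], of v] connection_form_coords[OF pt_in[OF s], of v "(axis l 1, 0)"]
        unfolding \<Phi> app_form_apply base_vec_def by simp
      then show "snd ((F \<circ> (\<lambda>s. (s, v))) s) = G s (axis l 1) v"
        using coord_vec_inject[OF total_smooth fibred pt_in[OF s]] by fastforce
    qed
  qed
  have "smooth_on (x ` U) (\<lambda>s. \<Sum>l\<in>UNIV. (a $ l) *\<^sub>R G s (axis l 1) v)"
    by (intro smooth_on_sum smooth_on_scaleR smooth_on_const ax local_chartD(5)[OF ch])
  then show ?thesis
  proof (rule smooth_on_cong)
    fix s assume s: "s \<in> x ` U"
    show "(\<Sum>l\<in>UNIV. (a $ l) *\<^sub>R G s (axis l 1) v) = G s a v"
      by (rule linear_eq_sum_axis[OF G_linear(1)[OF s], symmetric])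
  qed
qed

text \<open>Half the fibre components of the curvature. Its matrix entries are the classical expression
  \<open>\<partial>\<^sub>\<mu> K\<^sub>\<lambda> - \<partial>\<^sub>\<lambda> K\<^sub>\<mu>\<close> plus a commutator; the factor \<open>2\<close> is absorbed when a 2-form is summed over all
  pairs of indices.\<close>

definition \<Omega> :: "real^'n \<Rightarrow> real^'n \<Rightarrow> real^'n \<Rightarrow> real^'k \<Rightarrow> real^'k" where
  "\<Omega> s a b v = frechet_derivative (\<lambda>s. G s a v) (at s) b - frechet_derivative (\<lambda>s. G s b v) (at s) a
     + G s a (G s b v) - G s b (G s a v)"

text \<open>With \<open>F\<close> and \<open>H'\<close> the components of \<open>X\<close> and \<open>Y\<close>, those of the projected fields are \<open>(\<alpha>, G s \<alpha> v)\<close>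
  and \<open>(\<beta>, G s \<beta> v)\<close> with \<open>\<alpha> = fst F\<close> and \<open>\<beta> = fst H'\<close>. The base components of the bracket cancel. The
  fibre components are twice those of \<open>[PY, PX]\<close> minus \<open>G\<close> applied to its base component, and this
  correction removes exactly the terms with derivatives of \<open>\<alpha>\<close> and \<open>\<beta>\<close>.\<close>

lemma curvature_in_coords:
  assumes W: "W \<subseteq> P" and X: "vector_field TA W X" and Y: "vector_field TA W Y" and e: "e \<in> W"
  shows "curvature B K X Y e = coord_vec TA P \<Phi>
     (0, 2 *\<^sub>R \<Omega> (x (proj B e)) (\<chi> l. d_base B x l (X e)) (\<chi> l. d_base B x l (Y e)) (y e)) e"
proof -
  have eP: "e \<in> P" using W e by auto
  have im: "\<Phi> ` W \<subseteq> x ` U \<times> UNIV" using W unfolding image_fibred[symmetric] by auto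
  obtain F where F: "smooth_on (\<Phi> ` W) F" "\<And>p. p \<in> W \<Longrightarrow> X p = coord_vec TA P \<Phi> (F (\<Phi> p)) p"
    by (rule vector_field_in_chart[OF total_smooth fibred X W]) auto
  obtain H' where H: "smooth_on (\<Phi> ` W) H'" "\<And>p. p \<in> W \<Longrightarrow> Y p = coord_vec TA P \<Phi> (H' (\<Phi> p)) p"
    by (rule vector_field_in_chart[OF total_smooth fibred Y W]) auto
  let ?hor = "\<lambda>F q. (fst (F q), G (fst q) (fst (F q)) (snd q))"
  let ?\<kappa> = "connection_form B K"
  define q where "q = \<Phi> e"
  define s where "s = x (proj B e)"
  define v where "v = y e"
  have qe: "q = (s, v)" by (simp add: q_def s_def v_def fibred_chart_def)
  have qW: "q \<in> \<Phi> ` W" using e by (simp add: q_def)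
  have s: "s \<in> x ` U" using eP by (auto simp: s_def)
  have pe: "pt s v = e" unfolding s_def v_def by (rule pt_proj[OF eP])
  have fst_smooth: "smooth_on (\<Phi> ` W) (\<lambda>q. fst (F q))" if "smooth_on (\<Phi> ` W) F" for F :: "(real^'n) \<times> (real^'k) \<Rightarrow> (real^'n) \<times> (real^'k)"
    by (rule smooth_on_linear_compose[OF bounded_linear_fst that])
  have hor_smooth: "smooth_on (\<Phi> ` W) (?hor F)" if F: "smooth_on (\<Phi> ` W) F" for F :: "(real^'n) \<times> (real^'k) \<Rightarrow> (real^'n) \<times> (real^'k)"
    by (rule smooth_on_Pair[OF fst_smooth[OF F] bilinear_family_smooth[OF G_smooth G_linear fst_smooth[OF F] im]])
  have hor_deriv: "frechet_derivative (?hor F) (at q) w = (fst (frechet_derivative F (at q) w),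
      frechet_derivative (\<lambda>s. G s (fst (F q)) v) (at s) (fst w)
      + G s (fst (frechet_derivative F (at q) w)) v + G s (fst (F q)) (snd w))"
    if F: "smooth_on (\<Phi> ` W) F" for F :: "(real^'n) \<times> (real^'k) \<Rightarrow> (real^'n) \<times> (real^'k)" and w
  proof -
    have d1: "((\<lambda>q. fst (F q)) has_derivative (\<lambda>w. fst (frechet_derivative F (at q) w))) (at q)"
      by (rule bounded_linear.has_derivative[OF bounded_linear_fst smooth_on_has_derivative[OF F qW]])
    have e1: "frechet_derivative (\<lambda>q. fst (F q)) (at q) = (\<lambda>w. fst (frechet_derivative F (at q) w))"
      by (rule frechet_derivative_at[OF d1, symmetric])
    have d2: "((\<lambda>q. G (fst q) (fst (F q)) (snd q)) has_derivative (\<lambda>w.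
      frechet_derivative (\<lambda>s. G s (fst (F q)) (snd q)) (at (fst q)) (fst w)
      + G (fst q) (frechet_derivative (\<lambda>q. fst (F q)) (at q) w) (snd q) + G (fst q) (fst (F q)) (snd w))) (at q)"
      by (rule bilinear_family_derivative[OF G_smooth G_linear fst_smooth[OF F] im qW])
    show ?thesis
      using fun_cong[OF frechet_derivative_at[OF has_derivative_Pair[OF d1 d2]], of w] unfolding e1 by (simp add: qe)
  qed
  have hor_field: "(?\<kappa> \<cdot> X) p = coord_vec TA P \<Phi> (?hor F (\<Phi> p)) p"
    if X: "\<And>p. p \<in> W \<Longrightarrow> X p = coord_vec TA P \<Phi> (F (\<Phi> p)) p" and p: "p \<in> W"
    for X and F :: "(real^'n) \<times> (real^'k) \<Rightarrow> (real^'n) \<times> (real^'k)" and p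
  proof -
    have pP: "p \<in> P" using p W by auto
    show ?thesis
      unfolding app_form_apply X[OF p] connection_form_coords[OF pP] by (simp add: fibred_chart_def pt_proj[OF pP])
  qed
  have KX: "smooth_on (\<Phi> ` W) (?hor F)" "\<And>p. p \<in> W \<Longrightarrow> (?\<kappa> \<cdot> X) p = coord_vec TA P \<Phi> (?hor F (\<Phi> p)) p"
    by (rule hor_smooth[OF F(1)], rule hor_field[OF F(2)])
  have KY: "smooth_on (\<Phi> ` W) (?hor H')" "\<And>p. p \<in> W \<Longrightarrow> (?\<kappa> \<cdot> Y) p = coord_vec TA P \<Phi> (?hor H' (\<Phi> p)) p"
    by (rule hor_smooth[OF H(1)], rule hor_field[OF H(2)])
  note lb = lie_bracket_in_chart[OF total_smooth fibred W e, folded q_def]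
  have \<kappa>: "?\<kappa> e (coord_vec TA P \<Phi> c e) = coord_vec TA P \<Phi> (fst c, G s (fst c) v) e" for c
    unfolding pe by (rule connection_form_coords[OF eP])
  note minus = coord_vec_linear(2)[OF total_smooth fibred eP, symmetric] and plus = coord_vec_linear(1)[OF total_smooth fibred eP, symmetric]
    and neg = coord_vec_linear(4)[OF total_smooth fibred eP, symmetric]
  define \<alpha> where "\<alpha> = fst (F q)"
  define \<beta> where "\<beta> = fst (H' q)"
  have \<alpha>: "(\<chi> l. d_base B x l (X e)) = \<alpha>" and \<beta>: "(\<chi> l. d_base B x l (Y e)) = \<beta>"
    by (simp_all add: d_base_def F(2)[OF e] H(2)[OF e] base_component[OF eP] \<alpha>_def \<beta>_def q_def vec_eq_iff)
  have Gd: "G s (a - b) v = G s a v - G s b v" "G s (a + b) v = G s a v + G s b v" for a b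
    using linear_diff[OF G_linear(1)[OF s]] linear_add[OF G_linear(1)[OF s]] by auto
  let ?D = "\<lambda>F w. frechet_derivative F (at q) w"
  \<comment> \<open>The components of \<open>[PX, PY]\<close>, \<open>[PY, PX]\<close>, \<open>[PX, Y] - [PY, X]\<close> and \<open>[X, Y]\<close>.\<close>
  define c1 where "c1 = ?D (?hor H') (?hor F q) - ?D (?hor F) (?hor H' q)"
  define c2 where "c2 = ?D (?hor F) (?hor H' q) - ?D (?hor H') (?hor F q)"
  define c3 where "c3 = ?D H' (?hor F q) - ?D (?hor F) (H' q) - (?D F (?hor H' q) - ?D (?hor H') (F q))"
  define c4 where "c4 = ?D H' (F q) - ?D F (H' q)"
  let ?\<pi> = "\<lambda>c. (fst c, G s (fst c) v)"
  have l1: "lie_bracket TA (?\<kappa> \<cdot> X) (?\<kappa> \<cdot> Y) e = coord_vec TA P \<Phi> c1 e"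
    unfolding c1_def by (rule lb[OF KX KY])
  have l2: "lie_bracket TA (?\<kappa> \<cdot> Y) (?\<kappa> \<cdot> X) e = coord_vec TA P \<Phi> c2 e"
    unfolding c2_def by (rule lb[OF KY KX])
  have l3: "lie_bracket TA (?\<kappa> \<cdot> X) Y e = coord_vec TA P \<Phi> (?D H' (?hor F q) - ?D (?hor F) (H' q)) e"
    by (rule lb[OF KX H])
  have l4: "lie_bracket TA (?\<kappa> \<cdot> Y) X e = coord_vec TA P \<Phi> (?D F (?hor H' q) - ?D (?hor H') (F q)) e"
    by (rule lb[OF KY F])
  have l5: "lie_bracket TA X Y e = coord_vec TA P \<Phi> c4 e"
    unfolding c4_def by (rule lb[OF F H])
  have "fn_bracket TA ?\<kappa> ?\<kappa> X Y e =
      coord_vec TA P \<Phi> (c1 - c2 - ?\<pi> c3 - ?\<pi> c3 + (?\<pi> (?\<pi> c4) + ?\<pi> (?\<pi> c4))) e"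
    unfolding fn_bracket_apply l1 l2 l3 l4 l5 minus c3_def[symmetric] \<kappa> plus
    unfolding minus plus ..
  then have "curvature B K X Y e =
      coord_vec TA P \<Phi> (- (c1 - c2 - ?\<pi> c3 - ?\<pi> c3 + (?\<pi> (?\<pi> c4) + ?\<pi> (?\<pi> c4)))) e"
    by (simp only: curvature_def uminus_apply neg)
  also have "- (c1 - c2 - ?\<pi> c3 - ?\<pi> c3 + (?\<pi> (?\<pi> c4) + ?\<pi> (?\<pi> c4))) = (0, 2 *\<^sub>R \<Omega> s \<alpha> \<beta> v)"
  proof (rule prod_eqI)
    have "fst (- (c1 - c2 - ?\<pi> c3 - ?\<pi> c3 + (?\<pi> (?\<pi> c4) + ?\<pi> (?\<pi> c4)))) = - (fst c1 - fst c2 - 2 *\<^sub>R fst c3 + 2 *\<^sub>R fst c4)"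
      by (simp add: scaleR_2)
    also have "\<dots> = 0"
      by (simp add: c1_def c2_def c3_def c4_def hor_deriv[OF F(1)] hor_deriv[OF H(1)] scaleR_2)
    finally show "fst (- (c1 - c2 - ?\<pi> c3 - ?\<pi> c3 + (?\<pi> (?\<pi> c4) + ?\<pi> (?\<pi> c4)))) = fst (0, 2 *\<^sub>R \<Omega> s \<alpha> \<beta> v)" by simp
    \<comment> \<open>The base component of \<open>[PX, Y] - [PY, X] - [X, Y]\<close> is that of \<open>[PX, PY]\<close>: only derivatives of
      the base components of \<open>X\<close> and \<open>Y\<close> along \<open>PX\<close> and \<open>PY\<close> survive.\<close>
    have g: "G s (fst c3) v - G s (fst c4) v = G s (fst (?D H' (?hor F q))) v - G s (fst (?D F (?hor H' q))) v"
      unfolding Gd(1)[symmetric] by (simp add: c3_def c4_def hor_deriv[OF F(1)] hor_deriv[OF H(1)])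
    have "snd (- (c1 - c2 - ?\<pi> c3 - ?\<pi> c3 + (?\<pi> (?\<pi> c4) + ?\<pi> (?\<pi> c4)))) =
        - (snd c1 - snd c2 - 2 *\<^sub>R (G s (fst c3) v - G s (fst c4) v))"
      by (simp add: scaleR_2 algebra_simps)
    also have "\<dots> = 2 *\<^sub>R \<Omega> s \<alpha> \<beta> v"
      unfolding g c1_def c2_def hor_deriv[OF F(1)] hor_deriv[OF H(1)]
      by (simp add: \<Omega>_def \<alpha>_def \<beta>_def qe scaleR_2 algebra_simps)
    finally show "snd (- (c1 - c2 - ?\<pi> c3 - ?\<pi> c3 + (?\<pi> (?\<pi> c4) + ?\<pi> (?\<pi> c4)))) = snd (0, 2 *\<^sub>R \<Omega> s \<alpha> \<beta> v)" by simp
  qed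
  finally show ?thesis unfolding \<alpha> \<beta> s_def[symmetric] v_def[symmetric] .
qed

end

context connection_coords
begin

text \<open>Differentiation in \<open>s\<close> preserves bilinearity in \<open>a\<close> and \<open>v\<close>.\<close>

lemma G_derivative_linear:
  assumes s: "s \<in> x ` U"
  shows "linear (\<lambda>a. frechet_derivative (\<lambda>s. G s a v) (at s) b)"
    and "linear (\<lambda>v. frechet_derivative (\<lambda>s. G s a v) (at s) b)"
    and "linear (frechet_derivative (\<lambda>s. G s a v) (at s))"
proof -
  have ex: "frechet_derivative (\<lambda>s. G s a v) (at s) b =
      (\<Sum>c\<in>Basis. \<Sum>d\<in>Basis. ((a \<bullet> c) * (v \<bullet> d)) *\<^sub>R frechet_derivative (\<lambda>s. G s c d) (at s) b)" for a v
    by (rule bilinear_family_derivative_expand[OF G_smooth G_linear s, symmetric])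
  have "linear (\<lambda>a. \<Sum>c\<in>Basis. \<Sum>d\<in>Basis. ((a \<bullet> c) * (v \<bullet> d)) *\<^sub>R frechet_derivative (\<lambda>s. G s c d) (at s) b)"
    by (rule linearI)
       (simp_all add: inner_add_left distrib_right scaleR_left_distrib sum.distrib scaleR_sum_right mult.assoc)
  then show "linear (\<lambda>a. frechet_derivative (\<lambda>s. G s a v) (at s) b)"
    by (simp only: ex[symmetric])
  have "linear (\<lambda>v. \<Sum>c\<in>Basis. \<Sum>d\<in>Basis. ((a \<bullet> c) * (v \<bullet> d)) *\<^sub>R frechet_derivative (\<lambda>s. G s c d) (at s) b)"
    by (rule linearI)
       (simp_all add: inner_add_left distrib_left scaleR_left_distrib sum.distrib scaleR_sum_right mult.left_commute)
  then show "linear (\<lambda>v. frechet_derivative (\<lambda>s. G s a v) (at s) b)"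
    by (simp only: ex[symmetric])
  show "linear (frechet_derivative (\<lambda>s. G s a v) (at s))"
    by (rule linear_frechet_derivative[OF smooth_on_differentiable[OF G_smooth s]])
qed

lemma \<Omega>_antisym: "\<Omega> s b a v = - \<Omega> s a b v"
  by (simp add: \<Omega>_def)

lemma \<Omega>_linear:
  assumes s: "s \<in> x ` U"
  shows "linear (\<lambda>a. \<Omega> s a b v)" "linear (\<Omega> s a b)" "linear (\<lambda>b. \<Omega> s a b v)"
proof -
  have G2: "linear (\<lambda>a. G s b (G s a v))" "linear (\<lambda>v. G s a (G s b v))" for a b v
    using linear_compose[OF G_linear(1)[OF s] G_linear(2)[OF s]] linear_compose[OF G_linear(2)[OF s] G_linear(2)[OF s]]
    by (simp_all add: o_def)
  have 1: "linear (\<lambda>a. \<Omega> s a b v)" for b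
    unfolding \<Omega>_def by (intro linear_compose_add linear_compose_sub G_derivative_linear[OF s] G_linear[OF s] G2)
  then show "linear (\<lambda>a. \<Omega> s a b v)" .
  have "(\<lambda>b. \<Omega> s a b v) = (\<lambda>b. - \<Omega> s b a v)" by (rule ext, rule \<Omega>_antisym)
  then show "linear (\<lambda>b. \<Omega> s a b v)" using linear_compose_neg[OF 1[of a]] by simp
  show "linear (\<Omega> s a b)"
    unfolding \<Omega>_def by (intro linear_compose_add linear_compose_sub G_derivative_linear[OF s] G2)
qed

lemma curv_coeff_eq:
  assumes m: "m \<in> U"
  shows "curv_coeff B K U x y j i l k m = \<Omega> (x m) (axis l 1) (axis k 1) (axis j 1) $ i"
proof -
  define e where "e = inv_into (fibre B m) y (axis j 1)"
  have p: "proj B e = m" "y e = axis j 1" unfolding e_def using fibre_inv[OF yD(3)[OF m]] by auto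
  have eP: "e \<in> P" using p m by simp
  have d: "(\<chi> l'. d_base B x l' (base_vec B U x y l e)) = axis l 1" for l
    unfolding d_base_def base_vec_def base_component[OF eP] by (simp add: vec_eq_iff)
  have "curvature B K (base_vec B U x y l) (base_vec B U x y k) e =
      coord_vec TA P \<Phi> (0, 2 *\<^sub>R \<Omega> (x m) (axis l 1) (axis k 1) (axis j 1)) e"
    using curvature_in_coords[OF subset_refl vector_field_base_vec[of l] vector_field_base_vec[of k] eP] unfolding d p .
  moreover have "coord_vec TA P \<Phi> c e (\<lambda>e. y e $ i) = snd c $ i" for c
    using smooth_at_fibre_component(2)[OF eP, of c "axis i 1"] by (simp add: inner_axis)
  ultimately show ?thesis
    unfolding curv_coeff_def e_def[symmetric] by simp
qed

text \<open>Expand \<open>\<Omega>\<close> in both base directions. The sum over all \<open>l\<close> and \<open>k\<close> of the antisymmetric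
  coefficients against \<open>dx\<^sup>l \<and> dx\<^sup>k\<close> counts every pair twice, which accounts for the factor \<open>2\<close>.\<close>

lemma curvature_eq_vertical_2form:
  assumes W: "W \<subseteq> P" and X: "vector_field TA W X" and Y: "vector_field TA W Y" and e: "e \<in> W"
    and C: "\<And>i l k. C i l k e = \<Omega> (x (proj B e)) (axis l 1) (axis k 1) (y e) $ i"
  shows "curvature B K X Y e = vertical_2form B U x y C X Y e"
proof
  fix f
  have eP: "e \<in> P" using W e by auto
  define s where "s = x (proj B e)"
  have s: "s \<in> x ` U" using eP by (auto simp: s_def)
  define \<alpha> where "\<alpha> = (\<chi> l. d_base B x l (X e))"
  define \<beta> where "\<beta> = (\<chi> l. d_base B x l (Y e))"
  have exp: "\<Omega> s a b (y e) $ i = (\<Sum>l\<in>UNIV. \<Sum>k\<in>UNIV. C i l k e * (a $ l * b $ k))" for a b i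
  proof -
    have "\<Omega> s a b (y e) = (\<Sum>l\<in>UNIV. (a $ l) *\<^sub>R (\<Sum>k\<in>UNIV. (b $ k) *\<^sub>R \<Omega> s (axis l 1) (axis k 1) (y e)))"
      by (simp only: linear_eq_sum_axis[OF \<Omega>_linear(1)[OF s], of a b "y e", symmetric]
          linear_eq_sum_axis[OF \<Omega>_linear(3)[OF s], of _ b "y e", symmetric])
    then show ?thesis by (simp add: C s_def[symmetric] sum_distrib_left mult_ac)
  qed
  have two: "(2 *\<^sub>R \<Omega> s \<alpha> \<beta> (y e)) $ i = (\<Sum>l\<in>UNIV. \<Sum>k\<in>UNIV. C i l k e * (\<alpha> $ l * \<beta> $ k - \<beta> $ l * \<alpha> $ k))" for i
  proof -
    have "2 *\<^sub>R \<Omega> s \<alpha> \<beta> (y e) = \<Omega> s \<alpha> \<beta> (y e) - \<Omega> s \<beta> \<alpha> (y e)"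
      unfolding \<Omega>_antisym[of s \<beta> \<alpha>] by (simp add: scaleR_2)
    then show ?thesis by (simp add: exp right_diff_distrib sum_subtractf)
  qed
  have dec: "(0, c) = (\<Sum>i\<in>UNIV. (c $ i) *\<^sub>R ((0, axis i 1) :: (real^'n) \<times> (real^'k)))" for c
    using linear_eq_sum_axis[of "\<lambda>c. ((0, c) :: (real^'n) \<times> (real^'k))" c] by (simp add: linear_iff)
  have "curvature B K X Y e f = coord_vec TA P \<Phi> (0, 2 *\<^sub>R \<Omega> s \<alpha> \<beta> (y e)) e f"
    unfolding curvature_in_coords[OF W X Y e] s_def \<alpha>_def \<beta>_def ..
  also have "\<dots> = (\<Sum>i\<in>UNIV. (2 *\<^sub>R \<Omega> s \<alpha> \<beta> (y e)) $ i * fibre_vec B U x y i e f)"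
    by (subst dec) (simp only: coord_vec_linear(3,5)[OF total_smooth fibred eP] fibre_vec_def)
  also have "\<dots> = vertical_2form B U x y C X Y e f"
    unfolding two by (simp add: vertical_2form_def \<alpha>_def \<beta>_def sum_distrib_right)
  finally show "curvature B K X Y e f = vertical_2form B U x y C X Y e f" .
qed

end

section \<open>Tensor product connections\<close>

definition vtensor :: "real^'i::finite \<Rightarrow> real^'a::finite \<Rightarrow> real^('i \<times> 'a)" where
  "vtensor v v' = (\<chi> p. v $ fst p * v' $ snd p)"

lemma bounded_bilinear_vtensor: "bounded_bilinear vtensor"
  unfolding bilinear_conv_bounded_bilinear[symmetric] bilinear_def
  by (auto intro!: linearI simp: vtensor_def vec_eq_iff algebra_simps)

lemma axis_pair: "axis (j, b) 1 = vtensor (axis j 1) (axis b (1::real))"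
  by (auto simp: vtensor_def vec_eq_iff axis_def)

text \<open>The tensor product structure, read in coordinates. The condition on \<open>KT\<close> concerns decomposable
  tensors; it determines \<open>KT\<close> because the fibres have bases of decomposable tensors and a linear
  connection is linear in the fibre coordinate.\<close>

locale tensor_connection_coords =
  E: connection_coords E U x y K + E': connection_coords E' U x z K' + T: connection_coords T U x w KT
  for E :: "('m, 'e, 'n::finite, 'i::finite) vbundle" and E' :: "('m, 'f, 'n, 'a::finite) vbundle"
    and T :: "('m, 't, 'n, 'i \<times> 'a) vbundle" and U x y z w K K' KT +
  fixes tens :: "'e \<Rightarrow> 'f \<Rightarrow> 't"
  assumes tens: "\<And>m e e'. m \<in> U \<Longrightarrow> e \<in> fibre E m \<Longrightarrow> e' \<in> fibre E' m \<Longrightarrow> tens e e' \<in> fibre T m"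
    and KT: "\<And>e e'. e \<in> total E \<Longrightarrow> e' \<in> total E' \<Longrightarrow> proj E e = proj E' e' \<Longrightarrow>
        KT (tens e e') = jet_tensor E T tens (K e) (K' e')"
    and w: "\<And>m e e'. m \<in> U \<Longrightarrow> e \<in> fibre E m \<Longrightarrow> e' \<in> fibre E' m \<Longrightarrow> w (tens e e') = vtensor (y e) (z e')"
    and bases: "base E' = base E" "base T = base E"
begin

text \<open>The product rule, applied to the tensor product of sections representing \<open>K e\<close> and \<open>K' e'\<close>.\<close>

lemma horizontal_tens:
  assumes e: "e \<in> E.P" "e' \<in> E'.P" "proj E e = proj E' e'"
  shows "T.H (tens e e') a = vtensor (E.H e a) (z e') + vtensor (y e) (E'.H e' a)"
proof -
  define m where "m = proj E e"
  have m: "m \<in> U" "proj E e = m" "proj E' e' = m" using e by (auto simp: m_def)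
  have t: "tens e e' \<in> fibre T m" by (rule tens[OF m(1)]) (simp_all add: fibre_def m)
  then have p: "proj T (tens e e') = m" by (simp add: fibre_def)
  obtain W where W: "proj E e \<in> W" "W \<subseteq> U" "smooth_on (x ` W) (y \<circ> rep (K e) \<circ> inv_into U x)"
    "\<forall>q\<in>W. proj E (rep (K e) q) = q" using E.section_smooth[OF e(1)] .
  obtain W' where W': "proj E' e' \<in> W'" "W' \<subseteq> U" "smooth_on (x ` W') (z \<circ> rep (K' e') \<circ> inv_into U x)"
    "\<forall>q\<in>W'. proj E' (rep (K' e') q) = q" using E'.section_smooth[OF e(2)] .
  let ?S = "x ` W \<inter> x ` W'"
  have o: "open ?S" using smooth_on_open[OF W(3)] smooth_on_open[OF W'(3)] by auto
  have s: "smooth_on ?S (y \<circ> rep (K e) \<circ> inv_into U x)" "smooth_on ?S (z \<circ> rep (K' e') \<circ> inv_into U x)"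
    by (rule smooth_on_subset[OF W(3) o], simp, rule smooth_on_subset[OF W'(3) o], simp)
  have xS: "x m \<in> ?S" using W(1) W'(1) m by auto
  have K: "KT (tens e e') = j1 T m (\<lambda>q. tens (rep (K e) q) (rep (K' e') q))"
    unfolding KT[OF E.P_total[OF e(1)] E'.P_total[OF e(2)] e(3)] jet_tensor_def E.K_jet(2)[OF E.P_total[OF e(1)]] m(2) ..
  let ?F = "\<lambda>s. vtensor ((y \<circ> rep (K e) \<circ> inv_into U x) s) ((z \<circ> rep (K' e') \<circ> inv_into U x) s)"
  have "T.H (tens e e') a = frechet_derivative ?F (at (x (proj T (tens e e')))) a"
  proof (rule T.horizontal_eqI)
    show "tens e e' \<in> T.P" using p m by simp
    show "KT (tens e e') = j1 T (proj T (tens e e')) (\<lambda>q. tens (rep (K e) q) (rep (K' e') q))"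
      unfolding p by (rule K)
    show "smooth_on ?S ?F" by (rule smooth_on_bilinear[OF bounded_bilinear_vtensor s])
    show "x (proj T (tens e e')) \<in> ?S" unfolding p by (rule xS)
    show "?S \<subseteq> x ` U" using W(2) by auto
    fix q assume q: "q \<in> U" "x q \<in> ?S"
    then have qW: "q \<in> W" "q \<in> W'" using W(2) W'(2) local_chartD(1)[OF E.ch] by (auto simp: inj_on_def subset_iff)
    have "rep (K e) q \<in> fibre E q" "rep (K' e') q \<in> fibre E' q" using W(4) W'(4) qW by (auto simp: fibre_def)
    then show "w (tens (rep (K e) q) (rep (K' e') q)) = ?F (x q)"
      using w[OF q(1)] local_chartD(6)[OF E.ch q(1)] by simp
  qed
  also have "\<dots> = vtensor (E.H e a) (z e') + vtensor (y e) (E'.H e' a)"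
  proof -
    have i: "inv_into U x (x m) = m" by (rule local_chartD(6)[OF E.ch m(1)])
    have r: "rep (K e) m = e" "rep (K' e') m = e'"
      using E.rep_section(2)[OF E.P_total[OF e(1)]] E'.rep_section(2)[OF E'.P_total[OF e(2)]] unfolding m by auto
    show ?thesis
      unfolding p horizontal_def m(2,3)
      using fun_cong[OF frechet_derivative_at[OF bounded_bilinear.FDERIV[OF bounded_bilinear_vtensor
        smooth_on_has_derivative[OF s(1) xS] smooth_on_has_derivative[OF s(2) xS]]], of a]
      by (simp add: i r add.commute)
  qed
  finally show ?thesis .
qed

lemma G_tensor:
  assumes s: "s \<in> x ` U"
  shows "T.G s a (vtensor v v') = vtensor (E.G s a v) v' + vtensor v (E'.G s a v')"
proof -
  let ?e = "E.pt s v" and ?e' = "E'.pt s v'"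
  have p: "proj E ?e = proj E' ?e'" using E.proj_pt[OF s] E'.proj_pt[OF s] by simp
  have m: "proj E ?e \<in> U" using E.pt_in[OF s] by simp
  have f: "?e \<in> fibre E (proj E ?e)" "?e' \<in> fibre E' (proj E ?e)" using p by (auto simp: fibre_def)
  have t: "proj T (tens ?e ?e') = proj E ?e" "w (tens ?e ?e') = vtensor v v'"
    using tens[OF m f] w[OF m f] E.y_pt[OF s] E'.y_pt[OF s] by (auto simp: fibre_def)
  have "T.pt s (vtensor v v') = tens ?e ?e'"
    using T.pt_proj[of "tens ?e ?e'"] m unfolding t E.x_pt[OF s] by (simp add: t)
  then show ?thesis
    using horizontal_tens[OF E.pt_in[OF s] E'.pt_in[OF s] p] by (simp add: E.y_pt[OF s] E'.y_pt[OF s])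
qed

text \<open>Both \<open>T.G s a (T.G s b _)\<close> and the same with \<open>a\<close>, \<open>b\<close> exchanged contain the mixed terms
  \<open>vtensor (E.G s a v) (E'.G s b v')\<close> and \<open>vtensor (E.G s b v) (E'.G s a v')\<close>, so these cancel in the
  commutator.\<close>

lemma \<Omega>_tensor:
  assumes s: "s \<in> x ` U"
  shows "T.\<Omega> s a b (vtensor v v') = vtensor (E.\<Omega> s a b v) v' + vtensor v (E'.\<Omega> s a b v')"
proof -
  note bb = bounded_bilinear_vtensor
  have d: "frechet_derivative (\<lambda>s. T.G s a (vtensor v v')) (at s) b =
      vtensor (frechet_derivative (\<lambda>s. E.G s a v) (at s) b) v' + vtensor v (frechet_derivative (\<lambda>s. E'.G s a v') (at s) b)" for a b
  proof -
    have "((\<lambda>s. vtensor (E.G s a v) v' + vtensor v (E'.G s a v')) has_derivative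
      (\<lambda>b. vtensor (frechet_derivative (\<lambda>s. E.G s a v) (at s) b) v' + vtensor v (frechet_derivative (\<lambda>s. E'.G s a v') (at s) b))) (at s)"
      by (intro has_derivative_add bounded_linear.has_derivative[OF bounded_bilinear.bounded_linear_left[OF bb]]
          bounded_linear.has_derivative[OF bounded_bilinear.bounded_linear_right[OF bb]]
          smooth_on_has_derivative[OF E.G_smooth s] smooth_on_has_derivative[OF E'.G_smooth s])
    then have "((\<lambda>s. T.G s a (vtensor v v')) has_derivative
      (\<lambda>b. vtensor (frechet_derivative (\<lambda>s. E.G s a v) (at s) b) v' + vtensor v (frechet_derivative (\<lambda>s. E'.G s a v') (at s) b))) (at s)"
      by (rule has_derivative_transform_near[OF _ local_chartD(5)[OF E.ch] s]) (rule G_tensor[symmetric])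
    from fun_cong[OF frechet_derivative_at[OF this], of b] show ?thesis by simp
  qed
  show ?thesis
    by (simp add: T.\<Omega>_def E.\<Omega>_def E'.\<Omega>_def d G_tensor[OF s] linear_add[OF T.G_linear(2)[OF s]]
        bounded_bilinear.add_left[OF bb] bounded_bilinear.add_right[OF bb]
        bounded_bilinear.diff_left[OF bb] bounded_bilinear.diff_right[OF bb])
qed

lemma curv_coeff_tensor:
  assumes m: "m \<in> U"
  shows "curv_coeff T KT U x w (j, b) (i, a) l k m =
    curv_coeff E K U x y j i l k m * (if a = b then 1 else 0)
    + curv_coeff E' K' U x z b a l k m * (if i = j then 1 else 0)"
proof -
  have s: "x m \<in> x ` U" using m by simp
  show ?thesis
    unfolding T.curv_coeff_eq[OF m] E.curv_coeff_eq[OF m] E'.curv_coeff_eq[OF m] axis_pair \<Omega>_tensor[OF s]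
    by (simp add: vtensor_def axis_def)
qed

end

section \<open>Curvature of the tensor product connection\<close>

theorem theorem2p5:
  fixes M :: "('m, real^'n) atlas"
    and E :: "('m, 'e, 'n, 'i::finite) vbundle"
    and E' :: "('m, 'f, 'n, 'a::finite) vbundle"
    and T :: "('m, 't, 'n, 'i \<times> 'a) vbundle"
    and tens :: "'e \<Rightarrow> 'f \<Rightarrow> 't"
    and K :: "'e \<Rightarrow> ('m, 'e) jet"
    and K' :: "'f \<Rightarrow> ('m, 'f) jet"
    and KT :: "'t \<Rightarrow> ('m, 't) jet"
  assumes "vector_bundle E" and "base E = M"
    and "vector_bundle E'" and "base E' = M"
    and "tensor_bundle E E' T tens"
    and "linear_connection E K"
    and "linear_connection E' K'"
    and "tensor_connection E E' T tens K K' KT"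
    and "local_chart M U x"
    and "linear_fibre_coords E U y"
    and "linear_fibre_coords E' U z"
    and "induced_fibre_coords E E' T tens U y z w"
  shows "(\<forall>W X Y. W \<subseteq> proj T -` U \<longrightarrow> vector_field (total_atlas T) W X \<longrightarrow>
           vector_field (total_atlas T) W Y \<longrightarrow>
           (\<forall>t\<in>W.
              curvature T KT X Y t =
                vertical_2form T U x w
                  (\<lambda>(i, a) l k t. \<Sum>j\<in>UNIV. \<Sum>b\<in>UNIV.
                     curv_coeff T KT U x w (j, b) (i, a) l k (proj T t) * w t $ (j, b)) X Y t \<and>
              curvature T KT X Y t =
                vertical_2form T U x w
                  (\<lambda>(i, a) l k t.
                     (\<Sum>j\<in>UNIV. curv_coeff E K U x y j i l k (proj T t) * w t $ (j, a))
                     + (\<Sum>b\<in>UNIV. curv_coeff E' K' U x z b a l k (proj T t) * w t $ (i, b))) X Y t)) \<and>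
         (\<forall>m\<in>U. \<forall>j b i a l k.
           curv_coeff T KT U x w (j, b) (i, a) l k m =
             curv_coeff E K U x y j i l k m * (if a = b then 1 else 0)
             + curv_coeff E' K' U x z b a l k m * (if i = j then 1 else 0))"
proof -
  note tb = assms(5)[unfolded tensor_bundle_def]
  have vbT: "vector_bundle T" and bT: "base T = base E" using tb by simp_all
  have fT: "linear_fibre_coords T U w"
    using conjunct2[OF conjunct2[OF conjunct2[OF tb]]] assms(10-12) by simp
  have LT: "linear_connection T KT"
    and KT: "\<And>e e'. e \<in> total E \<Longrightarrow> e' \<in> total E' \<Longrightarrow> proj E e = proj E' e' \<Longrightarrow>
        KT (tens e e') = jet_tensor E T tens (K e) (K' e')"
    using assms(8) unfolding tensor_connection_def by simp_all
  have car: "m \<in> carrier (base E)" if "m \<in> U" for m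
    using mopenD(2)[OF linear_fibre_coordsD(1)[OF assms(10)]] that by auto
  interpret tensor_connection_coords E E' T U x y z w K K' KT tens
  proof unfold_locales
    show "tens e e' \<in> fibre T m" if "m \<in> U" "e \<in> fibre E m" "e' \<in> fibre E' m" for m e e'
      using tb car[OF that(1)] that(2,3) by simp
    show "w (tens e e') = vtensor (y e) (z e')" if "m \<in> U" "e \<in> fibre E m" "e' \<in> fibre E' m" for m e e'
      using assms(12) that unfolding induced_fibre_coords_def by (auto simp: vtensor_def vec_eq_iff)
  qed (use assms vbT bT fT LT KT in simp_all)
  have first: "(\<Sum>j\<in>UNIV. \<Sum>b\<in>UNIV. curv_coeff T KT U x w (j, b) p l k (proj T t) * w t $ (j, b)) =
      T.\<Omega> (x (proj T t)) (axis l 1) (axis k 1) (w t) $ p" if t: "t \<in> T.P" for p l k t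
  proof -
    have s: "x (proj T t) \<in> x ` U" and m: "proj T t \<in> U" using t by auto
    show ?thesis
      unfolding T.curv_coeff_eq[OF m] linear_eq_sum_axis[OF T.\<Omega>_linear(2)[OF s], of _ _ "w t"]
      by (simp add: sum.cartesian_product UNIV_Times_UNIV[symmetric] mult.commute case_prod_unfold
          del: UNIV_Times_UNIV)
  qed
  have delta: "(\<Sum>j\<in>UNIV. \<Sum>b\<in>UNIV. (f j * (if a = b then 1 else 0) + g b * (if i = j then 1 else 0)) * h j b) =
      (\<Sum>j\<in>UNIV. f j * h j a) + (\<Sum>b\<in>UNIV. g b * h i b)"
    for f :: "'i \<Rightarrow> real" and g :: "'a \<Rightarrow> real" and h i a
  proof -
    have "(\<Sum>b\<in>UNIV. f j * (if a = b then 1 else 0) * h j b) = (\<Sum>b\<in>UNIV. if a = b then f j * h j b else 0)" for j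
      by (rule sum.cong) auto
    then have 1: "(\<Sum>b\<in>UNIV. f j * (if a = b then 1 else 0) * h j b) = f j * h j a" for j by simp
    have "(\<Sum>j\<in>UNIV. \<Sum>b\<in>UNIV. g b * (if i = j then 1 else 0) * h j b) =
        (\<Sum>j\<in>UNIV. if i = j then \<Sum>b\<in>UNIV. g b * h j b else 0)"
      by (rule sum.cong) auto
    then have 2: "(\<Sum>j\<in>UNIV. \<Sum>b\<in>UNIV. g b * (if i = j then 1 else 0) * h j b) = (\<Sum>b\<in>UNIV. g b * h i b)"
      by simp
    show ?thesis by (simp only: distrib_right sum.distrib 1 2)
  qed
  have second: "(\<Sum>j\<in>UNIV. curv_coeff E K U x y j i l k (proj T t) * w t $ (j, a))
       + (\<Sum>b\<in>UNIV. curv_coeff E' K' U x z b a l k (proj T t) * w t $ (i, b)) =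
      T.\<Omega> (x (proj T t)) (axis l 1) (axis k 1) (w t) $ (i, a)" if t: "t \<in> T.P" for i a l k t
  proof -
    have m: "proj T t \<in> U" using t by auto
    show ?thesis
      unfolding first[OF t, symmetric] curv_coeff_tensor[OF m] delta ..
  qed
  show ?thesis
  proof (intro conjI allI impI ballI)
    fix W X Y t
    assume W: "W \<subseteq> proj T -` U" and XY: "vector_field (total_atlas T) W X" "vector_field (total_atlas T) W Y" and t: "t \<in> W"
    have tP: "t \<in> T.P" using W t by auto
    note cv = T.curvature_eq_vertical_2form[OF W XY t]
    show "curvature T KT X Y t = vertical_2form T U x w
          (\<lambda>(i, a) l k t. \<Sum>j\<in>UNIV. \<Sum>b\<in>UNIV. curv_coeff T KT U x w (j, b) (i, a) l k (proj T t) * w t $ (j, b)) X Y t"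
      by (rule cv) (simp add: first[OF tP] split: prod.split)
    show "curvature T KT X Y t = vertical_2form T U x w
          (\<lambda>(i, a) l k t. (\<Sum>j\<in>UNIV. curv_coeff E K U x y j i l k (proj T t) * w t $ (j, a))
             + (\<Sum>b\<in>UNIV. curv_coeff E' K' U x z b a l k (proj T t) * w t $ (i, b))) X Y t"
      by (rule cv) (simp add: second[OF tP] split: prod.split)
  qed (rule curv_coeff_tensor)
qed

end
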